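(* Let $\alpha>0$, $h\in H$ and $v_0\in V$. For $\nu>0$ let $v=v^{\nu}$ be the weak solution of the 3D Navier-Stokes-Voight problem $$v_t+\nu Av+\alpha^2Av_t+B(v,v)=h,\qquad v(0)=v_0,$$ and let $u$ be the weak solution of the inviscid simplified Bardina model $$u_t+\alpha^2Au_t+B(u,u)=h,\qquad u(0)=v_0.$$ Then for every $T>0$, $v^\nu\to u$ in $V$, uniformly on $[0,T]$, as $\nu\to0$. More precisely, there is a constant $C>0$ depending only on the shape of $\Omega$ such that for all $\nu>0$, all $T>0$ and all $t\in[0,T]$, the difference $w=v^\nu-u$ satisfies $$\|w(t)\|^2+\alpha^2\|w(t)\|_1^2\le \nu^2\,T D_T e^T\exp\!\left(\alpha^{-2}T+2C\alpha^{-2}\lambda_1^{-1/4}\,T D_T^{1/2}e^{T/2}\right),$$ where $D_T=\alpha^{-2}\left[\|v_0\|^2+\alpha^2\|v_0\|_1^2+T\alpha^{-2}\|h\|_{-1}^2\right]$.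
   Context: $\Omega\subset\mathbb R^3$ is a bounded domain with sufficiently smooth boundary. $\mathcal V=\{v\in (C_0^\infty(\Omega))^3:\nabla\cdot v=0\}$; $H$ is the closure of $\mathcal V$ in $(L^2(\Omega))^3$, with norm $\|\cdot\|$; $P$ is the orthogonal (Helmholtz-Leray) projection of $(L^2(\Omega))^3$ onto $H$; $A=-P\Delta$ is the Stokes operator with homogeneous Dirichlet boundary condition, with eigenvalues $0<\lambda_1\le\lambda_2\le\cdots$. $\|v\|_s=\|A^{s/2}v\|$ is the norm of $V_s=D(A^{s/2})$, $s\in\mathbb R$ (for $s<0$, defined as the completion); $V=V_1=(H_0^1(\Omega))^3\cap H$ with $\|v\|_1=\|\nabla v\|$, and $V'=V_{-1}$. $B(u,v)=P((u\cdot\nabla)v)$, extended to a continuous bilinear map $V\times V\to V'$. The forcing $h$ is time independent. Both problems have unique global solutions in $C^1([0,\infty);V)$, the equations being understood in $V'$; these are the weak solutions. "Depending only on the shape of $\Omega$" means: independent of $\nu,\alpha,h,v_0,T$ and unchanged when $\Omega$ is rescaled. *)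

theory Defs
  imports "HOL-Analysis.Analysis"
begin

section \<open>Smooth functions, test functions, domains\<close>

type_synonym point = "real ^ 3"
type_synonym field = "real ^ 3 \<Rightarrow> real ^ 3"

text \<open>\<open>Ck_on k S f\<close> is meant for open \<open>S\<close>.\<close>

primrec Ck_on ::
  "nat \<Rightarrow> 'a::real_normed_vector set \<Rightarrow> ('a \<Rightarrow> 'b::real_normed_vector) \<Rightarrow> bool" where
  "Ck_on 0 S f \<longleftrightarrow> continuous_on S f"
| "Ck_on (Suc k) S f \<longleftrightarrow>
     (\<forall>x\<in>S. f differentiable (at x)) \<and> (\<forall>d. Ck_on k S (\<lambda>x. frechet_derivative f (at x) d))"

definition test_functions :: "point set \<Rightarrow> (point \<Rightarrow> 'b::real_normed_vector) set" where
  "test_functions \<Omega> =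
     {f. (\<forall>k. Ck_on k UNIV f) \<and> (\<exists>K. compact K \<and> K \<subseteq> \<Omega> \<and> (\<forall>x. x \<notin> K \<longrightarrow> f x = 0))}"

definition partial_deriv :: "3 \<Rightarrow> (point \<Rightarrow> 'b::real_normed_vector) \<Rightarrow> point \<Rightarrow> 'b" where
  "partial_deriv j f x = frechet_derivative f (at x) (axis j 1)"

text \<open>Boundary of class \<open>C\<^sup>k\<close>, by local defining functions with nonvanishing differential.\<close>

definition Ck_boundary :: "nat \<Rightarrow> point set \<Rightarrow> bool" where
  "Ck_boundary k \<Omega> \<longleftrightarrow>
     (\<forall>p\<in>frontier \<Omega>. \<exists>U (\<rho> :: point \<Rightarrow> real).
        open U \<and> p \<in> U \<and> Ck_on k U \<rho> \<and>
        (\<forall>x\<in>U. frechet_derivative \<rho> (at x) \<noteq> (\<lambda>_. 0)) \<and>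
        \<Omega> \<inter> U = {x \<in> U. \<rho> x < 0} \<and> frontier \<Omega> \<inter> U = {x \<in> U. \<rho> x = 0})"

definition bounded_smooth_domain :: "point set \<Rightarrow> bool" where
  "bounded_smooth_domain \<Omega> \<longleftrightarrow>
     open \<Omega> \<and> connected \<Omega> \<and> \<Omega> \<noteq> {} \<and> bounded \<Omega> \<and> Ck_boundary 2 \<Omega>"


section \<open>Function spaces on a domain\<close>

text \<open>
  Elements of the Lebesgue and Sobolev spaces are represented by functions on the whole space, of
  which only the values on \<open>\<Omega>\<close>, up to null sets, matter.
\<close>

definition L2 :: "point set \<Rightarrow> (point \<Rightarrow> 'b::euclidean_space) set" where
  "L2 \<Omega> = {f. f \<in> borel_measurable (lebesgue_on \<Omega>) \<and>
              integrable (lebesgue_on \<Omega>) (\<lambda>x. (norm (f x))\<^sup>2)}"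

definition l2_inner ::
  "point set \<Rightarrow> (point \<Rightarrow> 'b::euclidean_space) \<Rightarrow> (point \<Rightarrow> 'b) \<Rightarrow> real" where
  "l2_inner \<Omega> f g = (LINT x|lebesgue_on \<Omega>. f x \<bullet> g x)"

definition l2_norm :: "point set \<Rightarrow> (point \<Rightarrow> 'b::euclidean_space) \<Rightarrow> real" where
  "l2_norm \<Omega> f = sqrt (l2_inner \<Omega> f f)"

text \<open>Weak gradient: the entry \<open>G x $ i $ j\<close> is the \<open>j\<close>-th weak derivative of the \<open>i\<close>-th component.\<close>

definition has_weak_grad :: "point set \<Rightarrow> field \<Rightarrow> (point \<Rightarrow> real ^ 3 ^ 3) \<Rightarrow> bool" where
  "has_weak_grad \<Omega> f G \<longleftrightarrow>
     (\<forall>\<phi> \<in> test_functions \<Omega>. \<forall>i j.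
        (LINT x|lebesgue_on \<Omega>. f x $ i * partial_deriv j \<phi> x) =
        - (LINT x|lebesgue_on \<Omega>. G x $ i $ j * \<phi> x))"

definition H1 :: "point set \<Rightarrow> field set" where
  "H1 \<Omega> = {f \<in> L2 \<Omega>. \<exists>G \<in> L2 \<Omega>. has_weak_grad \<Omega> f G}"

text \<open>Determined up to null sets for \<open>f \<in> H1 \<Omega>\<close>.\<close>

definition wgrad :: "point set \<Rightarrow> field \<Rightarrow> point \<Rightarrow> real ^ 3 ^ 3" where
  "wgrad \<Omega> f = (SOME G. G \<in> L2 \<Omega> \<and> has_weak_grad \<Omega> f G)"

definition H10 :: "point set \<Rightarrow> field set" where
  "H10 \<Omega> = {f \<in> H1 \<Omega>. \<exists>s. (\<forall>n. s n \<in> test_functions \<Omega>) \<and>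
       (\<lambda>n. l2_norm \<Omega> (\<lambda>x. s n x - f x)) \<longlonglongrightarrow> 0 \<and>
       (\<lambda>n. l2_norm \<Omega> (wgrad \<Omega> (\<lambda>x. s n x - f x))) \<longlonglongrightarrow> 0}"

definition solenoidal_test_fields :: "point set \<Rightarrow> field set" where
  "solenoidal_test_fields \<Omega> =
     {v \<in> test_functions \<Omega>. \<forall>x. (\<Sum>i\<in>UNIV. partial_deriv i v x $ i) = 0}"

definition H_space :: "point set \<Rightarrow> field set" where
  "H_space \<Omega> = {f \<in> L2 \<Omega>. \<exists>s. (\<forall>n. s n \<in> solenoidal_test_fields \<Omega>) \<and>
       (\<lambda>n. l2_norm \<Omega> (\<lambda>x. s n x - f x)) \<longlonglongrightarrow> 0}"

definition V_space :: "point set \<Rightarrow> field set" where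
  "V_space \<Omega> = H10 \<Omega> \<inter> H_space \<Omega>"

definition V_norm :: "point set \<Rightarrow> field \<Rightarrow> real" where
  "V_norm \<Omega> v = l2_norm \<Omega> (wgrad \<Omega> v)"


section \<open>The dual of \<open>V\<close> and the operators \<open>P\<close>, \<open>A\<close>, \<open>B\<close> with values in it\<close>

text \<open>
  Elements of \<open>V'\<close>, and more generally distributions that can be tested with fields in \<open>V\<close>, are
  functionals of type \<open>field \<Rightarrow> real\<close>. An \<open>L\<^sup>2\<close> field is identified with the functional \<open>l2_functional\<close>.
\<close>

definition l2_functional :: "point set \<Rightarrow> field \<Rightarrow> field \<Rightarrow> real" where
  "l2_functional \<Omega> f = (\<lambda>\<phi>. l2_inner \<Omega> f \<phi>)"

definition V_dual_norm :: "point set \<Rightarrow> (field \<Rightarrow> real) \<Rightarrow> real" where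
  "V_dual_norm \<Omega> F = (SUP \<phi>\<in>{\<phi> \<in> V_space \<Omega>. V_norm \<Omega> \<phi> \<le> 1}. \<bar>F \<phi>\<bar>)"

text \<open>
  \<open>P\<close> is the orthogonal projection onto \<open>H\<close>, i.e. the adjoint of the inclusion of \<open>H\<close> into \<open>L\<^sup>2\<close>. Its
  extension to functionals is the adjoint of the inclusion of \<open>V\<close>, i.e. restriction to \<open>V\<close>; the
  lemma below states that it agrees with the orthogonal projection wherever the latter applies.
\<close>

definition is_leray_projection :: "point set \<Rightarrow> field \<Rightarrow> field \<Rightarrow> bool" where
  "is_leray_projection \<Omega> f g \<longleftrightarrow>
     g \<in> H_space \<Omega> \<and> (\<forall>\<phi>\<in>H_space \<Omega>. l2_inner \<Omega> (\<lambda>x. f x - g x) \<phi> = 0)"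

definition leray :: "point set \<Rightarrow> (field \<Rightarrow> real) \<Rightarrow> field \<Rightarrow> real" where
  "leray \<Omega> F = restrict F (V_space \<Omega>)"

lemma integrable_inner_L2:
  fixes f g :: "point \<Rightarrow> 'b::euclidean_space"
  assumes "f \<in> L2 \<Omega>" "g \<in> L2 \<Omega>"
  shows "integrable (lebesgue_on \<Omega>) (\<lambda>x. f x \<bullet> g x)"
proof (rule Bochner_Integration.integrable_bound)
  show "integrable (lebesgue_on \<Omega>) (\<lambda>x. (norm (f x))\<^sup>2 + (norm (g x))\<^sup>2)"
    using assms by (auto simp: L2_def)
  show "(\<lambda>x. f x \<bullet> g x) \<in> borel_measurable (lebesgue_on \<Omega>)"
    using assms by (auto simp: L2_def)
  have "\<bar>a \<bullet> b\<bar> \<le> (norm a)\<^sup>2 + (norm b)\<^sup>2" for a b :: 'b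
  proof -
    have "\<bar>a \<bullet> b\<bar> \<le> norm a * norm b" by (rule Cauchy_Schwarz_ineq2)
    also have "\<dots> \<le> (norm a)\<^sup>2 + (norm b)\<^sup>2"
      using sum_squares_bound[of "norm a" "norm b"] zero_le_power2[of "norm a"]
        zero_le_power2[of "norm b"] mult_nonneg_nonneg[OF norm_ge_zero[of a] norm_ge_zero[of b]]
      by linarith
    finally show ?thesis .
  qed
  then show "AE x in lebesgue_on \<Omega>. norm (f x \<bullet> g x) \<le> norm ((norm (f x))\<^sup>2 + (norm (g x))\<^sup>2)"
    by (auto intro!: AE_I2)
qed

lemma leray_eq_projection:
  assumes "f \<in> L2 \<Omega>" "is_leray_projection \<Omega> f g"
    and "\<And>\<phi>. \<phi> \<in> V_space \<Omega> \<Longrightarrow> F \<phi> = l2_functional \<Omega> f \<phi>"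
    and "\<phi> \<in> V_space \<Omega>"
  shows "leray \<Omega> F \<phi> = l2_functional \<Omega> g \<phi>"
proof -
  have "\<phi> \<in> H_space \<Omega>" "g \<in> L2 \<Omega>" "\<phi> \<in> L2 \<Omega>"
    using assms by (auto simp: V_space_def H_space_def is_leray_projection_def)
  moreover have "l2_inner \<Omega> (\<lambda>x. f x - g x) \<phi> = 0"
    using assms \<open>\<phi> \<in> H_space \<Omega>\<close> by (auto simp: is_leray_projection_def)
  ultimately show ?thesis
    using assms integrable_inner_L2[of f \<Omega> \<phi>] integrable_inner_L2[of g \<Omega> \<phi>]
    by (simp add: leray_def l2_functional_def l2_inner_def inner_diff_left)
qed

text \<open>The distributional Laplacian of a field in \<open>H1\<close>, as a functional on \<open>H10\<close>.\<close>

definition vector_laplacian :: "point set \<Rightarrow> field \<Rightarrow> field \<Rightarrow> real" where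
  "vector_laplacian \<Omega> v = (\<lambda>\<phi>. - l2_inner \<Omega> (wgrad \<Omega> v) (wgrad \<Omega> \<phi>))"

definition stokes :: "point set \<Rightarrow> field \<Rightarrow> field \<Rightarrow> real" where
  "stokes \<Omega> v = leray \<Omega> (\<lambda>\<phi>. - vector_laplacian \<Omega> v \<phi>)"

text \<open>\<open>wgrad \<Omega> v x *v u x\<close> is the value at \<open>x\<close> of \<open>(u \<cdot> \<nabla>)v\<close>.\<close>

definition bilin_B :: "point set \<Rightarrow> field \<Rightarrow> field \<Rightarrow> field \<Rightarrow> real" where
  "bilin_B \<Omega> u v = leray \<Omega> (l2_functional \<Omega> (\<lambda>x. wgrad \<Omega> v x *v u x))"

text \<open>
  The equation \<open>A w = \<mu> w\<close> is read in \<open>V'\<close>. Its right-hand side lies in \<open>H\<close>, so that every solution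
  belongs to the domain of \<open>A\<close> as an unbounded operator in \<open>H\<close>.
\<close>

definition stokes_eigenvalue :: "point set \<Rightarrow> real \<Rightarrow> bool" where
  "stokes_eigenvalue \<Omega> \<mu> \<longleftrightarrow>
     (\<exists>w\<in>V_space \<Omega>. l2_norm \<Omega> w \<noteq> 0 \<and>
        (\<forall>\<phi>\<in>V_space \<Omega>. stokes \<Omega> w \<phi> = l2_functional \<Omega> (\<lambda>x. \<mu> *\<^sub>R w x) \<phi>))"

definition stokes_lambda1 :: "point set \<Rightarrow> real" where
  "stokes_lambda1 \<Omega> = Inf {\<mu>. stokes_eigenvalue \<Omega> \<mu>}"


section \<open>Weak solutions\<close>

text \<open>\<open>v \<in> C\<^sup>1([0,\<infinity>); V)\<close> with time derivative \<open>v'\<close>, one-sided at time \<open>0\<close>.\<close>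

definition C1_in_V :: "point set \<Rightarrow> (real \<Rightarrow> field) \<Rightarrow> (real \<Rightarrow> field) \<Rightarrow> bool" where
  "C1_in_V \<Omega> v v' \<longleftrightarrow>
     (\<forall>t\<ge>0. v t \<in> V_space \<Omega> \<and> v' t \<in> V_space \<Omega> \<and>
        ((\<lambda>s. V_norm \<Omega> (\<lambda>x. (v s x - v t x) /\<^sub>R (s - t) - v' t x)) \<longlongrightarrow> 0) (at t within {0..}) \<and>
        ((\<lambda>s. V_norm \<Omega> (\<lambda>x. v' s x - v' t x)) \<longlongrightarrow> 0) (at t within {0..}))"

definition NSV_weak_solution ::
  "point set \<Rightarrow> real \<Rightarrow> real \<Rightarrow> field \<Rightarrow> field \<Rightarrow> (real \<Rightarrow> field) \<Rightarrow> bool" where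
  "NSV_weak_solution \<Omega> \<nu> \<alpha> h v0 v \<longleftrightarrow>
     (\<exists>v'. C1_in_V \<Omega> v v' \<and>
        (\<forall>t\<ge>0. \<forall>\<phi>\<in>V_space \<Omega>.
           l2_functional \<Omega> (v' t) \<phi> + \<nu> * stokes \<Omega> (v t) \<phi> + \<alpha>\<^sup>2 * stokes \<Omega> (v' t) \<phi>
             + bilin_B \<Omega> (v t) (v t) \<phi> = l2_functional \<Omega> h \<phi>)) \<and>
     (AE x in lebesgue_on \<Omega>. v 0 x = v0 x)"

definition Bardina_weak_solution ::
  "point set \<Rightarrow> real \<Rightarrow> field \<Rightarrow> field \<Rightarrow> (real \<Rightarrow> field) \<Rightarrow> bool" where
  "Bardina_weak_solution \<Omega> \<alpha> h v0 u \<longleftrightarrow>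
     (\<exists>u'. C1_in_V \<Omega> u u' \<and>
        (\<forall>t\<ge>0. \<forall>\<phi>\<in>V_space \<Omega>.
           l2_functional \<Omega> (u' t) \<phi> + \<alpha>\<^sup>2 * stokes \<Omega> (u' t) \<phi>
             + bilin_B \<Omega> (u t) (u t) \<phi> = l2_functional \<Omega> h \<phi>)) \<and>
     (AE x in lebesgue_on \<Omega>. u 0 x = v0 x)"

definition D_const :: "point set \<Rightarrow> real \<Rightarrow> field \<Rightarrow> field \<Rightarrow> real \<Rightarrow> real" where
  "D_const \<Omega> \<alpha> h v0 T =
     ((l2_norm \<Omega> v0)\<^sup>2 + \<alpha>\<^sup>2 * (V_norm \<Omega> v0)\<^sup>2
        + T * (V_dual_norm \<Omega> (l2_functional \<Omega> h))\<^sup>2 / \<alpha>\<^sup>2) / \<alpha>\<^sup>2"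

end

theory Submission
  imports Defs "HOL-Complex_Analysis.Great_Picard" "HOL-Real_Asymp.Real_Asymp"
begin

text \<open>
  Testing the Navier-Stokes-Voight equation with its solution bounds the squared \<open>V\<close>-norm on \<open>[0, T]\<close>
  by \<open>D\<^sub>T e\<^sup>T\<close>, independently of \<open>\<nu>\<close>. Testing the equation for \<open>w = v - u\<close> with \<open>w\<close> leaves, besides the
  viscous term \<open>\<nu> (\<nabla>v, \<nabla>w)\<close>, only
  \<open>((w \<cdot> \<nabla>)u, w)\<close>, since \<open>((v \<cdot> \<nabla>)w, w) = 0\<close>. Ladyzhenskaya's inequality
  \<open>\<parallel>w\<parallel>\<^sub>4\<^sup>2 \<le> sqrt 8 \<parallel>w\<parallel>\<^sup>1\<^sup>/\<^sup>2 \<parallel>\<nabla>w\<parallel>\<^sup>3\<^sup>/\<^sup>2\<close> and \<open>\<lambda>\<^sub>1 \<parallel>w\<parallel>\<^sup>2 \<le> \<parallel>\<nabla>w\<parallel>\<^sup>2\<close> bound that term by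
  \<open>sqrt 8 \<lambda>\<^sub>1\<^sup>-\<^sup>1\<^sup>/\<^sup>4 \<parallel>\<nabla>w\<parallel>\<^sup>2 \<parallel>\<nabla>u\<parallel>\<close>, so that \<open>C = sqrt 8\<close> serves for all domains, and Gronwall's lemma concludes.
  The inequality involving \<open>\<lambda>\<^sub>1\<close> requires that the infimum of the Rayleigh quotient is an
  eigenvalue, which is derived from Rellich's compactness theorem.
\<close>

section \<open>Smooth functions\<close>

text \<open>Fields are representatives up to null sets and \<open>wgrad\<close> is a choice, so even
  the linearity of the gradient holds only almost everywhere and rests on the fundamental lemma of
  the calculus of variations. The value \<open>stokes_lambda1\<close> is an infimum over a set that
  might be empty, so an eigenfunction has to be produced before an inequality with it can be used.
  \<open>V_space\<close> is the intersection of \<open>H10\<close> and \<open>H_space\<close>: its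
  elements come with approximations by test functions in the gradient norm, and with others by
  solenoidal fields in \<open>L2\<close> only. The cancellation of the convective term respects
  this: the solenoidal approximation is used for the transporting field alone, the gradient
  approximation for the transported one. The number 8 under the root arises from the derivative of
  |w|^2, bounded by 2 |w| |nabla w|: the factor 2 enters as 4^3 = 64, and two square roots are
  taken. The Bardina model is the case \<nu> = 0, so one energy estimate bounds both solutions.
  Young's inequality for the viscous term produces \<nu>^2 and the exponent T / \<alpha>^2.\<close>

lemma frechet_derivative_eqI:
  "(f has_derivative f') (at x) \<Longrightarrow> frechet_derivative f (at x) = f'"
  by (metis frechet_derivative_at)

lemma Ck_on_const: "Ck_on k S (\<lambda>_. c)"
proof (induction k arbitrary: c)
  case (Suc k)
  have "frechet_derivative (\<lambda>_. c) (at x) = (\<lambda>_. 0)" for x :: 'a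
    by (rule frechet_derivative_eqI) auto
  then show ?case using Suc by auto
qed auto

text \<open>\<open>Ck_on\<close> of positive order records differentiability but not continuity of
  the function itself, so the descent to order 0 goes through differentiability.\<close>

lemma Ck_on_SucD: "Ck_on (Suc k) S f \<Longrightarrow> Ck_on k S f"
proof (induction k arbitrary: f)
  case 0
  then show ?case
    by (auto intro!: continuous_at_imp_continuous_on differentiable_imp_continuous_within)
next
  case (Suc k)
  then show ?case by (metis Ck_on.simps(2))
qed

lemma Ck_on_linear:
  assumes "bounded_linear L"
  shows "Ck_on k UNIV f \<Longrightarrow> Ck_on k UNIV (\<lambda>x. L (f x))"
proof (induction k arbitrary: f)
  case 0
  then show ?case
    using bounded_linear.continuous_on[OF assms] by auto
next
  case (Suc k)
  have D: "((\<lambda>x. L (f x)) has_derivative (\<lambda>d. L (frechet_derivative f (at x) d))) (at x)" for x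
    using Suc.prems by (auto intro!: bounded_linear.has_derivative[OF assms] simp: frechet_derivative_works)
  have *: "frechet_derivative (\<lambda>x. L (f x)) (at x) d = L (frechet_derivative f (at x) d)" for x d
    using frechet_derivative_eqI[OF D] by simp
  show ?case
    using Suc D by (auto simp: * differentiable_def)
qed

lemma Ck_on_add:
  "Ck_on k UNIV f \<Longrightarrow> Ck_on k UNIV g \<Longrightarrow> Ck_on k UNIV (\<lambda>x. f x + g x)"
proof (induction k arbitrary: f g)
  case 0
  then show ?case by (auto intro: continuous_intros)
next
  case (Suc k)
  have D: "((\<lambda>x. f x + g x) has_derivative
      (\<lambda>d. frechet_derivative f (at x) d + frechet_derivative g (at x) d)) (at x)" for x
    using Suc.prems by (auto intro!: has_derivative_add simp: frechet_derivative_works)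
  have *: "frechet_derivative (\<lambda>x. f x + g x) (at x) d
      = frechet_derivative f (at x) d + frechet_derivative g (at x) d" for x d
    using frechet_derivative_eqI[OF D] by simp
  show ?case
    using Suc D by (auto simp: * differentiable_def)
qed

text \<open>The Leibniz rule once for all products used below, multiplication of reals and the inner
  product. Both factors vary in the induction, since each summand of the derivative differentiates
  one of them.\<close>

lemma Ck_on_bilinear:
  assumes "bounded_bilinear B"
  shows "Ck_on k UNIV f \<Longrightarrow> Ck_on k UNIV g \<Longrightarrow> Ck_on k UNIV (\<lambda>x. B (f x) (g x))"
proof (induction k arbitrary: f g)
  case 0
  then show ?case using bounded_bilinear.continuous_on[OF assms] by auto
next
  case (Suc k)
  have D: "((\<lambda>x. B (f x) (g x)) has_derivative
      (\<lambda>d. B (f x) (frechet_derivative g (at x) d) + B (frechet_derivative f (at x) d) (g x)))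
      (at x)" for x
    using Suc.prems by (auto intro!: bounded_bilinear.FDERIV[OF assms] simp: frechet_derivative_works)
  have *: "frechet_derivative (\<lambda>x. B (f x) (g x)) (at x) d
      = B (f x) (frechet_derivative g (at x) d) + B (frechet_derivative f (at x) d) (g x)" for x d
    using frechet_derivative_eqI[OF D] by simp
  have "Ck_on k UNIV f" "Ck_on k UNIV g"
    using Suc.prems Ck_on_SucD by blast+
  then have "Ck_on k UNIV (\<lambda>x. frechet_derivative (\<lambda>x. B (f x) (g x)) (at x) d)" for d
    using Suc unfolding * by (intro Ck_on_add Suc.IH) auto
  then show ?case
    using D by (auto simp: differentiable_def)
qed

lemma Ck_on_prod:
  fixes f :: "'i \<Rightarrow> 'a::real_normed_vector \<Rightarrow> real"
  assumes "finite I" "\<And>i. i \<in> I \<Longrightarrow> Ck_on k UNIV (f i)"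
  shows "Ck_on k UNIV (\<lambda>x. \<Prod>i\<in>I. f i x)"
  using assms
proof (induction I rule: finite_induct)
  case (insert i I)
  then show ?case
    using Ck_on_bilinear[OF bounded_bilinear_mult, of k "f i" "\<lambda>x. \<Prod>i\<in>I. f i x"] by simp
qed (simp add: Ck_on_const)

section \<open>A smooth function that is flat at the origin\<close>

text \<open>The case \<open>n = 0\<close> is the classical function exp (-1/s), extended by 0. The
  powers of 1/s are included because the derivative of a member is a combination of later members,
  so the family is closed under differentiation.\<close>

definition flat_exp :: "nat \<Rightarrow> real \<Rightarrow> real" where
  "flat_exp n s = (if s > 0 then (1 / s) ^ n * exp (- (1 / s)) else 0)"

text \<open>Substituting x = 1/s turns the right-hand limit into that of x^n / exp x at infinity; on
  the left the function vanishes.\<close>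

lemma flat_exp_tendsto_0: "(flat_exp n \<longlongrightarrow> 0) (at 0)"
proof -
  have "((\<lambda>x. x ^ n / exp x) \<longlongrightarrow> 0) (at_top :: real filter)"
    by (rule tendsto_power_div_exp_0)
  then have "((\<lambda>s. (inverse s) ^ n / exp (inverse s)) \<longlongrightarrow> 0) (at_right (0::real))"
    by (rule filterlim_compose[OF _ filterlim_inverse_at_top_right])
  moreover have "eventually (\<lambda>s. (inverse s) ^ n / exp (inverse s) = flat_exp n s) (at_right (0::real))"
    by (auto simp: eventually_at_filter flat_exp_def exp_minus field_simps)
  ultimately have "(flat_exp n \<longlongrightarrow> 0) (at_right 0)"
    by (rule Lim_transform_eventually)
  moreover have "(flat_exp n \<longlongrightarrow> 0) (at_left 0)"
    by (rule tendsto_eventually) (auto simp: eventually_at_filter flat_exp_def)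
  ultimately show ?thesis
    by (simp add: filterlim_split_at_real filterlim_at_split)
qed

lemma flat_exp_deriv:
  "(flat_exp n has_real_derivative - real n * flat_exp (Suc n) s + flat_exp (n + 2) s) (at s)"
proof -
  consider "s < 0" | "s = 0" | "s > 0" by linarith
  then show ?thesis
  proof cases
    case 1
    have "((\<lambda>_. 0) has_real_derivative 0) (at s)" by simp
    then have "(flat_exp n has_real_derivative 0) (at s)"
      by (rule has_field_derivative_transform_within_open[of _ _ _ "{..<0}"])
        (use 1 in \<open>auto simp: flat_exp_def\<close>)
    then show ?thesis using 1 by (simp add: flat_exp_def)
  next
    case 2
    \<comment> \<open>The difference quotient at 0 is the next member of the family, which tends to
      0.\<close>
    have eq: "flat_exp n h / h = flat_exp (Suc n) h" for h
      by (simp add: flat_exp_def)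
    have "(flat_exp n has_real_derivative 0) (at 0)"
      using flat_exp_tendsto_0[of "Suc n"] unfolding DERIV_def
      by (simp add: eq flat_exp_def[of n 0])
    then show ?thesis using 2 by (simp add: flat_exp_def)
  next
    case 3
    have "((\<lambda>s. (1 / s) ^ n * exp (- (1 / s))) has_real_derivative
        - real n * ((1 / s) ^ Suc n * exp (- (1 / s))) + (1 / s) ^ (n + 2) * exp (- (1 / s))) (at s)"
    proof -
      \<comment> \<open>For g = 1/s one has g' = - g^2, so the derivative becomes a polynomial in g
        times the exponential.\<close>
      define g where "g s = 1 / s" for s :: real
      have r: "(g has_real_derivative - ((g s)\<^sup>2)) (at s)"
        unfolding g_def[abs_def] using 3
        by (auto intro!: derivative_eq_intros simp: power2_eq_square)
      have "((\<lambda>s. g s ^ n * exp (- g s)) has_real_derivative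
        - real n * (g s ^ Suc n * exp (- g s)) + g s ^ (n + 2) * exp (- g s)) (at s)"
        by (rule DERIV_cong[OF DERIV_mult[OF DERIV_power[OF r] DERIV_fun_exp[OF DERIV_minus[OF r]]]])
          (cases n; simp add: power2_eq_square algebra_simps)
      then show ?thesis by (simp only: g_def)
    qed
    then have "(flat_exp n has_real_derivative
        - real n * ((1 / s) ^ Suc n * exp (- (1 / s))) + (1 / s) ^ (n + 2) * exp (- (1 / s))) (at s)"
      by (rule has_field_derivative_transform_within_open[of _ _ _ "{0<..}"])
        (use 3 in \<open>auto simp: flat_exp_def\<close>)
    then show ?thesis using 3 by (simp add: flat_exp_def)
  qed
qed

text \<open>The induction on the order runs for all \<open>n\<close> at once, as differentiation
  leads from \<open>n\<close> to \<open>n + 1\<close> and \<open>n + 2\<close>. The affine argument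
  is what the faces of a box require.\<close>

lemma Ck_on_flat_exp:
  fixes L :: "'a::real_normed_vector \<Rightarrow> real"
  assumes L: "bounded_linear L"
  shows "Ck_on k UNIV (\<lambda>x. flat_exp n (L x + c))"
proof (induction k arbitrary: n)
  case 0
  have "continuous_on UNIV (flat_exp n)"
    using flat_exp_deriv by (meson DERIV_isCont continuous_at_imp_continuous_on)
  moreover have "continuous_on UNIV (\<lambda>x. L x + c)"
    using linear_continuous_on[OF L] by (auto intro: continuous_intros)
  ultimately have "continuous_on UNIV (flat_exp n \<circ> (\<lambda>x. L x + c))"
    by (intro continuous_on_compose) (auto intro: continuous_on_subset)
  then show ?case by (simp add: o_def)
next
  case (Suc k)
  let ?D = "\<lambda>s. - real n * flat_exp (Suc n) s + flat_exp (n + 2) s"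
  have D: "((\<lambda>x. flat_exp n (L x + c)) has_derivative (\<lambda>d. ?D (L x + c) * L d)) (at x)" for x
  proof -
    have 1: "((\<lambda>x. L x + c) has_derivative L) (at x)"
      using bounded_linear_imp_has_derivative[OF L] by (auto intro!: derivative_eq_intros)
    show ?thesis
      using DERIV_compose_FDERIV[OF flat_exp_deriv 1] by (simp add: mult.commute)
  qed
  have *: "frechet_derivative (\<lambda>x. flat_exp n (L x + c)) (at x) d = L d * (- real n) * flat_exp (Suc n) (L x + c)
      + L d * flat_exp (n + 2) (L x + c)" for x d
    using frechet_derivative_eqI[OF D] by (simp add: algebra_simps)
  have "Ck_on k UNIV (\<lambda>x. frechet_derivative (\<lambda>x. flat_exp n (L x + c)) (at x) d)" for d
    unfolding * by (intro Ck_on_add Ck_on_linear[OF bounded_linear_mult_right] Suc)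
  then show ?case
    using D by (auto simp: differentiable_def)
qed

section \<open>Test functions\<close>

lemma test_functions_I:
  assumes "\<And>k. Ck_on k UNIV f" "compact K" "K \<subseteq> \<Omega>" "\<And>x. x \<notin> K \<Longrightarrow> f x = 0"
  shows "f \<in> test_functions \<Omega>"
  using assms unfolding test_functions_def by blast

lemma test_functions_smooth: "f \<in> test_functions \<Omega> \<Longrightarrow> Ck_on k UNIV f"
  unfolding test_functions_def by blast

lemma test_functions_zero: "f \<in> test_functions \<Omega> \<Longrightarrow> x \<notin> \<Omega> \<Longrightarrow> f x = 0"
  unfolding test_functions_def by blast

lemma test_functions_const_0: "(\<lambda>_. 0) \<in> test_functions \<Omega>"
  by (rule test_functions_I[of _ "{}"]) (auto simp: Ck_on_const)

lemma test_functions_add: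
  assumes "f \<in> test_functions \<Omega>" "g \<in> test_functions \<Omega>"
  shows "(\<lambda>x. f x + g x) \<in> test_functions \<Omega>"
proof -
  obtain K L where "compact K" "K \<subseteq> \<Omega>" "\<And>x. x \<notin> K \<Longrightarrow> f x = 0"
    "compact L" "L \<subseteq> \<Omega>" "\<And>x. x \<notin> L \<Longrightarrow> g x = 0"
    using assms unfolding test_functions_def by blast
  then show ?thesis
    using assms by (intro test_functions_I[of _ "K \<union> L"] Ck_on_add compact_Un)
      (auto simp: test_functions_smooth)
qed

lemma test_functions_linear:
  assumes "bounded_linear L" "f \<in> test_functions \<Omega>"
  shows "(\<lambda>x. L (f x)) \<in> test_functions \<Omega>"
proof -
  obtain K where "compact K" "K \<subseteq> \<Omega>" "\<And>x. x \<notin> K \<Longrightarrow> f x = 0"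
    using assms unfolding test_functions_def by blast
  then show ?thesis
    by (intro test_functions_I[of _ K] Ck_on_linear[OF assms(1) test_functions_smooth[OF assms(2)]])
      (auto simp: linear_0[OF bounded_linear.linear[OF assms(1)]])
qed

lemma test_functions_bilinear:
  assumes "bounded_bilinear B" "f \<in> test_functions \<Omega>" "g \<in> test_functions \<Omega>"
  shows "(\<lambda>x. B (f x) (g x)) \<in> test_functions \<Omega>"
proof -
  obtain K where "compact K" "K \<subseteq> \<Omega>" "\<And>x. x \<notin> K \<Longrightarrow> f x = 0"
    using assms unfolding test_functions_def by blast
  then show ?thesis
    by (intro test_functions_I[of _ K]
        Ck_on_bilinear[OF assms(1) test_functions_smooth[OF assms(2)] test_functions_smooth[OF assms(3)]])
      (auto simp: bounded_bilinear.zero_left[OF assms(1)])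
qed

lemma test_functions_diff:
  assumes "f \<in> test_functions \<Omega>" "g \<in> test_functions \<Omega>"
  shows "(\<lambda>x. f x - g x) \<in> test_functions \<Omega>"
  using test_functions_add[OF assms(1) test_functions_linear[OF bounded_linear_minus[OF bounded_linear_ident] assms(2)]]
  by simp

lemma test_functions_scaleR: "f \<in> test_functions \<Omega> \<Longrightarrow> (\<lambda>x. c *\<^sub>R f x) \<in> test_functions \<Omega>"
  by (rule test_functions_linear[OF bounded_linear_scaleR_right])

lemma test_functions_nth: "f \<in> test_functions \<Omega> \<Longrightarrow> (\<lambda>x. f x $ i) \<in> test_functions \<Omega>"
  by (rule test_functions_linear[OF bounded_linear_vec_nth])

lemma test_functions_continuous: "f \<in> test_functions \<Omega> \<Longrightarrow> continuous_on S f"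
  using test_functions_smooth[of f \<Omega> 0] continuous_on_subset by auto

lemma test_functions_differentiable: "f \<in> test_functions \<Omega> \<Longrightarrow> f differentiable (at x)"
  using test_functions_smooth[of f \<Omega> 1] by auto

lemma test_functions_has_derivative:
  "f \<in> test_functions \<Omega> \<Longrightarrow> (f has_derivative frechet_derivative f (at x)) (at x)"
  using test_functions_differentiable frechet_derivative_works by blast

text \<open>Off its compact set the function vanishes on an open set, so the same compact set serves
  for the derivative.\<close>

lemma test_functions_frechet:
  assumes "f \<in> test_functions \<Omega>"
  shows "(\<lambda>x. frechet_derivative f (at x) d) \<in> test_functions \<Omega>"
proof -
  obtain K where K: "compact K" "K \<subseteq> \<Omega>" "\<And>x. x \<notin> K \<Longrightarrow> f x = 0"
    using assms unfolding test_functions_def by blast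
  have "frechet_derivative f (at x) = (\<lambda>_. 0)" if "x \<notin> K" for x
  proof (rule frechet_derivative_eqI)
    show "(f has_derivative (\<lambda>_. 0)) (at x)"
      by (rule has_derivative_transform_within_open[of "\<lambda>_. 0" _ _ _ "- K"])
        (use that K compact_imp_closed in auto)
  qed
  then have "frechet_derivative f (at x) d = 0" if "x \<notin> K" for x
    using that by simp
  moreover have "Ck_on k UNIV (\<lambda>x. frechet_derivative f (at x) d)" for k
    using test_functions_smooth[OF assms, of "Suc k"] by simp
  ultimately show ?thesis
    using K by (intro test_functions_I)
qed

lemma test_functions_partial_deriv:
  "f \<in> test_functions \<Omega> \<Longrightarrow> partial_deriv j f \<in> test_functions \<Omega>"
  using test_functions_frechet[of f \<Omega> "axis j 1"] by (simp add: partial_deriv_def[abs_def])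

lemma test_functions_bounded:
  assumes "f \<in> test_functions \<Omega>"
  obtains B where "B \<ge> 0" "\<And>x. norm (f x) \<le> B"
proof -
  obtain K where K: "compact K" "K \<subseteq> \<Omega>" "\<And>x. x \<notin> K \<Longrightarrow> f x = 0"
    using assms unfolding test_functions_def by blast
  have "compact (f ` K)"
    using K(1) test_functions_continuous[OF assms] by (rule compact_continuous_image[rotated])
  then obtain B where B: "\<And>y. y \<in> f ` K \<Longrightarrow> norm y \<le> B"
    using bounded_iff compact_imp_bounded by metis
  have "norm (f x) \<le> max B 0" for x
    using B[of "f x"] K(3)[of x] by (cases "x \<in> K") auto
  then show ?thesis using that[of "max B 0"] by auto
qed

section \<open>Approximation of indicators by test functions\<close>

text \<open>One flat factor per face of the box. The factor \<open>n\<close> in front of the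
  distance s to a face drives the exponent -1/(n s - 1) to 0, so the product tends to 1 in the
  interior.\<close>

lemma exists_test_function_box:
  assumes "box a b \<subseteq> \<Omega>"
  shows "\<exists>\<phi>. (\<forall>n. \<phi> n \<in> test_functions \<Omega>) \<and> (\<forall>n x. 0 \<le> \<phi> n x \<and> \<phi> n x \<le> (1::real)) \<and>
     (\<forall>n x. x \<notin> box a b \<longrightarrow> \<phi> n x = 0) \<and> (\<forall>x\<in>box a b. (\<lambda>n. \<phi> n x) \<longlonglongrightarrow> 1)"
proof -
  \<comment> \<open>The shift by \<open>1\<close> moves the support into a compact subset of the open box.\<close>
  define \<phi> where "\<phi> n x = (\<Prod>i\<in>UNIV. flat_exp 0 (real n * (x $ i - a $ i) - 1) *
      flat_exp 0 (real n * (b $ i - x $ i) - 1))" for n and x :: point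
  have 01: "0 \<le> flat_exp 0 s" "flat_exp 0 s \<le> 1" for s
    by (auto simp: flat_exp_def)
  have out: "\<phi> n x = 0" if *: "\<exists>i. \<not> (1 \<le> real n * (x $ i - a $ i) \<and> 1 \<le> real n * (b $ i - x $ i))" for n x
  proof -
    obtain i where "\<not> (1 \<le> real n * (x $ i - a $ i) \<and> 1 \<le> real n * (b $ i - x $ i))"
      using * by blast
    then have "flat_exp 0 (real n * (x $ i - a $ i) - 1) * flat_exp 0 (real n * (b $ i - x $ i) - 1) = 0"
      by (auto simp: flat_exp_def)
    then show ?thesis unfolding \<phi>_def by (intro prod_zero) auto
  qed
  have sub: "x \<in> box a b" if "\<forall>i. 1 \<le> real n * (x $ i - a $ i) \<and> 1 \<le> real n * (b $ i - x $ i)" for n x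
  proof -
    have "a $ i < x $ i \<and> x $ i < b $ i" for i
    proof -
      have "0 < real n * (x $ i - a $ i)" "0 < real n * (b $ i - x $ i)"
        using that by (smt (verit))+
      then show ?thesis by (auto simp: zero_less_mult_iff)
    qed
    then show ?thesis by (simp add: mem_box_cart)
  qed
  have "\<phi> n \<in> test_functions \<Omega>" for n
  proof (rule test_functions_I)
    let ?K = "{x. \<forall>i. 1 \<le> real n * (x $ i - a $ i) \<and> 1 \<le> real n * (b $ i - x $ i)}"
    have "closed ?K"
      by (intro closed_Collect_all closed_Collect_conj closed_Collect_le continuous_intros continuous_on_component)
    moreover have "?K \<subseteq> box a b" using sub by blast
    ultimately show "compact ?K" "?K \<subseteq> \<Omega>"
      using assms bounded_subset[OF bounded_box] by (auto simp: compact_eq_bounded_closed)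
    fix k
    have L: "bounded_linear (\<lambda>x::point. real n * x $ i)" "bounded_linear (\<lambda>x::point. - (real n * x $ i))" for i
      by (auto intro!: bounded_linear_const_mult bounded_linear_minus bounded_linear_vec_nth)
    have eq: "real n * (x $ i - a $ i) - 1 = real n * x $ i + (- real n * a $ i - 1)"
      "real n * (b $ i - x $ i) - 1 = - (real n * x $ i) + (real n * b $ i - 1)" for x :: point and i
      by (auto simp: algebra_simps)
    show "Ck_on k UNIV (\<phi> n)"
      unfolding \<phi>_def[abs_def] eq
      by (intro Ck_on_prod Ck_on_bilinear[OF bounded_bilinear_mult] Ck_on_flat_exp L) auto
  qed (use out in auto)
  moreover have "0 \<le> \<phi> n x \<and> \<phi> n x \<le> 1" for n x
    unfolding \<phi>_def by (auto intro!: prod_nonneg prod_le_1 mult_nonneg_nonneg mult_le_one 01)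
  moreover have "(\<lambda>n. \<phi> n x) \<longlonglongrightarrow> 1" if "x \<in> box a b" for x
  proof -
    have E: "(\<lambda>n. flat_exp 0 (real n * s - 1)) \<longlonglongrightarrow> 1" if "s > 0" for s
    proof -
      have lim: "filterlim (\<lambda>n. real n * s - 1) at_top sequentially"
        using that by real_asymp
      then have "(\<lambda>n. exp (- inverse (real n * s - 1))) \<longlonglongrightarrow> exp (- 0)"
        by (intro tendsto_exp tendsto_minus tendsto_inverse_0_at_top)
      moreover have "eventually (\<lambda>n. exp (- inverse (real n * s - 1)) = flat_exp 0 (real n * s - 1)) sequentially"
        using filterlim_at_top_dense[THEN iffD1, OF lim, rule_format, of 0]
        by eventually_elim (simp add: flat_exp_def field_simps)
      ultimately show ?thesis using tendsto_cong by fastforce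
    qed
    have "(\<lambda>n. \<phi> n x) \<longlonglongrightarrow> (\<Prod>i\<in>(UNIV::3 set). 1 * 1)"
      unfolding \<phi>_def by (intro tendsto_prod tendsto_mult E) (use that in \<open>auto simp: mem_box_cart\<close>)
    then show ?thesis by simp
  qed
  ultimately show ?thesis using out sub by (intro exI[of _ \<phi>]) blast
qed

text \<open>An open set is a countable union of boxes. The function 1 - prod (1 - \<phi>), taken
  over the first \<open>n\<close> boxes, stays between 0 and 1, involves finitely many supports, and
  tends to 1 as soon as one box contains the point.\<close>

lemma exists_test_function_open:
  assumes "open U" "U \<subseteq> \<Omega>"
  shows "\<exists>\<psi>. (\<forall>n. \<psi> n \<in> test_functions \<Omega>) \<and> (\<forall>n x. 0 \<le> \<psi> n x \<and> \<psi> n x \<le> (1::real)) \<and>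
     (\<forall>x. (\<lambda>n. \<psi> n x) \<longlonglongrightarrow> indicator U x)"
proof (cases "U = {}")
  case True
  then show ?thesis
    by (intro exI[of _ "\<lambda>_ _. 0"]) (auto simp: test_functions_const_0)
next
  case False
  obtain \<D> where \<D>: "countable \<D>" "\<D> \<subseteq> Pow U" "\<And>X. X \<in> \<D> \<Longrightarrow> \<exists>a b. X = box a b" "\<Union>\<D> = U"
    using open_countable_Union_open_box[OF assms(1)] by blast
  with False have "\<D> \<noteq> {}" by blast
  then obtain X where X: "range (X :: nat \<Rightarrow> _) = \<D>"
    using uncountable_def \<D>(1) by metis
  have "\<exists>\<phi>. (\<forall>n. \<phi> n \<in> test_functions \<Omega>) \<and> (\<forall>n x. 0 \<le> \<phi> n x \<and> \<phi> n x \<le> (1::real)) \<and>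
     (\<forall>n x. x \<notin> X k \<longrightarrow> \<phi> n x = 0) \<and> (\<forall>x\<in>X k. (\<lambda>n. \<phi> n x) \<longlonglongrightarrow> 1)" for k
  proof -
    have "X k \<in> \<D>" using X by blast
    from \<D>(3)[OF this] obtain a b where ab: "X k = box a b" by blast
    moreover have "X k \<subseteq> \<Omega>" using \<D>(2) \<open>X k \<in> \<D>\<close> assms(2) by blast
    ultimately have sub: "box a b \<subseteq> \<Omega>" by simp
    show ?thesis using exists_test_function_box[OF sub] unfolding ab .
  qed
  then have "\<forall>k. \<exists>\<phi>. (\<forall>n. \<phi> n \<in> test_functions \<Omega>) \<and> (\<forall>n x. 0 \<le> \<phi> n x \<and> \<phi> n x \<le> (1::real)) \<and>
     (\<forall>n x. x \<notin> X k \<longrightarrow> \<phi> n x = 0) \<and> (\<forall>x\<in>X k. (\<lambda>n. \<phi> n x) \<longlonglongrightarrow> 1)"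
    by blast
  from choice[OF this] obtain \<phi> where
    \<phi>': "\<forall>k. (\<forall>n. \<phi> k n \<in> test_functions \<Omega>) \<and> (\<forall>n x. 0 \<le> \<phi> k n x \<and> \<phi> k n x \<le> (1::real)) \<and>
     (\<forall>n x. x \<notin> X k \<longrightarrow> \<phi> k n x = 0) \<and> (\<forall>x\<in>X k. (\<lambda>n. \<phi> k n x) \<longlonglongrightarrow> 1)" ..
  have \<phi>: "\<phi> k n \<in> test_functions \<Omega>" "0 \<le> \<phi> k n x" "\<phi> k n x \<le> 1"
    "x \<notin> X k \<Longrightarrow> \<phi> k n x = 0" "x\<in>X k \<Longrightarrow> (\<lambda>n. \<phi> k n x) \<longlonglongrightarrow> 1" for k n x
    using spec[OF \<phi>', of k] by auto
  define \<psi> where "\<psi> n x = 1 - (\<Prod>k<n. 1 - \<phi> k n x)" for n x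
  have P: "0 \<le> (\<Prod>k<m. 1 - \<phi> k n x)" "(\<Prod>k<m. 1 - \<phi> k n x) \<le> 1" for m n x
    by (auto intro!: prod_nonneg prod_le_1 simp: \<phi>)
  have "(\<lambda>x. 1 - (\<Prod>k<m. 1 - \<phi> k n x)) \<in> test_functions \<Omega>" for m n
  proof (induction m)
    case 0
    then show ?case by (simp add: test_functions_const_0)
  next
    case (Suc m)
    let ?P = "\<lambda>x. \<Prod>k<m. 1 - \<phi> k n x"
    \<comment> \<open>The product alone equals 1 far away and is no test function; written as p + q
      - p q, the recursion stays inside \<open>test_functions\<close>.\<close>
    have eq: "(\<lambda>x. 1 - (\<Prod>k<Suc m. 1 - \<phi> k n x)) = (\<lambda>x. ((1 - ?P x) + \<phi> m n x) - (1 - ?P x) * \<phi> m n x)"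
      by (simp add: fun_eq_iff algebra_simps)
    show ?case unfolding eq
      by (intro test_functions_diff test_functions_add test_functions_bilinear[OF bounded_bilinear_mult] Suc \<phi>)
  qed
  then have "\<psi> n \<in> test_functions \<Omega>" for n
    unfolding \<psi>_def[abs_def] .
  moreover have "0 \<le> \<psi> n x \<and> \<psi> n x \<le> 1" for n x
    using P[where m=n and n=n and x=x] by (simp add: \<psi>_def)
  moreover have "(\<lambda>n. \<psi> n x) \<longlonglongrightarrow> indicator U x" for x
  proof (cases "x \<in> U")
    case True
    then obtain k where k: "x \<in> X k" using \<D>(4) X by blast
    have le: "(\<Prod>j<n. 1 - \<phi> j n x) \<le> 1 - \<phi> k n x" if "k < n" for n
    proof -
      have "(\<Prod>j<n. 1 - \<phi> j n x) = (1 - \<phi> k n x) * (\<Prod>j\<in>{..<n}-{k}. 1 - \<phi> j n x)"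
        using that by (intro prod.remove) auto
      also have "\<dots> \<le> (1 - \<phi> k n x) * 1"
        by (intro mult_left_mono prod_le_1) (simp_all add: \<phi>)
      finally show ?thesis by simp
    qed
    have "(\<lambda>n. 1 - \<phi> k n x) \<longlonglongrightarrow> 1 - 1"
      by (intro tendsto_intros \<phi> k)
    then have lim: "(\<lambda>n. 1 - \<phi> k n x) \<longlonglongrightarrow> 0" by simp
    have "(\<lambda>n. \<Prod>j<n. 1 - \<phi> j n x) \<longlonglongrightarrow> 0"
    proof (rule tendsto_sandwich[OF _ _ tendsto_const lim])
      show "eventually (\<lambda>n. 0 \<le> (\<Prod>j<n. 1 - \<phi> j n x)) sequentially"
        by (intro always_eventually allI P)
      show "eventually (\<lambda>n. (\<Prod>j<n. 1 - \<phi> j n x) \<le> 1 - \<phi> k n x) sequentially"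
        using eventually_gt_at_top[of k] by eventually_elim (rule le)
    qed
    then have "(\<lambda>n. \<psi> n x) \<longlonglongrightarrow> 1 - 0"
      unfolding \<psi>_def by (intro tendsto_intros)
    then show ?thesis using True by simp
  next
    case False
    then have "x \<notin> X k" for k using \<D>(4) X by blast
    then have "\<psi> n x = 0" for n by (simp add: \<psi>_def \<phi>)
    then show ?thesis using False by simp
  qed
  ultimately show ?thesis by (intro exI[of _ \<psi>]) blast
qed

section \<open>The fundamental lemma of the calculus of variations\<close>

text \<open>A function that vanishes off \<Omega> can be integrated over the whole space instead,
  where Fubini's theorem and translation invariance apply.\<close>

lemma integral_lebesgue_on_eq_lborel:
  fixes f :: "'a::euclidean_space \<Rightarrow> 'b::euclidean_space"
  assumes "\<Omega> \<in> sets lebesgue" "f \<in> borel_measurable borel" "\<And>x. x \<notin> \<Omega> \<Longrightarrow> f x = 0"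
  shows "(LINT x|lebesgue_on \<Omega>. f x) = (LINT x|lborel. f x)"
    and "integrable (lebesgue_on \<Omega>) f \<longleftrightarrow> integrable lborel f"
proof -
  have eq: "(\<lambda>x. indicator \<Omega> x *\<^sub>R f x) = f"
    using assms(3) by (auto simp: fun_eq_iff indicator_def)
  show "(LINT x|lebesgue_on \<Omega>. f x) = (LINT x|lborel. f x)"
    using assms by (subst integral_restrict_space) (auto simp: eq integral_completion)
  show "integrable (lebesgue_on \<Omega>) f \<longleftrightarrow> integrable lborel f"
    using assms by (subst integrable_restrict_space) (auto simp: eq integrable_completion)
qed

lemma nn_integral_lebesgue_on_eq_lborel:
  fixes f :: "'a::euclidean_space \<Rightarrow> ennreal"
  assumes "\<Omega> \<in> sets lebesgue" "\<And>x. x \<notin> \<Omega> \<Longrightarrow> f x = 0"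
  shows "(\<integral>\<^sup>+x. f x \<partial>lebesgue_on \<Omega>) = (\<integral>\<^sup>+x. f x \<partial>lborel)"
proof -
  have eq: "(\<lambda>x. f x * indicator \<Omega> x) = f"
    using assms(2) by (auto simp: fun_eq_iff indicator_def)
  show ?thesis
    using assms by (subst nn_integral_restrict_space) (auto simp: eq nn_integral_completion)
qed

text \<open>The vanishing of the integrals passes from test functions to open sets by dominated
  convergence, to Borel sets by a Dynkin argument and to Lebesgue sets by removing a null set; a
  density all of whose set integrals are zero vanishes almost everywhere.\<close>

lemma AE_zero_if_integral_test_zero:
  fixes g :: "point \<Rightarrow> real"
  assumes "open \<Omega>" "bounded \<Omega>" and g: "integrable (lebesgue_on \<Omega>) g"
    and test: "\<And>\<phi>. \<phi> \<in> test_functions \<Omega> \<Longrightarrow> (LINT x|lebesgue_on \<Omega>. g x * \<phi> x) = 0"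
  shows "AE x in lebesgue_on \<Omega>. g x = 0"
proof -
  let ?M = "lebesgue_on \<Omega>"
  interpret finite_measure ?M
    using assms(1,2) by (intro finite_measure_lebesgue_on lmeasurable_open)
  have [measurable]: "g \<in> borel_measurable ?M" using g by auto
  have \<Omega>: "\<Omega> \<in> sets lebesgue" using assms(1) by auto
  have sM: "space ?M = \<Omega>" by simp
  have borel_M: "A \<inter> \<Omega> \<in> sets ?M" if "A \<in> sets borel" for A
    using that \<Omega> by (auto simp: sets_restrict_space intro!: image_eqI[of _ _ A])
  have ind: "(\<lambda>x. indicator A x :: real) \<in> borel_measurable ?M" if "A \<in> sets borel" for A
    by (rule borel_measurable_indicator') (use borel_M[OF that] in \<open>auto simp: vimage_def Int_def conj_commute\<close>)
  have int: "integrable ?M (\<lambda>x. indicator A x * g x)" if "A \<in> sets borel" for A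
    by (rule Bochner_Integration.integrable_bound[OF g])
      (use ind[OF that] in \<open>auto simp: indicator_def\<close>)
  have op: "(LINT x|?M. indicator U x * g x) = 0" if U: "open U" for U
  proof -
    have "open (U \<inter> \<Omega>)" "U \<inter> \<Omega> \<subseteq> \<Omega>" using U assms(1) by auto
    from exists_test_function_open[OF this] obtain \<psi> where
      \<psi>: "\<And>n. \<psi> n \<in> test_functions \<Omega>" "\<And>n x. 0 \<le> \<psi> n x" "\<And>n x. \<psi> n x \<le> (1::real)"
        "\<And>x. (\<lambda>n. \<psi> n x) \<longlonglongrightarrow> indicator (U \<inter> \<Omega>) x"
      by blast
    have \<psi>m [measurable]: "\<psi> n \<in> borel_measurable ?M" for n
      using borel_measurable_continuous_onI[OF test_functions_continuous[OF \<psi>(1)[of n]]]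
      by (intro measurable_restrict_space1 measurable_completion) simp
    have "(\<lambda>n. LINT x|?M. g x * \<psi> n x) \<longlonglongrightarrow> (LINT x|?M. indicator U x * g x)"
    proof (rule integral_dominated_convergence[where w="\<lambda>x. \<bar>g x\<bar>"])
      show "(\<lambda>x. indicator U x * g x) \<in> borel_measurable ?M"
        using int[of U] U by auto
      show "AE x in ?M. (\<lambda>n. g x * \<psi> n x) \<longlonglongrightarrow> indicator U x * g x"
      proof (rule AE_I2)
        fix x assume x: "x \<in> space ?M"
        have "(\<lambda>n. g x * \<psi> n x) \<longlonglongrightarrow> g x * indicator (U \<inter> \<Omega>) x"
          by (intro tendsto_intros \<psi>)
        moreover have "g x * indicator (U \<inter> \<Omega>) x = indicator U x * g x"
          using x by (auto simp: indicator_def)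
        ultimately show "(\<lambda>n. g x * \<psi> n x) \<longlonglongrightarrow> indicator U x * g x" by simp
      qed
      show "AE x in ?M. norm (g x * \<psi> n x) \<le> \<bar>g x\<bar>" for n
        using \<psi>(2,3) by (auto simp: abs_mult intro!: AE_I2 mult_left_le)
    qed (use g in auto)
    then show ?thesis using test[OF \<psi>(1)] by (simp add: LIMSEQ_const_iff)
  qed
  have bor: "(LINT x|?M. indicator A x * g x) = 0" if A: "A \<in> sets borel" for A
  proof -
    \<comment> \<open>Open sets are stable under intersection and generate the Borel sets, so only
      complements and disjoint unions remain to be treated.\<close>
    have "Int_stable {S::point set. open S}" by (auto simp: Int_stable_def)
    moreover have "{S::point set. open S} \<subseteq> Pow UNIV" by simp
    moreover have "A \<in> sigma_sets UNIV {S. open S}" using A by (simp add: borel_def)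
    ultimately show ?thesis
    proof (induction A rule: sigma_sets_induct_disjoint)
      case (basic A)
      then show ?case using op by auto
    next
      case (compl A)
      then have A: "A \<in> sets borel" by (simp add: borel_def)
      have "(LINT x|?M. indicator (UNIV - A) x * g x) = (LINT x|?M. indicator UNIV x * g x - indicator A x * g x)"
        by (intro Bochner_Integration.integral_cong) (auto simp: indicator_def)
      also have "\<dots> = (LINT x|?M. indicator UNIV x * g x) - (LINT x|?M. indicator A x * g x)"
        by (intro Bochner_Integration.integral_diff int A) auto
      also have "\<dots> = 0" using op[of UNIV] compl by simp
      finally show ?case .
    next
      case (union A)
      then have A: "A i \<in> sets borel" for i by (auto simp: borel_def)
      have UA: "(\<Union>i. A i) \<in> sets borel" using A by auto
      have "(\<lambda>n. LINT x|?M. (\<Sum>i<n. indicator (A i) x) * g x) \<longlonglongrightarrow> (LINT x|?M. indicator (\<Union>i. A i) x * g x)"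
      proof (rule integral_dominated_convergence[where w="\<lambda>x. \<bar>g x\<bar>"])
        show "(\<lambda>x. indicator (\<Union>i. A i) x * g x) \<in> borel_measurable ?M"
          using int[OF UA] by auto
        have "(\<lambda>x. (\<Sum>i<n. indicator (A i) x) * g x) = (\<lambda>x. (\<Sum>i<n. indicator (A i) x * g x))" for n
          by (simp add: sum_distrib_right)
        then show "(\<lambda>x. (\<Sum>i<n. indicator (A i) x) * g x) \<in> borel_measurable ?M" for n
          by (simp only:) (intro borel_measurable_sum borel_measurable_integrable int A)
        have s: "(\<Sum>i<n. indicator (A i) x) = (indicator (\<Union>i<n. A i) x :: real)" for n x
          using union(1) by (intro indicator_UN_disjoint[symmetric])
            (auto simp: disjoint_family_on_def)
        show "AE x in ?M. (\<lambda>n. (\<Sum>i<n. indicator (A i) x) * g x) \<longlonglongrightarrow> indicator (\<Union>i. A i) x * g x"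
          unfolding s by (intro AE_I2 tendsto_mult tendsto_const LIMSEQ_indicator_UN)
        show "AE x in ?M. norm ((\<Sum>i<n. indicator (A i) x) * g x) \<le> \<bar>g x\<bar>" for n
          unfolding s by (auto simp: indicator_def)
      qed (use g in auto)
      moreover have "(LINT x|?M. (\<Sum>i<n. indicator (A i) x) * g x) = 0" for n
        unfolding sum_distrib_right using union(3) int[OF A]
        by (subst Bochner_Integration.integral_sum) auto
      ultimately show ?case by (simp add: LIMSEQ_const_iff)
    qed auto
  qed
  show ?thesis
  proof (rule density_zero[OF g])
    fix A assume "A \<in> sets ?M"
    then have A: "A \<in> sets lebesgue" "A \<subseteq> \<Omega>"
      using \<Omega> by (auto simp: sets_restrict_space_iff)
    \<comment> \<open>Up to a subset of a null set, a Lebesgue set is Borel, and the integral does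
      not see the difference.\<close>
    then obtain S N N' where SN: "A = S \<union> N" "N \<subseteq> N'" "N' \<in> null_sets lborel" "S \<in> sets lborel"
      by (auto elim!: sets_completionE)
    then have "N' \<in> null_sets lebesgue" by (simp add: null_sets_completionI)
    then have "AE x in lebesgue. x \<notin> N'" by (rule AE_not_in)
    then have "AE x in ?M. x \<notin> N'"
      using \<Omega> by (auto simp: AE_restrict_space_iff elim!: eventually_mono)
    then have "AE x in ?M. indicator A x *\<^sub>R g x = indicator S x * g x"
      by eventually_elim (use SN in \<open>auto simp: indicator_def\<close>)
    then have "set_lebesgue_integral ?M A g = (LINT x|?M. indicator S x * g x)"
      unfolding set_lebesgue_integral_def
      using \<open>A \<in> sets ?M\<close> int[of S] SN(4) by (intro integral_cong_AE) auto
    then show "set_lebesgue_integral ?M A g = 0"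
      using bor SN(4) by simp
  qed
qed

section \<open>Integration by parts for test functions\<close>

lemma test_functions_has_vector_derivative_line:
  assumes "\<phi> \<in> test_functions \<Omega>"
  shows "((\<lambda>t. \<phi> (x + t *\<^sub>R v)) has_vector_derivative frechet_derivative \<phi> (at (x + t *\<^sub>R v)) v) (at t within S)"
proof -
  have 1: "((\<lambda>t. x + t *\<^sub>R v) has_derivative (\<lambda>h. h *\<^sub>R v)) (at t within S)"
    by (auto intro!: derivative_eq_intros)
  have "((\<lambda>t. \<phi> (x + t *\<^sub>R v)) has_derivative (\<lambda>h. frechet_derivative \<phi> (at (x + t *\<^sub>R v)) (h *\<^sub>R v))) (at t within S)"
    using has_derivative_compose[OF 1 test_functions_has_derivative[OF assms]] .
  moreover have "frechet_derivative \<phi> (at (x + t *\<^sub>R v)) (h *\<^sub>R v) = h *\<^sub>R frechet_derivative \<phi> (at (x + t *\<^sub>R v)) v" for h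
    using test_functions_has_derivative[OF assms] has_derivative_linear linear_cmul by blast
  ultimately show ?thesis unfolding has_vector_derivative_def by simp
qed

lemma test_functions_borel_measurable [measurable_dest]:
  "\<phi> \<in> test_functions \<Omega> \<Longrightarrow> \<phi> \<in> borel_measurable borel"
  by (rule borel_measurable_continuous_onI[OF test_functions_continuous])

lemma test_functions_integrable:
  fixes \<phi> :: "point \<Rightarrow> 'b::euclidean_space"
  assumes "\<phi> \<in> test_functions \<Omega>"
  shows "integrable lborel \<phi>"
proof -
  obtain K where K: "compact K" "K \<subseteq> \<Omega>" "\<And>x. x \<notin> K \<Longrightarrow> \<phi> x = 0"
    using assms unfolding test_functions_def by blast
  have "integrable lborel (\<lambda>x. indicator K x *\<^sub>R \<phi> x)"
    by (rule borel_integrable_compact[OF K(1) test_functions_continuous[OF assms]])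
  moreover have "(\<lambda>x. indicator K x *\<^sub>R \<phi> x) = \<phi>"
    using K(3) by (auto simp: fun_eq_iff indicator_def)
  ultimately show ?thesis by simp
qed

lemma lborel_integral_translate:
  fixes f :: "'a::euclidean_space \<Rightarrow> 'b::euclidean_space"
  assumes "f \<in> borel_measurable borel"
  shows "(LINT x|lborel. f (c + x)) = (LINT x|lborel. f x)"
  using assms by (subst (2) lborel_distr_plus[of c, symmetric]) (simp add: integral_distr)

lemma lborel_nn_integral_translate:
  fixes f :: "'a::euclidean_space \<Rightarrow> ennreal"
  assumes [measurable]: "f \<in> borel_measurable borel"
  shows "(\<integral>\<^sup>+x. f (c + x) \<partial>lborel) = (\<integral>\<^sup>+x. f x \<partial>lborel)"
  using assms by (subst (2) lborel_distr_plus[of c, symmetric]) (simp add: nn_integral_distr)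

text \<open>Difference quotients integrate to 0 by translation invariance of Lebesgue measure, and
  they converge to the derivative under a common integrable bound.\<close>

lemma integral_partial_deriv_test:
  fixes \<phi> :: "point \<Rightarrow> real"
  assumes \<phi>: "\<phi> \<in> test_functions \<Omega>"
  shows "(LINT x|lborel. partial_deriv j \<phi> x) = 0"
proof -
  let ?e = "axis j 1 :: point"
  obtain K where K: "compact K" "K \<subseteq> \<Omega>" "\<And>x. x \<notin> K \<Longrightarrow> \<phi> x = 0"
    using assms unfolding test_functions_def by blast
  obtain R where R: "\<And>x. x \<in> K \<Longrightarrow> norm x \<le> R"
    using compact_imp_bounded[OF K(1)] bounded_iff by metis
  obtain B where B: "B \<ge> 0" "\<And>x. norm (partial_deriv j \<phi> x) \<le> B"
    using test_functions_bounded[OF test_functions_partial_deriv[OF \<phi>]] by blast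
  have meas [measurable]: "\<phi> \<in> borel_measurable borel" "partial_deriv j \<phi> \<in> borel_measurable borel"
    using \<phi> test_functions_borel_measurable test_functions_partial_deriv by blast+
  \<comment> \<open>Steps of length at most 1 keep the supports of all difference quotients in one
    ball.\<close>
  define h where "h n = 1 / real (Suc n)" for n
  have h: "0 < h n" "h n \<le> 1" for n by (auto simp: h_def)
  define q where "q n x = (\<phi> (h n *\<^sub>R ?e + x) - \<phi> x) / h n" for n x
  have D: "((\<lambda>t. \<phi> (x + t *\<^sub>R ?e)) has_real_derivative partial_deriv j \<phi> (x + t *\<^sub>R ?e)) (at t)" for x t
    using test_functions_has_vector_derivative_line[OF \<phi>, of x ?e t UNIV]
    by (simp add: partial_deriv_def has_real_derivative_iff_has_vector_derivative)
  have q_bound: "\<bar>q n x\<bar> \<le> B" for n x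
  proof -
    obtain z where "\<phi> (x + h n *\<^sub>R ?e) - \<phi> (x + 0 *\<^sub>R ?e) = (h n - 0) * partial_deriv j \<phi> (x + z *\<^sub>R ?e)"
      using MVT2[of 0 "h n" "\<lambda>t. \<phi> (x + t *\<^sub>R ?e)" "\<lambda>t. partial_deriv j \<phi> (x + t *\<^sub>R ?e)"] h[of n] D
      by blast
    then have "q n x = partial_deriv j \<phi> (x + z *\<^sub>R ?e)"
      using h[of n] by (simp add: q_def add.commute field_simps)
    then show ?thesis using B(2) by simp
  qed
  have q_supp: "q n x = 0" if "x \<notin> cball 0 (R + 1)" for n x
  proof -
    have "norm x \<le> norm (h n *\<^sub>R ?e + x) + 1"
      using norm_triangle_ineq4[of "h n *\<^sub>R ?e + x" "h n *\<^sub>R ?e"] h[of n] by simp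
    then have "x \<notin> K" "h n *\<^sub>R ?e + x \<notin> K"
      using R[of x] R[of "h n *\<^sub>R ?e + x"] that by auto
    then show ?thesis by (simp add: q_def K)
  qed
  have "(\<lambda>n. LINT x|lborel. q n x) \<longlonglongrightarrow> (LINT x|lborel. partial_deriv j \<phi> x)"
  proof (rule integral_dominated_convergence[where w="\<lambda>x. B * indicator (cball 0 (R+1)) x"])
    show "integrable lborel (\<lambda>x::point. B * indicator (cball 0 (R + 1)) x)"
      using emeasure_bounded_finite[of "cball 0 (R+1) :: point set"] by auto
    show "AE x in lborel. norm (q n x) \<le> B * indicator (cball 0 (R + 1)) x" for n
    proof (rule AE_I2)
      fix x show "norm (q n x) \<le> B * indicator (cball 0 (R + 1)) x"
        using q_bound[of n x] q_supp[of x n] by (cases "x \<in> cball 0 (R+1)") auto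
    qed
    show "AE x in lborel. (\<lambda>n. q n x) \<longlonglongrightarrow> partial_deriv j \<phi> x"
    proof (rule AE_I2)
      fix x
      have "((\<lambda>k. (\<phi> (x + k *\<^sub>R ?e) - \<phi> x) / k) \<longlongrightarrow> partial_deriv j \<phi> x) (at 0)"
        using D[of x 0] by (simp add: DERIV_def)
      moreover have "filterlim h (at 0) sequentially"
        unfolding h_def[abs_def] using LIMSEQ_inverse_real_of_nat
        by (auto simp: filterlim_at inverse_eq_divide)
      ultimately have "(\<lambda>n. (\<phi> (x + h n *\<^sub>R ?e) - \<phi> x) / h n) \<longlonglongrightarrow> partial_deriv j \<phi> x"
        by (rule filterlim_compose)
      then show "(\<lambda>n. q n x) \<longlonglongrightarrow> partial_deriv j \<phi> x"
        by (simp add: q_def add.commute)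
    qed
    show "q n \<in> borel_measurable lborel" for n unfolding q_def[abs_def] by measurable
  qed auto
  moreover have "(LINT x|lborel. q n x) = 0" for n
  proof -
    have i: "integrable lborel \<phi>" using test_functions_integrable[OF \<phi>] .
    have "integrable lborel (\<lambda>x. \<phi> (h n *\<^sub>R ?e + x))"
      using i by (subst (asm) lborel_distr_plus[of "h n *\<^sub>R ?e", symmetric])
        (simp add: integrable_distr_eq)
    then show ?thesis
      using i lborel_integral_translate[of \<phi> "h n *\<^sub>R ?e"] by (simp add: q_def)
  qed
  ultimately show ?thesis by (simp add: LIMSEQ_const_iff)
qed

lemma partial_deriv_bilinear:
  assumes "bounded_bilinear B" "f \<in> test_functions \<Omega>" "g \<in> test_functions \<Omega>'"
  shows "partial_deriv j (\<lambda>x. B (f x) (g x)) x = B (f x) (partial_deriv j g x) + B (partial_deriv j f x) (g x)"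
  unfolding partial_deriv_def
  using frechet_derivative_eqI[OF bounded_bilinear.FDERIV[OF assms(1)
      test_functions_has_derivative[OF assms(2)] test_functions_has_derivative[OF assms(3)]]]
  by simp

lemma partial_deriv_linear:
  assumes "bounded_linear L" "f \<in> test_functions \<Omega>"
  shows "partial_deriv j (\<lambda>x. L (f x)) x = L (partial_deriv j f x)"
  unfolding partial_deriv_def
  using frechet_derivative_eqI[OF bounded_linear.has_derivative[OF assms(1)
      test_functions_has_derivative[OF assms(2)]]]
  by simp

text \<open>The product is again a test function, so the integral of its derivative is zero.\<close>

lemma integration_by_parts_test:
  fixes \<phi> \<psi> :: "point \<Rightarrow> real"
  assumes "\<phi> \<in> test_functions \<Omega>" "\<psi> \<in> test_functions \<Omega>"
  shows "(LINT x|lborel. \<phi> x * partial_deriv j \<psi> x) = - (LINT x|lborel. partial_deriv j \<phi> x * \<psi> x)"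
proof -
  note T = test_functions_bilinear[OF bounded_bilinear_mult]
  have "integrable lborel (\<lambda>x. \<phi> x * partial_deriv j \<psi> x)" "integrable lborel (\<lambda>x. partial_deriv j \<phi> x * \<psi> x)"
    using T[OF assms(1) test_functions_partial_deriv[OF assms(2)]]
      T[OF test_functions_partial_deriv[OF assms(1)] assms(2)] test_functions_integrable by blast+
  then show ?thesis
    using integral_partial_deriv_test[OF T[OF assms], of j]
    by (simp add: partial_deriv_bilinear[OF bounded_bilinear_mult assms])
qed

section \<open>The inner product of \<open>L\<^sup>2\<close>\<close>

lemma L2_measurable: "f \<in> L2 \<Omega> \<Longrightarrow> f \<in> borel_measurable (lebesgue_on \<Omega>)"
  by (simp add: L2_def)

lemma L2_I:
  fixes f :: "point \<Rightarrow> 'b::euclidean_space"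
  assumes "f \<in> borel_measurable (lebesgue_on \<Omega>)" "(\<integral>\<^sup>+x. ennreal ((norm (f x))\<^sup>2) \<partial>lebesgue_on \<Omega>) < \<infinity>"
  shows "f \<in> L2 \<Omega>"
  using assms unfolding L2_def by (auto intro!: integrableI_bounded)

lemma L2_0: "(\<lambda>_. 0) \<in> L2 \<Omega>"
  by (simp add: L2_def)

lemma L2_add:
  fixes f g :: "point \<Rightarrow> 'b::euclidean_space"
  assumes "f \<in> L2 \<Omega>" "g \<in> L2 \<Omega>"
  shows "(\<lambda>x. f x + g x) \<in> L2 \<Omega>"
proof -
  have [measurable]: "f \<in> borel_measurable (lebesgue_on \<Omega>)" "g \<in> borel_measurable (lebesgue_on \<Omega>)"
    using assms by (auto simp: L2_def)
  have "(norm (f x + g x))\<^sup>2 = (norm (f x))\<^sup>2 + 2 * (f x \<bullet> g x) + (norm (g x))\<^sup>2" for x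
    by (simp add: power2_norm_eq_inner inner_add_left inner_add_right inner_commute)
  then show ?thesis
    using assms integrable_inner_L2[OF assms] by (simp add: L2_def)
qed

lemma L2_scaleR: "f \<in> L2 \<Omega> \<Longrightarrow> (\<lambda>x. c *\<^sub>R f x) \<in> L2 \<Omega>"
  by (auto simp: L2_def power_mult_distrib)

lemma L2_diff:
  fixes f g :: "point \<Rightarrow> 'b::euclidean_space"
  assumes "f \<in> L2 \<Omega>" "g \<in> L2 \<Omega>"
  shows "(\<lambda>x. f x - g x) \<in> L2 \<Omega>"
  using L2_add[OF assms(1) L2_scaleR[OF assms(2), of "-1"]] by simp

lemma L2_norm: "f \<in> L2 \<Omega> \<Longrightarrow> (\<lambda>x. norm (f x)) \<in> L2 \<Omega>"
  by (auto simp: L2_def)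

lemma L2_bound:
  fixes f :: "point \<Rightarrow> 'b::euclidean_space" and g :: "point \<Rightarrow> 'c::euclidean_space"
  assumes "g \<in> L2 \<Omega>" "f \<in> borel_measurable (lebesgue_on \<Omega>)" "\<And>x. norm (f x) \<le> norm (g x)"
  shows "f \<in> L2 \<Omega>"
  unfolding L2_def mem_Collect_eq
proof (intro conjI assms(2))
  show "integrable (lebesgue_on \<Omega>) (\<lambda>x. (norm (f x))\<^sup>2)"
  proof (rule Bochner_Integration.integrable_bound)
    show "integrable (lebesgue_on \<Omega>) (\<lambda>x. (norm (g x))\<^sup>2)"
      using assms(1) by (simp add: L2_def)
    show "(\<lambda>x. (norm (f x))\<^sup>2) \<in> borel_measurable (lebesgue_on \<Omega>)"
      using assms(2) by measurable
    show "AE x in lebesgue_on \<Omega>. norm ((norm (f x))\<^sup>2) \<le> norm ((norm (g x))\<^sup>2)"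
      using assms(3) by (auto intro!: AE_I2 power_mono)
  qed
qed

lemma L2_nth: 
  fixes f :: "point \<Rightarrow> 'b::euclidean_space ^ 'n"
  assumes "f \<in> L2 \<Omega>" shows "(\<lambda>x. f x $ i) \<in> L2 \<Omega>"
proof (rule L2_bound[OF assms])
  show "(\<lambda>x. f x $ i) \<in> borel_measurable (lebesgue_on \<Omega>)"
    using L2_measurable[OF assms] by (rule measurable_compose)
      (auto intro!: borel_measurable_continuous_onI linear_continuous_on bounded_linear_vec_nth)
qed (rule Finite_Cartesian_Product.norm_nth_le)

lemma l2_inner_commute: "l2_inner \<Omega> f g = l2_inner \<Omega> g f"
  by (simp add: l2_inner_def inner_commute)

lemma l2_inner_add_left:
  "f \<in> L2 \<Omega> \<Longrightarrow> g \<in> L2 \<Omega> \<Longrightarrow> h \<in> L2 \<Omega> \<Longrightarrow>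
    l2_inner \<Omega> (\<lambda>x. f x + g x) h = l2_inner \<Omega> f h + l2_inner \<Omega> g h"
  by (simp add: l2_inner_def inner_add_left integrable_inner_L2)

lemma l2_inner_diff_left:
  "f \<in> L2 \<Omega> \<Longrightarrow> g \<in> L2 \<Omega> \<Longrightarrow> h \<in> L2 \<Omega> \<Longrightarrow>
    l2_inner \<Omega> (\<lambda>x. f x - g x) h = l2_inner \<Omega> f h - l2_inner \<Omega> g h"
  by (simp add: l2_inner_def inner_diff_left integrable_inner_L2)

lemma l2_inner_scaleR_left:
  "l2_inner \<Omega> (\<lambda>x. c *\<^sub>R f x) h = c * l2_inner \<Omega> f h"
  by (simp add: l2_inner_def)

lemma l2_inner_add_right:
  "f \<in> L2 \<Omega> \<Longrightarrow> g \<in> L2 \<Omega> \<Longrightarrow> h \<in> L2 \<Omega> \<Longrightarrow>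
    l2_inner \<Omega> h (\<lambda>x. f x + g x) = l2_inner \<Omega> h f + l2_inner \<Omega> h g"
  by (simp add: l2_inner_def inner_add_right integrable_inner_L2)

lemma l2_inner_diff_right:
  "f \<in> L2 \<Omega> \<Longrightarrow> g \<in> L2 \<Omega> \<Longrightarrow> h \<in> L2 \<Omega> \<Longrightarrow>
    l2_inner \<Omega> h (\<lambda>x. f x - g x) = l2_inner \<Omega> h f - l2_inner \<Omega> h g"
  by (simp add: l2_inner_def inner_diff_right integrable_inner_L2)

lemma l2_inner_scaleR_right:
  "l2_inner \<Omega> h (\<lambda>x. c *\<^sub>R f x) = c * l2_inner \<Omega> h f"
  by (simp add: l2_inner_def)

lemma l2_inner_self_nonneg: "0 \<le> l2_inner \<Omega> f f"
  by (simp add: l2_inner_def integral_nonneg_AE)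

lemma l2_norm_nonneg: "0 \<le> l2_norm \<Omega> f"
  by (simp add: l2_norm_def l2_inner_self_nonneg)

lemma l2_norm_sq: "(l2_norm \<Omega> f)\<^sup>2 = l2_inner \<Omega> f f"
  by (simp add: l2_norm_def l2_inner_self_nonneg)

lemma l2_norm_sq_integral: "(l2_norm \<Omega> f)\<^sup>2 = (LINT x|lebesgue_on \<Omega>. (norm (f x))\<^sup>2)"
  by (simp add: l2_norm_sq l2_inner_def power2_norm_eq_inner)

lemma l2_norm_nn_integral:
  assumes "f \<in> L2 \<Omega>"
  shows "ennreal ((l2_norm \<Omega> f)\<^sup>2) = (\<integral>\<^sup>+x. ennreal ((norm (f x))\<^sup>2) \<partial>lebesgue_on \<Omega>)"
  unfolding l2_norm_sq_integral
  using assms by (intro nn_integral_eq_integral[symmetric]) (auto simp: L2_def)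

lemma l2_inner_cong_AE:
  assumes "AE x in lebesgue_on \<Omega>. f x = f' x" "AE x in lebesgue_on \<Omega>. g x = g' x"
    "f \<in> L2 \<Omega>" "f' \<in> L2 \<Omega>" "g \<in> L2 \<Omega>" "g' \<in> L2 \<Omega>"
  shows "l2_inner \<Omega> f g = l2_inner \<Omega> f' g'"
  unfolding l2_inner_def
proof (rule integral_cong_AE)
  show "AE x in lebesgue_on \<Omega>. f x \<bullet> g x = f' x \<bullet> g' x"
    using assms(1,2) by eventually_elim simp
qed (use assms integrable_inner_L2 in blast)+

lemma l2_norm_cong_AE:
  assumes "AE x in lebesgue_on \<Omega>. f x = f' x" "f \<in> L2 \<Omega>" "f' \<in> L2 \<Omega>"
  shows "l2_norm \<Omega> f = l2_norm \<Omega> f'"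
  using l2_inner_cong_AE[OF assms(1) assms(1)] assms by (simp add: l2_norm_def)

lemma l2_norm_scaleR: "l2_norm \<Omega> (\<lambda>x. c *\<^sub>R f x) = \<bar>c\<bar> * l2_norm \<Omega> f"
  by (simp add: l2_norm_def l2_inner_scaleR_left l2_inner_scaleR_right real_sqrt_mult
      flip: mult.assoc power2_eq_square)

lemma l2_norm_minus_commute: "l2_norm \<Omega> (\<lambda>x. f x - g x) = l2_norm \<Omega> (\<lambda>x. g x - f x)"
  using l2_norm_scaleR[of \<Omega> "-1" "\<lambda>x. g x - f x"] by simp

text \<open>Used twice: for the Cauchy-Schwarz inequality, and with \<open>c = 0\<close> for the
  first variation of the Rayleigh quotient, where it forces the linear coefficient to
  vanish.\<close>

lemma quadratic_nonneg_discriminant: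
  fixes a b c :: real
  assumes "\<And>t. 0 \<le> a * t\<^sup>2 + 2 * b * t + c"
  shows "b\<^sup>2 \<le> a * c"
proof (cases "a = 0")
  case True
  have "b = 0"
  proof (rule ccontr)
    assume "b \<noteq> 0"
    \<comment> \<open>At this point the affine function takes the value -1.\<close>
    then show False using assms[of "- (c + 1) / (2 * b)"] True by simp
  qed
  then show ?thesis using True by simp
next
  case False
  have "0 \<le> a"
  proof (rule ccontr)
    assume "\<not> 0 \<le> a"
    then have "a < 0" by simp
    \<comment> \<open>Chosen so large that the negative quadratic term outweighs the linear and the
      constant one.\<close>
    define t where "t = (\<bar>2 * b\<bar> + \<bar>c\<bar> + 1) / (- a) + 1"
    have t: "t \<ge> 1" "- a * t \<ge> \<bar>2 * b\<bar> + \<bar>c\<bar> + 1"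
      using \<open>a < 0\<close> by (auto simp: t_def field_simps)
    have "a * t\<^sup>2 \<le> - (\<bar>2 * b\<bar> * t) - \<bar>c\<bar> * t - t"
      using mult_right_mono[OF t(2), of t] t(1) by (simp add: power2_eq_square algebra_simps)
    moreover have "2 * b * t \<le> \<bar>2 * b\<bar> * t" using t(1) by (intro mult_right_mono) auto
    moreover have "c \<le> \<bar>c\<bar> * t" using t(1) mult_left_mono[of 1 t "\<bar>c\<bar>"] by auto
    ultimately show False using assms[of t] t(1) by linarith
  qed
  then have "a > 0" using False by simp
  then have "0 \<le> a * (a * (b/a)\<^sup>2 - 2 * b * (b/a) + c)"
    using assms[of "- b/a"] by (intro mult_nonneg_nonneg) (auto simp: algebra_simps)
  also have "\<dots> = a * c - b\<^sup>2" using \<open>a > 0\<close> by (simp add: field_simps power2_eq_square)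
  finally show ?thesis by simp
qed

lemma l2_Cauchy_Schwarz:
  assumes "f \<in> L2 \<Omega>" "g \<in> L2 \<Omega>"
  shows "\<bar>l2_inner \<Omega> f g\<bar> \<le> l2_norm \<Omega> f * l2_norm \<Omega> g"
proof -
  have "0 \<le> l2_inner \<Omega> f f * t\<^sup>2 + 2 * l2_inner \<Omega> f g * t + l2_inner \<Omega> g g" for t
  proof -
    have "0 \<le> l2_inner \<Omega> (\<lambda>x. t *\<^sub>R f x + g x) (\<lambda>x. t *\<^sub>R f x + g x)"
      by (rule l2_inner_self_nonneg)
    also have "\<dots> = l2_inner \<Omega> f f * t\<^sup>2 + 2 * l2_inner \<Omega> f g * t + l2_inner \<Omega> g g"
      using assms by (simp add: l2_inner_add_left l2_inner_add_right L2_add L2_scaleR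
          l2_inner_scaleR_left l2_inner_scaleR_right l2_inner_commute[of \<Omega> g f] power2_eq_square algebra_simps)
    finally show ?thesis .
  qed
  from quadratic_nonneg_discriminant[OF this]
  have "(l2_inner \<Omega> f g)\<^sup>2 \<le> (l2_norm \<Omega> f * l2_norm \<Omega> g)\<^sup>2"
    by (simp add: power_mult_distrib l2_norm_sq)
  then show ?thesis
    using l2_norm_nonneg by (metis abs_le_square_iff abs_of_nonneg mult_nonneg_nonneg)
qed

lemma l2_norm_triangle:
  assumes "f \<in> L2 \<Omega>" "g \<in> L2 \<Omega>"
  shows "l2_norm \<Omega> (\<lambda>x. f x + g x) \<le> l2_norm \<Omega> f + l2_norm \<Omega> g"
proof (rule power2_le_imp_le)
  have "(l2_norm \<Omega> (\<lambda>x. f x + g x))\<^sup>2 = (l2_norm \<Omega> f)\<^sup>2 + 2 * l2_inner \<Omega> f g + (l2_norm \<Omega> g)\<^sup>2"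
    using assms by (simp add: l2_norm_sq l2_inner_add_left l2_inner_add_right L2_add l2_inner_commute[of \<Omega> g f])
  also have "\<dots> \<le> (l2_norm \<Omega> f + l2_norm \<Omega> g)\<^sup>2"
    using l2_Cauchy_Schwarz[OF assms] by (simp add: power2_eq_square algebra_simps)
  finally show "(l2_norm \<Omega> (\<lambda>x. f x + g x))\<^sup>2 \<le> (l2_norm \<Omega> f + l2_norm \<Omega> g)\<^sup>2" .
qed (simp add: l2_norm_nonneg)

lemma l2_norm_triangle_diff:
  assumes "f \<in> L2 \<Omega>" "g \<in> L2 \<Omega>" "h \<in> L2 \<Omega>"
  shows "l2_norm \<Omega> (\<lambda>x. f x - h x) \<le> l2_norm \<Omega> (\<lambda>x. f x - g x) + l2_norm \<Omega> (\<lambda>x. g x - h x)"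
  using l2_norm_triangle[OF L2_diff[OF assms(1,2)] L2_diff[OF assms(2,3)]] by simp

lemma l2_norm_diff_le:
  assumes "f \<in> L2 \<Omega>" "g \<in> L2 \<Omega>"
  shows "\<bar>l2_norm \<Omega> f - l2_norm \<Omega> g\<bar> \<le> l2_norm \<Omega> (\<lambda>x. f x - g x)"
  using l2_norm_triangle_diff[OF assms L2_0] l2_norm_triangle_diff[OF assms(2,1) L2_0]
    l2_norm_minus_commute[of \<Omega> f g] by auto

lemma l2_norm_tendsto:
  assumes "eventually (\<lambda>n. F n \<in> L2 \<Omega>) \<F>" "f \<in> L2 \<Omega>" "((\<lambda>n. l2_norm \<Omega> (\<lambda>x. F n x - f x)) \<longlongrightarrow> 0) \<F>"
  shows "((\<lambda>n. l2_norm \<Omega> (F n)) \<longlongrightarrow> l2_norm \<Omega> f) \<F>"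
proof -
  have "((\<lambda>n. l2_norm \<Omega> (F n) - l2_norm \<Omega> f) \<longlongrightarrow> 0) \<F>"
  proof (rule Lim_null_comparison[OF _ assms(3)])
    show "eventually (\<lambda>n. norm (l2_norm \<Omega> (F n) - l2_norm \<Omega> f) \<le> l2_norm \<Omega> (\<lambda>x. F n x - f x)) \<F>"
      using assms(1) by eventually_elim (simp add: l2_norm_diff_le assms(2))
  qed
  then show ?thesis by (simp add: LIM_zero_iff)
qed

text \<open>The filter is arbitrary so that the lemma serves both for approximating sequences and
  for difference quotients in time.\<close>

lemma l2_inner_tendsto:
  assumes "eventually (\<lambda>n. F n \<in> L2 \<Omega>) \<F>" "f \<in> L2 \<Omega>" "((\<lambda>n. l2_norm \<Omega> (\<lambda>x. F n x - f x)) \<longlongrightarrow> 0) \<F>"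
    and "eventually (\<lambda>n. G n \<in> L2 \<Omega>) \<F>" "g \<in> L2 \<Omega>" "((\<lambda>n. l2_norm \<Omega> (\<lambda>x. G n x - g x)) \<longlongrightarrow> 0) \<F>"
  shows "((\<lambda>n. l2_inner \<Omega> (F n) (G n)) \<longlongrightarrow> l2_inner \<Omega> f g) \<F>"
proof -
  have "((\<lambda>n. l2_inner \<Omega> (F n) (G n) - l2_inner \<Omega> f g) \<longlongrightarrow> 0) \<F>"
  proof (rule Lim_null_comparison)
    show "eventually (\<lambda>n. norm (l2_inner \<Omega> (F n) (G n) - l2_inner \<Omega> f g) \<le>
        l2_norm \<Omega> (\<lambda>x. F n x - f x) * l2_norm \<Omega> (G n) + l2_norm \<Omega> f * l2_norm \<Omega> (\<lambda>x. G n x - g x)) \<F>"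
      using assms(1,4)
    proof eventually_elim
      case (elim n)
      have "l2_inner \<Omega> (F n) (G n) - l2_inner \<Omega> f g = l2_inner \<Omega> (\<lambda>x. F n x - f x) (G n) + l2_inner \<Omega> f (\<lambda>x. G n x - g x)"
        using elim assms(2,5) by (simp add: l2_inner_diff_left l2_inner_diff_right)
      then show ?case
        using l2_Cauchy_Schwarz[OF L2_diff[OF elim(1) assms(2)] elim(2)]
          l2_Cauchy_Schwarz[OF assms(2) L2_diff[OF elim(2) assms(5)]]
        unfolding real_norm_def by linarith
    qed
    have "((\<lambda>n. l2_norm \<Omega> (\<lambda>x. F n x - f x) * l2_norm \<Omega> (G n) + l2_norm \<Omega> f * l2_norm \<Omega> (\<lambda>x. G n x - g x))
      \<longlongrightarrow> 0 * l2_norm \<Omega> g + l2_norm \<Omega> f * 0) \<F>"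
      by (intro tendsto_intros assms l2_norm_tendsto)
    then show "((\<lambda>n. l2_norm \<Omega> (\<lambda>x. F n x - f x) * l2_norm \<Omega> (G n) + l2_norm \<Omega> f * l2_norm \<Omega> (\<lambda>x. G n x - g x))
      \<longlongrightarrow> 0) \<F>" by simp
  qed
  then show ?thesis by (simp add: LIM_zero_iff)
qed

text \<open>Since (W s - W t, W s + W t) = (W s, W s) - (W t, W t), the difference quotient of the
  square is the inner product of the difference quotient of \<open>W\<close> with a sum that tends
  to twice \<open>W t\<close>. The filter makes the derivative one-sided at time 0.\<close>

lemma l2_inner_has_derivative:
  assumes L2: "\<And>s. s \<ge> 0 \<Longrightarrow> W s \<in> L2 \<Omega>" "W' \<in> L2 \<Omega>" and t: "t \<ge> (0::real)"
    and d: "((\<lambda>s. l2_norm \<Omega> (\<lambda>x. (W s x - W t x) /\<^sub>R (s - t) - W' x)) \<longlongrightarrow> 0) (at t within {0..})"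
  shows "((\<lambda>s. l2_inner \<Omega> (W s) (W s)) has_real_derivative 2 * l2_inner \<Omega> W' (W t)) (at t within {0..})"
proof -
  let ?F = "at t within {0..}" and ?D = "\<lambda>s x. (W s x - W t x) /\<^sub>R (s - t)"
  have ev: "eventually (\<lambda>s. s \<in> {0..} \<and> s \<noteq> t) ?F" by (auto simp: eventually_at_filter)
  have evW: "eventually (\<lambda>s. W s \<in> L2 \<Omega>) ?F" using ev by eventually_elim (simp add: L2)
  have evD: "eventually (\<lambda>s. ?D s \<in> L2 \<Omega>) ?F"
    using ev by eventually_elim (simp add: L2 t L2_scaleR L2_diff)
  \<comment> \<open>The difference quotients have convergent norms, so multiplied by |s - t| they
    tend to 0: differentiability implies continuity.\<close>
  have "((\<lambda>s. \<bar>s - t\<bar> * l2_norm \<Omega> (?D s)) \<longlongrightarrow> \<bar>t - t\<bar> * l2_norm \<Omega> W') ?F"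
    by (intro tendsto_intros l2_norm_tendsto evD L2 d)
  then have "((\<lambda>s. \<bar>s - t\<bar> * l2_norm \<Omega> (?D s)) \<longlongrightarrow> 0) ?F" by simp
  then have lim: "((\<lambda>s. l2_norm \<Omega> (\<lambda>x. W s x - W t x)) \<longlongrightarrow> 0) ?F"
  proof (rule Lim_transform_eventually)
    show "eventually (\<lambda>s. \<bar>s - t\<bar> * l2_norm \<Omega> (?D s) = l2_norm \<Omega> (\<lambda>x. W s x - W t x)) ?F"
      using ev by eventually_elim (simp add: l2_norm_scaleR[symmetric])
  qed
  have lim': "((\<lambda>s. l2_norm \<Omega> (\<lambda>x. (W s x + W t x) - 2 *\<^sub>R W t x)) \<longlongrightarrow> 0) ?F"
    using lim by (simp add: scaleR_2)
  have evS: "eventually (\<lambda>s. (\<lambda>x. W s x + W t x) \<in> L2 \<Omega>) ?F"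
    using evW by eventually_elim (intro L2_add L2(1)[OF t])
  have "((\<lambda>s. l2_inner \<Omega> (?D s) (\<lambda>x. W s x + W t x)) \<longlongrightarrow> l2_inner \<Omega> W' (\<lambda>x. 2 *\<^sub>R W t x)) ?F"
    by (rule l2_inner_tendsto[OF evD L2(2) d evS L2_scaleR[OF L2(1)[OF t]] lim'])
  then have "((\<lambda>s. (l2_inner \<Omega> (W s) (W s) - l2_inner \<Omega> (W t) (W t)) / (s - t)) \<longlongrightarrow> l2_inner \<Omega> W' (\<lambda>x. 2 *\<^sub>R W t x)) ?F"
  proof (rule Lim_transform_eventually)
    show "eventually (\<lambda>s. l2_inner \<Omega> (?D s) (\<lambda>x. W s x + W t x) =
        (l2_inner \<Omega> (W s) (W s) - l2_inner \<Omega> (W t) (W t)) / (s - t)) ?F"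
      using evW
    proof eventually_elim
      case (elim s)
      have "l2_inner \<Omega> (\<lambda>x. W s x - W t x) (\<lambda>x. W s x + W t x) = l2_inner \<Omega> (W s) (W s) - l2_inner \<Omega> (W t) (W t)"
        using l2_inner_commute[of \<Omega> "W t" "W s"] elim L2(1)[OF t]
        by (simp add: l2_inner_diff_left l2_inner_add_right L2_add)
      then show ?case by (simp add: l2_inner_scaleR_left divide_inverse)
    qed
  qed
  then show ?thesis by (simp add: has_field_derivative_iff l2_inner_scaleR_right)
qed

section \<open>Weak gradients\<close>

lemma test_functions_sum:
  assumes "finite I" "\<And>i. i \<in> I \<Longrightarrow> f i \<in> test_functions \<Omega>"
  shows "(\<lambda>x. \<Sum>i\<in>I. f i x) \<in> test_functions \<Omega>"
  using assms by (induction I rule: finite_induct) (simp_all add: test_functions_const_0 test_functions_add)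

text \<open>Indexed like \<open>wgrad\<close>, row by component and column by direction, so that for
  a test field \<open>classical_grad s x *v u x\<close> is the derivative of \<open>s\<close> along
  \<open>u x\<close>.\<close>

definition classical_grad :: "field \<Rightarrow> point \<Rightarrow> real ^ 3 ^ 3" where
  "classical_grad s x = (\<chi> i j. partial_deriv j s x $ i)"

lemma test_functions_classical_grad:
  assumes "s \<in> test_functions \<Omega>"
  shows "classical_grad s \<in> test_functions \<Omega>"
proof -
  \<comment> \<open>\<open>?L j\<close> puts a vector into column \<open>j\<close> of a zero matrix,
    which exhibits the gradient as a sum of linear images of the partial derivatives.\<close>
  let ?L = "\<lambda>j v. (\<chi> i k. v $ i * (if k = j then 1 else 0)) :: real ^ 3 ^ 3"
  have "linear (?L j)" for j
    by (rule linearI) (auto simp: vec_eq_iff algebra_simps)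
  then have L: "bounded_linear (?L j)" for j by (simp add: linear_conv_bounded_linear)
  have "classical_grad s = (\<lambda>x. \<Sum>j\<in>UNIV. ?L j (partial_deriv j s x))"
    by (simp add: fun_eq_iff classical_grad_def vec_eq_iff if_distrib cong: if_cong)
  then show ?thesis
    using test_functions_sum[OF finite, of UNIV "\<lambda>j x. ?L j (partial_deriv j s x)" \<Omega>]
      test_functions_linear[OF L test_functions_partial_deriv[OF assms]] by simp
qed

text \<open>A locale, since the estimates are needed on \<Omega> and on every rescaled copy of
  it.\<close>

locale bounded_open =
  fixes \<Omega> :: "point set"
  assumes open_domain: "open \<Omega>" and bounded_domain: "bounded \<Omega>"
begin

lemma domain_lebesgue: "\<Omega> \<in> sets lebesgue"
  using open_domain by auto

sublocale finite_measure "lebesgue_on \<Omega>"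
  using open_domain bounded_domain by (intro finite_measure_lebesgue_on lmeasurable_open)

lemma borel_measurable_domain: "f \<in> borel_measurable borel \<Longrightarrow> f \<in> borel_measurable (lebesgue_on \<Omega>)"
  by (intro measurable_restrict_space1 measurable_completion) simp

lemma test_functions_L2:
  fixes \<phi> :: "point \<Rightarrow> 'b::euclidean_space"
  assumes "\<phi> \<in> test_functions \<Omega>'"
  shows "\<phi> \<in> L2 \<Omega>"
proof -
  obtain B where "\<And>x. norm (\<phi> x) \<le> B" using test_functions_bounded[OF assms] by blast
  moreover have "(\<lambda>_. B) \<in> L2 \<Omega>" by (simp add: L2_def)
  moreover have "\<phi> \<in> borel_measurable (lebesgue_on \<Omega>)"
    by (rule borel_measurable_domain[OF test_functions_borel_measurable[OF assms]])
  ultimately show ?thesis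
    by (intro L2_bound[of "\<lambda>_. B" \<Omega> \<phi>]) (auto intro: order_trans[OF _ abs_ge_self])
qed

lemma L2_integrable_mult:
  fixes f g :: "point \<Rightarrow> real"
  assumes "f \<in> L2 \<Omega>" "g \<in> L2 \<Omega>"
  shows "integrable (lebesgue_on \<Omega>) (\<lambda>x. f x * g x)"
  using integrable_inner_L2[OF assms] by simp

lemma L2_integrable:
  fixes f :: "point \<Rightarrow> real"
  assumes "f \<in> L2 \<Omega>"
  shows "integrable (lebesgue_on \<Omega>) f"
proof -
  have "(\<lambda>_. 1::real) \<in> L2 \<Omega>" by (simp add: L2_def)
  from L2_integrable_mult[OF assms this] show ?thesis by simp
qed

text \<open>\<open>wgrad\<close> picks some weak gradient; uniqueness, which is the fundamental
  lemma applied to each entry, lets any computed gradient stand for it almost everywhere.\<close>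

lemma has_weak_grad_unique:
  assumes G: "G \<in> L2 \<Omega>" "has_weak_grad \<Omega> f G" and G': "G' \<in> L2 \<Omega>" "has_weak_grad \<Omega> f G'"
  shows "AE x in lebesgue_on \<Omega>. G x = G' x"
proof -
  have c: "(\<lambda>x. G x $ i $ j) \<in> L2 \<Omega>" "(\<lambda>x. G' x $ i $ j) \<in> L2 \<Omega>" for i j
    using L2_nth[OF L2_nth[OF G(1)]] L2_nth[OF L2_nth[OF G'(1)]] by blast+
  have "AE x in lebesgue_on \<Omega>. G x $ i $ j - G' x $ i $ j = 0" for i j
  proof (rule AE_zero_if_integral_test_zero[OF open_domain bounded_domain])
    show "integrable (lebesgue_on \<Omega>) (\<lambda>x. G x $ i $ j - G' x $ i $ j)"
      using c by (intro Bochner_Integration.integrable_diff L2_integrable)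
    fix \<phi> :: "point \<Rightarrow> real" assume \<phi>: "\<phi> \<in> test_functions \<Omega>"
    have "(LINT x|lebesgue_on \<Omega>. G x $ i $ j * \<phi> x) = (LINT x|lebesgue_on \<Omega>. G' x $ i $ j * \<phi> x)"
      using bspec[OF G(2)[unfolded has_weak_grad_def] \<phi>, rule_format, of i j]
        bspec[OF G'(2)[unfolded has_weak_grad_def] \<phi>, rule_format, of i j] by simp
    then show "(LINT x|lebesgue_on \<Omega>. (G x $ i $ j - G' x $ i $ j) * \<phi> x) = 0"
      using L2_integrable_mult[OF c(1) test_functions_L2[OF \<phi>]] L2_integrable_mult[OF c(2) test_functions_L2[OF \<phi>]]
      by (simp add: left_diff_distrib)
  qed
  then have "AE x in lebesgue_on \<Omega>. \<forall>i j. G x $ i $ j - G' x $ i $ j = 0"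
    by (simp add: AE_all_countable)
  then show ?thesis
    by eventually_elim (simp add: vec_eq_iff)
qed

lemma has_weak_grad_add:
  assumes "f \<in> L2 \<Omega>" "G \<in> L2 \<Omega>" "has_weak_grad \<Omega> f G" "f' \<in> L2 \<Omega>" "G' \<in> L2 \<Omega>" "has_weak_grad \<Omega> f' G'"
  shows "has_weak_grad \<Omega> (\<lambda>x. f x + f' x) (\<lambda>x. G x + G' x)"
  unfolding has_weak_grad_def
proof (intro ballI allI)
  fix \<phi> :: "point \<Rightarrow> real" and i j assume \<phi>: "\<phi> \<in> test_functions \<Omega>"
  note t = test_functions_L2[OF \<phi>] test_functions_L2[OF test_functions_partial_deriv[OF \<phi>], of j]
  have "(LINT x|lebesgue_on \<Omega>. (f x + f' x) $ i * partial_deriv j \<phi> x) =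
      (LINT x|lebesgue_on \<Omega>. f x $ i * partial_deriv j \<phi> x) + (LINT x|lebesgue_on \<Omega>. f' x $ i * partial_deriv j \<phi> x)"
    unfolding vector_add_component distrib_right
    by (rule Bochner_Integration.integral_add[OF L2_integrable_mult[OF L2_nth[OF assms(1)] t(2)]
          L2_integrable_mult[OF L2_nth[OF assms(4)] t(2)]])
  moreover have "(LINT x|lebesgue_on \<Omega>. (G x + G' x) $ i $ j * \<phi> x) =
      (LINT x|lebesgue_on \<Omega>. G x $ i $ j * \<phi> x) + (LINT x|lebesgue_on \<Omega>. G' x $ i $ j * \<phi> x)"
    unfolding vector_add_component distrib_right
    by (rule Bochner_Integration.integral_add[OF L2_integrable_mult[OF L2_nth[OF L2_nth[OF assms(2)]] t(1)]
          L2_integrable_mult[OF L2_nth[OF L2_nth[OF assms(5)]] t(1)]])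
  ultimately show "(LINT x|lebesgue_on \<Omega>. (f x + f' x) $ i * partial_deriv j \<phi> x) =
        - (LINT x|lebesgue_on \<Omega>. (G x + G' x) $ i $ j * \<phi> x)"
    using bspec[OF assms(3)[unfolded has_weak_grad_def] \<phi>, rule_format, of i j]
      bspec[OF assms(6)[unfolded has_weak_grad_def] \<phi>, rule_format, of i j] by linarith
qed

lemma has_weak_grad_scaleR:
  "has_weak_grad \<Omega> f G \<Longrightarrow> has_weak_grad \<Omega> (\<lambda>x. c *\<^sub>R f x) (\<lambda>x. c *\<^sub>R G x)"
  by (simp add: has_weak_grad_def mult.assoc)

lemma has_weak_grad_cong_AE:
  assumes "AE x in lebesgue_on \<Omega>. f x = f' x" "f \<in> L2 \<Omega>" "f' \<in> L2 \<Omega>" "has_weak_grad \<Omega> f G"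
  shows "has_weak_grad \<Omega> f' G"
  unfolding has_weak_grad_def
proof (intro ballI allI)
  fix \<phi> :: "point \<Rightarrow> real" and i j assume \<phi>: "\<phi> \<in> test_functions \<Omega>"
  note t = test_functions_L2[OF test_functions_partial_deriv[OF \<phi>], of j]
  have "(LINT x|lebesgue_on \<Omega>. f' x $ i * partial_deriv j \<phi> x) = (LINT x|lebesgue_on \<Omega>. f x $ i * partial_deriv j \<phi> x)"
    using assms(1) L2_integrable_mult[OF L2_nth[OF assms(2)] t, of i]
      L2_integrable_mult[OF L2_nth[OF assms(3)] t, of i]
    by (intro integral_cong_AE) auto
  then show "(LINT x|lebesgue_on \<Omega>. f' x $ i * partial_deriv j \<phi> x) = - (LINT x|lebesgue_on \<Omega>. G x $ i $ j * \<phi> x)"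
    using assms(4) \<phi> by (simp add: has_weak_grad_def)
qed

lemma has_weak_grad_test:
  assumes s: "s \<in> test_functions \<Omega>"
  shows "has_weak_grad \<Omega> s (classical_grad s)"
  unfolding has_weak_grad_def
proof (intro ballI allI)
  fix \<phi> :: "point \<Rightarrow> real" and i j assume \<phi>: "\<phi> \<in> test_functions \<Omega>"
  let ?s = "\<lambda>x. s x $ i"
  note T = test_functions_bilinear[OF bounded_bilinear_mult]
  have si: "?s \<in> test_functions \<Omega>" by (rule test_functions_nth[OF s])
  have pd: "partial_deriv j ?s = (\<lambda>x. classical_grad s x $ i $ j)"
    using partial_deriv_linear[OF bounded_linear_vec_nth s] by (simp add: fun_eq_iff classical_grad_def)
  have eq: "(LINT x|lebesgue_on \<Omega>. g x) = (LINT x|lborel. g x)" if "g \<in> test_functions \<Omega>" for g :: "point \<Rightarrow> real"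
    using that by (intro integral_lebesgue_on_eq_lborel domain_lebesgue test_functions_borel_measurable test_functions_zero)
  show "(LINT x|lebesgue_on \<Omega>. s x $ i * partial_deriv j \<phi> x) = - (LINT x|lebesgue_on \<Omega>. classical_grad s x $ i $ j * \<phi> x)"
    using integration_by_parts_test[OF si \<phi>, of j] eq[OF T[OF si test_functions_partial_deriv[OF \<phi>]]]
      eq[OF T[OF test_functions_partial_deriv[OF si, of j] \<phi>]] by (simp add: pd)
qed

section \<open>The spaces \<open>H\<^sup>1\<close>, \<open>H\<^sup>1\<^sub>0\<close> and \<open>V\<close>\<close>

lemma H1_I: "f \<in> L2 \<Omega> \<Longrightarrow> G \<in> L2 \<Omega> \<Longrightarrow> has_weak_grad \<Omega> f G \<Longrightarrow> f \<in> H1 \<Omega>"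
  unfolding H1_def by blast

lemma H1_L2: "f \<in> H1 \<Omega> \<Longrightarrow> f \<in> L2 \<Omega>"
  unfolding H1_def by blast

lemma
  assumes "f \<in> H1 \<Omega>"
  shows wgrad_L2: "wgrad \<Omega> f \<in> L2 \<Omega>" and wgrad_has_weak_grad: "has_weak_grad \<Omega> f (wgrad \<Omega> f)"
proof -
  have "\<exists>G. G \<in> L2 \<Omega> \<and> has_weak_grad \<Omega> f G" using assms unfolding H1_def by blast
  from someI_ex[OF this] show "wgrad \<Omega> f \<in> L2 \<Omega>" "has_weak_grad \<Omega> f (wgrad \<Omega> f)"
    unfolding wgrad_def by blast+
qed

lemma wgrad_eqI:
  assumes "f \<in> L2 \<Omega>" "G \<in> L2 \<Omega>" "has_weak_grad \<Omega> f G"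
  shows "AE x in lebesgue_on \<Omega>. wgrad \<Omega> f x = G x"
  using has_weak_grad_unique[OF wgrad_L2 wgrad_has_weak_grad] H1_I assms by blast

lemma H1_add: "f \<in> H1 \<Omega> \<Longrightarrow> g \<in> H1 \<Omega> \<Longrightarrow> (\<lambda>x. f x + g x) \<in> H1 \<Omega>"
  by (rule H1_I[OF L2_add[OF H1_L2 H1_L2] L2_add[OF wgrad_L2 wgrad_L2]
        has_weak_grad_add[OF H1_L2 wgrad_L2 wgrad_has_weak_grad H1_L2 wgrad_L2 wgrad_has_weak_grad]])

lemma H1_scaleR: "f \<in> H1 \<Omega> \<Longrightarrow> (\<lambda>x. c *\<^sub>R f x) \<in> H1 \<Omega>"
  by (rule H1_I[OF L2_scaleR[OF H1_L2] L2_scaleR[OF wgrad_L2] has_weak_grad_scaleR[OF wgrad_has_weak_grad]])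

lemma H1_diff: "f \<in> H1 \<Omega> \<Longrightarrow> g \<in> H1 \<Omega> \<Longrightarrow> (\<lambda>x. f x - g x) \<in> H1 \<Omega>"
  using H1_add[OF _ H1_scaleR[of g "-1"], of f] by simp

lemma wgrad_add:
  assumes "f \<in> H1 \<Omega>" "g \<in> H1 \<Omega>"
  shows "AE x in lebesgue_on \<Omega>. wgrad \<Omega> (\<lambda>x. f x + g x) x = wgrad \<Omega> f x + wgrad \<Omega> g x"
  by (rule wgrad_eqI[OF L2_add[OF H1_L2 H1_L2] L2_add[OF wgrad_L2 wgrad_L2]
        has_weak_grad_add[OF H1_L2 wgrad_L2 wgrad_has_weak_grad H1_L2 wgrad_L2 wgrad_has_weak_grad]];
      rule assms)

lemma wgrad_scaleR:
  assumes "f \<in> H1 \<Omega>"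
  shows "AE x in lebesgue_on \<Omega>. wgrad \<Omega> (\<lambda>x. c *\<^sub>R f x) x = c *\<^sub>R wgrad \<Omega> f x"
  by (rule wgrad_eqI[OF L2_scaleR[OF H1_L2] L2_scaleR[OF wgrad_L2]
        has_weak_grad_scaleR[OF wgrad_has_weak_grad]]; rule assms)

lemma wgrad_diff:
  assumes "f \<in> H1 \<Omega>" "g \<in> H1 \<Omega>"
  shows "AE x in lebesgue_on \<Omega>. wgrad \<Omega> (\<lambda>x. f x - g x) x = wgrad \<Omega> f x - wgrad \<Omega> g x"
  using wgrad_add[OF assms(1) H1_scaleR[OF assms(2), of "-1"]] wgrad_scaleR[OF assms(2), of "-1"]
  by eventually_elim simp

lemma wgrad_cong_AE:
  assumes "AE x in lebesgue_on \<Omega>. f x = g x" "f \<in> H1 \<Omega>" "g \<in> L2 \<Omega>"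
  shows "AE x in lebesgue_on \<Omega>. wgrad \<Omega> f x = wgrad \<Omega> g x"
  using wgrad_eqI[OF assms(3) wgrad_L2[OF assms(2)]
      has_weak_grad_cong_AE[OF assms(1) H1_L2[OF assms(2)] assms(3) wgrad_has_weak_grad[OF assms(2)]]]
  by eventually_elim simp

lemma H1_cong_AE:
  assumes "AE x in lebesgue_on \<Omega>. f x = g x" "f \<in> H1 \<Omega>" "g \<in> L2 \<Omega>"
  shows "g \<in> H1 \<Omega>"
  by (rule H1_I[OF assms(3) wgrad_L2[OF assms(2)]
        has_weak_grad_cong_AE[OF assms(1) H1_L2[OF assms(2)] assms(3) wgrad_has_weak_grad[OF assms(2)]]])

text \<open>The Dirichlet form, which is the weak form of the Stokes operator on
  \<open>V_space\<close>.\<close>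

definition grad_inner :: "field \<Rightarrow> field \<Rightarrow> real" where
  "grad_inner f g = l2_inner \<Omega> (wgrad \<Omega> f) (wgrad \<Omega> g)"

lemma V_norm_sq: "(V_norm \<Omega> f)\<^sup>2 = grad_inner f f"
  by (simp add: V_norm_def grad_inner_def l2_norm_sq)

lemma V_norm_nonneg: "0 \<le> V_norm \<Omega> f"
  by (simp add: V_norm_def l2_norm_nonneg)

lemma grad_inner_commute: "grad_inner f g = grad_inner g f"
  by (simp add: grad_inner_def l2_inner_commute)

lemma grad_inner_add_left:
  assumes "f \<in> H1 \<Omega>" "g \<in> H1 \<Omega>" "h \<in> H1 \<Omega>"
  shows "grad_inner (\<lambda>x. f x + g x) h = grad_inner f h + grad_inner g h"
proof -
  have "grad_inner (\<lambda>x. f x + g x) h = l2_inner \<Omega> (\<lambda>x. wgrad \<Omega> f x + wgrad \<Omega> g x) (wgrad \<Omega> h)"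
    unfolding grad_inner_def 
    by (rule l2_inner_cong_AE[OF wgrad_add[OF assms(1,2)] AE_I2[OF refl]])
      (simp_all add: assms wgrad_L2 L2_add H1_add)
  then show ?thesis using assms by (simp add: l2_inner_add_left wgrad_L2 grad_inner_def)
qed

lemma grad_inner_scaleR_left:
  assumes "f \<in> H1 \<Omega>" "h \<in> H1 \<Omega>"
  shows "grad_inner (\<lambda>x. c *\<^sub>R f x) h = c * grad_inner f h"
proof -
  have "grad_inner (\<lambda>x. c *\<^sub>R f x) h = l2_inner \<Omega> (\<lambda>x. c *\<^sub>R wgrad \<Omega> f x) (wgrad \<Omega> h)"
    unfolding grad_inner_def 
    by (rule l2_inner_cong_AE[OF wgrad_scaleR[OF assms(1)] AE_I2[OF refl]])
      (simp_all add: assms wgrad_L2 L2_scaleR H1_scaleR)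
  then show ?thesis by (simp add: l2_inner_scaleR_left grad_inner_def)
qed

lemma grad_inner_diff_left:
  assumes "f \<in> H1 \<Omega>" "g \<in> H1 \<Omega>" "h \<in> H1 \<Omega>"
  shows "grad_inner (\<lambda>x. f x - g x) h = grad_inner f h - grad_inner g h"
  using grad_inner_add_left[OF assms(1) H1_scaleR[OF assms(2), of "-1"] assms(3)]
    grad_inner_scaleR_left[OF assms(2,3), of "-1"] by simp

lemma grad_inner_add_right:
  "f \<in> H1 \<Omega> \<Longrightarrow> g \<in> H1 \<Omega> \<Longrightarrow> h \<in> H1 \<Omega> \<Longrightarrow> grad_inner h (\<lambda>x. f x + g x) = grad_inner h f + grad_inner h g"
  unfolding grad_inner_commute[of h "\<lambda>x. f x + g x"] grad_inner_commute[of h f] grad_inner_commute[of h g]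
  by (rule grad_inner_add_left)

lemma grad_inner_scaleR_right:
  "f \<in> H1 \<Omega> \<Longrightarrow> h \<in> H1 \<Omega> \<Longrightarrow> grad_inner h (\<lambda>x. c *\<^sub>R f x) = c * grad_inner h f"
  unfolding grad_inner_commute[of h "\<lambda>x. c *\<^sub>R f x"] grad_inner_commute[of h f]
  by (rule grad_inner_scaleR_left)

lemma grad_inner_Cauchy_Schwarz:
  "f \<in> H1 \<Omega> \<Longrightarrow> g \<in> H1 \<Omega> \<Longrightarrow> \<bar>grad_inner f g\<bar> \<le> V_norm \<Omega> f * V_norm \<Omega> g"
  unfolding grad_inner_def V_norm_def by (intro l2_Cauchy_Schwarz wgrad_L2)

lemma V_norm_cong_AE:
  assumes "AE x in lebesgue_on \<Omega>. f x = g x" "f \<in> H1 \<Omega>" "g \<in> L2 \<Omega>"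
  shows "V_norm \<Omega> f = V_norm \<Omega> g"
  unfolding V_norm_def
  using l2_norm_cong_AE[OF wgrad_cong_AE[OF assms]] wgrad_L2[OF assms(2)] wgrad_L2[OF H1_cong_AE[OF assms]] .

lemma V_norm_diff:
  assumes "f \<in> H1 \<Omega>" "g \<in> H1 \<Omega>"
  shows "V_norm \<Omega> (\<lambda>x. f x - g x) = l2_norm \<Omega> (\<lambda>x. wgrad \<Omega> f x - wgrad \<Omega> g x)"
  unfolding V_norm_def
  by (rule l2_norm_cong_AE[OF wgrad_diff[OF assms] wgrad_L2[OF H1_diff[OF assms]]
        L2_diff[OF wgrad_L2[OF assms(1)] wgrad_L2[OF assms(2)]]])

lemma V_norm_triangle:
  assumes "f \<in> H1 \<Omega>" "g \<in> H1 \<Omega>"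
  shows "V_norm \<Omega> (\<lambda>x. f x + g x) \<le> V_norm \<Omega> f + V_norm \<Omega> g"
proof -
  have "V_norm \<Omega> (\<lambda>x. f x + g x) = l2_norm \<Omega> (\<lambda>x. wgrad \<Omega> f x + wgrad \<Omega> g x)"
    unfolding V_norm_def
    by (rule l2_norm_cong_AE[OF wgrad_add[OF assms] wgrad_L2[OF H1_add[OF assms]]
          L2_add[OF wgrad_L2[OF assms(1)] wgrad_L2[OF assms(2)]]])
  then show ?thesis
    using l2_norm_triangle[OF wgrad_L2[OF assms(1)] wgrad_L2[OF assms(2)]] by (simp add: V_norm_def)
qed

lemma V_norm_scaleR:
  assumes "f \<in> H1 \<Omega>"
  shows "V_norm \<Omega> (\<lambda>x. c *\<^sub>R f x) = \<bar>c\<bar> * V_norm \<Omega> f"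
proof -
  have "V_norm \<Omega> (\<lambda>x. c *\<^sub>R f x) = l2_norm \<Omega> (\<lambda>x. c *\<^sub>R wgrad \<Omega> f x)"
    unfolding V_norm_def
    by (rule l2_norm_cong_AE[OF wgrad_scaleR[OF assms] wgrad_L2[OF H1_scaleR[OF assms]]
          L2_scaleR[OF wgrad_L2[OF assms]]])
  then show ?thesis by (simp add: l2_norm_scaleR V_norm_def)
qed

lemma test_H1: "s \<in> test_functions \<Omega> \<Longrightarrow> s \<in> H1 \<Omega>"
  by (rule H1_I[OF test_functions_L2 test_functions_L2[OF test_functions_classical_grad] has_weak_grad_test])

lemma wgrad_test:
  assumes "s \<in> test_functions \<Omega>"
  shows "AE x in lebesgue_on \<Omega>. wgrad \<Omega> s x = classical_grad s x"
  by (rule wgrad_eqI[OF test_functions_L2[OF assms]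
        test_functions_L2[OF test_functions_classical_grad[OF assms]] has_weak_grad_test[OF assms]])

lemma V_norm_test:
  assumes "s \<in> test_functions \<Omega>"
  shows "V_norm \<Omega> s = l2_norm \<Omega> (classical_grad s)"
  unfolding V_norm_def
  by (rule l2_norm_cong_AE[OF wgrad_test[OF assms] wgrad_L2[OF test_H1[OF assms]]
        test_functions_L2[OF test_functions_classical_grad[OF assms]]])

section \<open>Linear structure of the closure of the test functions\<close>

lemma H10_H1: "f \<in> H10 \<Omega> \<Longrightarrow> f \<in> H1 \<Omega>"
  by (simp add: H10_def)

lemma H10_approx:
  assumes "f \<in> H10 \<Omega>"
  obtains s where "\<And>n. s n \<in> test_functions \<Omega>" "(\<lambda>n. l2_norm \<Omega> (\<lambda>x. s n x - f x)) \<longlonglongrightarrow> 0"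
    "(\<lambda>n. V_norm \<Omega> (\<lambda>x. s n x - f x)) \<longlonglongrightarrow> 0"
  using assms unfolding H10_def V_norm_def by blast

lemma H10_I:
  assumes "f \<in> H1 \<Omega>" "\<And>n. s n \<in> test_functions \<Omega>" "(\<lambda>n. l2_norm \<Omega> (\<lambda>x. s n x - f x)) \<longlonglongrightarrow> 0"
    "(\<lambda>n. V_norm \<Omega> (\<lambda>x. s n x - f x)) \<longlonglongrightarrow> 0"
  shows "f \<in> H10 \<Omega>"
  using assms unfolding H10_def V_norm_def by blast

lemma test_H10:
  assumes "s \<in> test_functions \<Omega>" shows "s \<in> H10 \<Omega>"
proof -
  \<comment> \<open>The gradient of the zero field is also only chosen, so its norm is computed by
    scaling some field with the factor 0.\<close>
  have "V_norm \<Omega> (\<lambda>_. 0) = 0"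
    using V_norm_scaleR[OF test_H1[OF assms], of 0] by simp
  moreover have "l2_norm \<Omega> (\<lambda>_. 0 :: point) = 0"
    by (simp add: l2_norm_def l2_inner_def)
  ultimately show ?thesis
    by (intro H10_I[of s "\<lambda>_. s"] test_H1 assms) simp_all
qed

lemma H10_add:
  assumes "f \<in> H10 \<Omega>" "g \<in> H10 \<Omega>" shows "(\<lambda>x. f x + g x) \<in> H10 \<Omega>"
proof -
  obtain s where s: "\<And>n. s n \<in> test_functions \<Omega>" "(\<lambda>n. l2_norm \<Omega> (\<lambda>x. s n x - f x)) \<longlonglongrightarrow> 0"
    "(\<lambda>n. V_norm \<Omega> (\<lambda>x. s n x - f x)) \<longlonglongrightarrow> 0" using H10_approx[OF assms(1)] by blast
  obtain r where r: "\<And>n. r n \<in> test_functions \<Omega>" "(\<lambda>n. l2_norm \<Omega> (\<lambda>x. r n x - g x)) \<longlonglongrightarrow> 0"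
    "(\<lambda>n. V_norm \<Omega> (\<lambda>x. r n x - g x)) \<longlonglongrightarrow> 0" using H10_approx[OF assms(2)] by blast
  have H: "(\<lambda>x. s n x - f x) \<in> H1 \<Omega>" "(\<lambda>x. r n x - g x) \<in> H1 \<Omega>" for n
    by (intro H1_diff test_H1[OF s(1)] test_H1[OF r(1)] H10_H1[OF assms(1)] H10_H1[OF assms(2)])+
  have eq: "(\<lambda>x. (s n x + r n x) - (f x + g x)) = (\<lambda>x. (s n x - f x) + (r n x - g x))" for n
    by (simp add: fun_eq_iff)
  show ?thesis
  proof (rule H10_I[of _ "\<lambda>n x. s n x + r n x"])
    show "(\<lambda>x. f x + g x) \<in> H1 \<Omega>" using assms by (simp add: H1_add H10_H1)
    show "(\<lambda>x. s n x + r n x) \<in> test_functions \<Omega>" for n using s r by (simp add: test_functions_add)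
    show "(\<lambda>n. l2_norm \<Omega> (\<lambda>x. s n x + r n x - (f x + g x))) \<longlonglongrightarrow> 0"
      unfolding eq
      by (rule tendsto_sandwich[OF _ _ tendsto_const tendsto_add_zero[OF s(2) r(2)]])
        (auto intro!: always_eventually l2_norm_nonneg l2_norm_triangle H1_L2 H)
    show "(\<lambda>n. V_norm \<Omega> (\<lambda>x. s n x + r n x - (f x + g x))) \<longlonglongrightarrow> 0"
      unfolding eq
      by (rule tendsto_sandwich[OF _ _ tendsto_const tendsto_add_zero[OF s(3) r(3)]])
        (auto intro!: always_eventually V_norm_nonneg V_norm_triangle H)
  qed
qed

lemma H10_scaleR:
  assumes "f \<in> H10 \<Omega>" shows "(\<lambda>x. c *\<^sub>R f x) \<in> H10 \<Omega>"
proof -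
  obtain s where s: "\<And>n. s n \<in> test_functions \<Omega>" "(\<lambda>n. l2_norm \<Omega> (\<lambda>x. s n x - f x)) \<longlonglongrightarrow> 0"
    "(\<lambda>n. V_norm \<Omega> (\<lambda>x. s n x - f x)) \<longlonglongrightarrow> 0" using H10_approx[OF assms(1)] by blast
  have H: "(\<lambda>x. s n x - f x) \<in> H1 \<Omega>" for n
    by (intro H1_diff test_H1[OF s(1)] H10_H1[OF assms(1)])
  show ?thesis
  proof (rule H10_I[of _ "\<lambda>n x. c *\<^sub>R s n x"])
    show "(\<lambda>x. c *\<^sub>R f x) \<in> H1 \<Omega>" using assms by (simp add: H1_scaleR H10_H1)
    show "(\<lambda>x. c *\<^sub>R s n x) \<in> test_functions \<Omega>" for n using s by (simp add: test_functions_scaleR)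
    show "(\<lambda>n. l2_norm \<Omega> (\<lambda>x. c *\<^sub>R s n x - c *\<^sub>R f x)) \<longlonglongrightarrow> 0"
      using tendsto_mult_right_zero[OF s(2), of "\<bar>c\<bar>"]
      by (simp add: scaleR_diff_right[symmetric] l2_norm_scaleR)
    show "(\<lambda>n. V_norm \<Omega> (\<lambda>x. c *\<^sub>R s n x - c *\<^sub>R f x)) \<longlonglongrightarrow> 0"
      using tendsto_mult_right_zero[OF s(3), of "\<bar>c\<bar>"]
      by (simp add: scaleR_diff_right[symmetric] V_norm_scaleR[OF H])
  qed
qed

section \<open>Linear structure of \<open>H_space\<close> and \<open>V_space\<close>\<close>

lemma H_space_L2: "f \<in> H_space \<Omega> \<Longrightarrow> f \<in> L2 \<Omega>"
  by (simp add: H_space_def)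

lemma solenoidal_add:
  assumes "s \<in> solenoidal_test_fields \<Omega>" "r \<in> solenoidal_test_fields \<Omega>"
  shows "(\<lambda>x. s x + r x) \<in> solenoidal_test_fields \<Omega>"
proof -
  have t: "s \<in> test_functions \<Omega>" "r \<in> test_functions \<Omega>"
    and d: "(\<Sum>i\<in>UNIV. partial_deriv i s x $ i) = 0" "(\<Sum>i\<in>UNIV. partial_deriv i r x $ i) = 0" for x
    using assms by (auto simp: solenoidal_test_fields_def)
  have "partial_deriv i (\<lambda>x. s x + r x) x = partial_deriv i s x + partial_deriv i r x" for i x
    unfolding partial_deriv_def
    using frechet_derivative_eqI[OF has_derivative_add[OF test_functions_has_derivative[OF t(1)]
          test_functions_has_derivative[OF t(2)]]] by simp
  then show ?thesis
    using t d by (simp add: solenoidal_test_fields_def test_functions_add sum.distrib)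
qed

lemma solenoidal_scaleR:
  assumes "s \<in> solenoidal_test_fields \<Omega>"
  shows "(\<lambda>x. c *\<^sub>R s x) \<in> solenoidal_test_fields \<Omega>"
proof -
  have t: "s \<in> test_functions \<Omega>" and d: "(\<Sum>i\<in>UNIV. partial_deriv i s x $ i) = 0" for x
    using assms by (auto simp: solenoidal_test_fields_def)
  show ?thesis
    using t d partial_deriv_linear[OF bounded_linear_scaleR_right t]
    by (simp add: solenoidal_test_fields_def test_functions_scaleR sum_distrib_left[symmetric])
qed

lemma H_space_add:
  assumes "f \<in> H_space \<Omega>" "g \<in> H_space \<Omega>" shows "(\<lambda>x. f x + g x) \<in> H_space \<Omega>"
proof -
  obtain s where s: "\<And>n. s n \<in> solenoidal_test_fields \<Omega>" "(\<lambda>n. l2_norm \<Omega> (\<lambda>x. s n x - f x)) \<longlonglongrightarrow> 0"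
    using assms(1) unfolding H_space_def by blast
  obtain r where r: "\<And>n. r n \<in> solenoidal_test_fields \<Omega>" "(\<lambda>n. l2_norm \<Omega> (\<lambda>x. r n x - g x)) \<longlonglongrightarrow> 0"
    using assms(2) unfolding H_space_def by blast
  have t: "s n \<in> L2 \<Omega>" "r n \<in> L2 \<Omega>" for n
    using s(1)[of n] r(1)[of n] test_functions_L2 unfolding solenoidal_test_fields_def by blast+
  have H: "(\<lambda>x. s n x - f x) \<in> L2 \<Omega>" "(\<lambda>x. r n x - g x) \<in> L2 \<Omega>" for n
    using assms t by (simp_all add: L2_diff H_space_L2)
  have eq: "(\<lambda>x. (s n x + r n x) - (f x + g x)) = (\<lambda>x. (s n x - f x) + (r n x - g x))" for n
    by (simp add: fun_eq_iff)
  have "(\<lambda>n. l2_norm \<Omega> (\<lambda>x. s n x + r n x - (f x + g x))) \<longlonglongrightarrow> 0"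
    unfolding eq
    by (rule tendsto_sandwich[OF _ _ tendsto_const tendsto_add_zero[OF s(2) r(2)]])
      (auto intro!: always_eventually l2_norm_nonneg l2_norm_triangle H)
  moreover have "(\<lambda>x. f x + g x) \<in> L2 \<Omega>" using assms by (simp add: L2_add H_space_L2)
  ultimately show ?thesis
    using solenoidal_add[OF s(1) r(1)] unfolding H_space_def
    by (intro CollectI conjI exI[of _ "\<lambda>n x. s n x + r n x"]) auto
qed

lemma H_space_scaleR:
  assumes "f \<in> H_space \<Omega>" shows "(\<lambda>x. c *\<^sub>R f x) \<in> H_space \<Omega>"
proof -
  obtain s where s: "\<And>n. s n \<in> solenoidal_test_fields \<Omega>" "(\<lambda>n. l2_norm \<Omega> (\<lambda>x. s n x - f x)) \<longlonglongrightarrow> 0"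
    using assms(1) unfolding H_space_def by blast
  have "(\<lambda>n. l2_norm \<Omega> (\<lambda>x. c *\<^sub>R s n x - c *\<^sub>R f x)) \<longlonglongrightarrow> 0"
    using tendsto_mult_right_zero[OF s(2), of "\<bar>c\<bar>"]
    by (simp add: scaleR_diff_right[symmetric] l2_norm_scaleR)
  moreover have "(\<lambda>x. c *\<^sub>R f x) \<in> L2 \<Omega>" using assms by (simp add: L2_scaleR H_space_L2)
  ultimately show ?thesis
    using solenoidal_scaleR[OF s(1)] unfolding H_space_def
    by (intro CollectI conjI exI[of _ "\<lambda>n x. c *\<^sub>R s n x"]) auto
qed

lemma V_H10: "v \<in> V_space \<Omega> \<Longrightarrow> v \<in> H10 \<Omega>" and V_H: "v \<in> V_space \<Omega> \<Longrightarrow> v \<in> H_space \<Omega>"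
  by (simp_all add: V_space_def)

lemma V_H1: "v \<in> V_space \<Omega> \<Longrightarrow> v \<in> H1 \<Omega>"
  by (simp add: V_H10 H10_H1)

lemma V_L2: "v \<in> V_space \<Omega> \<Longrightarrow> v \<in> L2 \<Omega>"
  by (simp add: V_H1 H1_L2)

lemma V_add: "f \<in> V_space \<Omega> \<Longrightarrow> g \<in> V_space \<Omega> \<Longrightarrow> (\<lambda>x. f x + g x) \<in> V_space \<Omega>"
  by (simp add: V_space_def H10_add H_space_add)

lemma V_scaleR: "f \<in> V_space \<Omega> \<Longrightarrow> (\<lambda>x. c *\<^sub>R f x) \<in> V_space \<Omega>"
  by (simp add: V_space_def H10_scaleR H_space_scaleR)

lemma V_diff: "f \<in> V_space \<Omega> \<Longrightarrow> g \<in> V_space \<Omega> \<Longrightarrow> (\<lambda>x. f x - g x) \<in> V_space \<Omega>"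
  using V_add[OF _ V_scaleR[of g "-1"], of f] by simp

lemma H10_diff: "f \<in> H10 \<Omega> \<Longrightarrow> g \<in> H10 \<Omega> \<Longrightarrow> (\<lambda>x. f x - g x) \<in> H10 \<Omega>"
  using H10_add[OF _ H10_scaleR[of g "-1"], of f] by simp

end

section \<open>Ladyzhenskaya's inequality in three dimensions\<close>

definition vec3 :: "real \<Rightarrow> real \<Rightarrow> real \<Rightarrow> point" where
  "vec3 x y z = x *\<^sub>R axis 1 1 + y *\<^sub>R axis 2 1 + z *\<^sub>R axis 3 1"

lemma vec3_nth [simp]: "vec3 x y z $ 1 = x" "vec3 x y z $ 2 = y" "vec3 x y z $ 3 = z"
  by (simp_all add: vec3_def axis_def)

lemma vec3_measurable [measurable (raw)]:
  assumes [measurable]: "f \<in> borel_measurable M" "g \<in> borel_measurable M" "h \<in> borel_measurable M"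
  shows "(\<lambda>w. vec3 (f w) (g w) (h w)) \<in> borel_measurable M"
  unfolding vec3_def by measurable

lemma prod_Basis_vec3: "(\<Prod>b\<in>Basis. (w::point) \<bullet> b) = w $ 1 * w $ 2 * w $ 3"
proof -
  have B: "(Basis :: point set) = range (\<lambda>i. axis i 1)"
    by (auto simp: Basis_vec_def)
  have "inj (\<lambda>i::3. axis i (1::real))"
    by (auto simp: inj_on_def axis_eq_axis)
  then have "(\<Prod>b\<in>Basis. w \<bullet> b) = (\<Prod>i\<in>UNIV. w \<bullet> axis i 1)"
    unfolding B by (subst prod.reindex) (auto simp: o_def)
  also have "\<dots> = (\<Prod>i\<in>UNIV. w $ i)" by (simp add: inner_axis)
  also have "\<dots> = w $ 1 * w $ 2 * w $ 3" unfolding UNIV_3 by simp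
  finally show ?thesis .
qed

lemma sigma_finite_lborel_pair:
  "sigma_finite_measure (lborel \<Otimes>\<^sub>M lborel :: ('a::euclidean_space \<times> 'b::euclidean_space) measure)"
  by (simp add: lborel_prod sigma_finite_lborel)

text \<open>Lebesgue measure is determined by its values on boxes, whose preimages are products of
  intervals. The third coordinate comes first so that it is outermost in iterated integrals, with
  horizontal planes as slices.\<close>

lemma lborel_vec3:
  "lborel = distr (lborel \<Otimes>\<^sub>M (lborel \<Otimes>\<^sub>M lborel)) borel (\<lambda>(z, x, y). vec3 x y z)"
proof (rule lborel_eqI)
  fix l u :: point assume le: "\<And>b. b \<in> Basis \<Longrightarrow> l \<bullet> b \<le> u \<bullet> b"
  have lu: "l $ i \<le> u $ i" for i
    using le[of "axis i 1"] by (auto simp: Basis_vec_def inner_axis)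
  have m: "(\<lambda>(z, x, y). vec3 x y z) \<in> borel_measurable (lborel \<Otimes>\<^sub>M (lborel \<Otimes>\<^sub>M lborel))"
    by measurable
  have v: "(\<lambda>(z, x, y). vec3 x y z) -` box l u = {l$3<..<u$3} \<times> ({l$1<..<u$1} \<times> {l$2<..<u$2})"
    by (auto simp: mem_box_cart forall_3)
  have "emeasure (distr (lborel \<Otimes>\<^sub>M (lborel \<Otimes>\<^sub>M lborel)) borel (\<lambda>(z, x, y). vec3 x y z)) (box l u)
      = emeasure (lborel \<Otimes>\<^sub>M (lborel \<Otimes>\<^sub>M lborel)) ({l$3<..<u$3} \<times> ({l$1<..<u$1} \<times> {l$2<..<u$2}))"
    using m by (subst emeasure_distr) (auto simp: v space_pair_measure)
  also have "\<dots> = emeasure lborel {l$3<..<u$3} * (emeasure lborel {l$1<..<u$1} * emeasure lborel {l$2<..<u$2})"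
    by (subst sigma_finite_measure.emeasure_pair_measure_Times[OF sigma_finite_lborel_pair],
        simp, measurable, subst lborel.emeasure_pair_measure_Times) auto
  also have "\<dots> = (\<Prod>b\<in>Basis. (u - l) \<bullet> b)"
    unfolding prod_Basis_vec3 using lu
    by (simp add: ennreal_mult' [symmetric] mult_ac)
  finally show "emeasure (distr (lborel \<Otimes>\<^sub>M (lborel \<Otimes>\<^sub>M lborel)) borel (\<lambda>(z, x, y). vec3 x y z)) (box l u)
      = (\<Prod>b\<in>Basis. (u - l) \<bullet> b)" .
qed simp

lemma nn_integral_vec3:
  assumes [measurable]: "f \<in> borel_measurable borel"
  shows "(\<integral>\<^sup>+p. f p \<partial>lborel) = (\<integral>\<^sup>+z. \<integral>\<^sup>+x. \<integral>\<^sup>+y. f (vec3 x y z) \<partial>lborel \<partial>lborel \<partial>lborel)"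
proof -
  let ?T = "\<lambda>w::real \<times> real \<times> real. case w of (z, x, y) \<Rightarrow> vec3 x y z"
  have T: "?T \<in> borel_measurable (lborel \<Otimes>\<^sub>M (lborel \<Otimes>\<^sub>M lborel))" by measurable
  have fT: "(\<lambda>w. f (?T w)) \<in> borel_measurable (lborel \<Otimes>\<^sub>M (lborel \<Otimes>\<^sub>M lborel))"
    by (rule measurable_compose[OF T assms])
  have "(\<integral>\<^sup>+p. f p \<partial>lborel) = (\<integral>\<^sup>+w. f (case w of (z, x, y) \<Rightarrow> vec3 x y z) \<partial>(lborel \<Otimes>\<^sub>M (lborel \<Otimes>\<^sub>M lborel)))"
    by (subst lborel_vec3, subst nn_integral_distr) auto
  also have "\<dots> = (\<integral>\<^sup>+z. \<integral>\<^sup>+w. f (case w of (x, y) \<Rightarrow> vec3 x y z) \<partial>(lborel \<Otimes>\<^sub>M lborel) \<partial>lborel)"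
    by (subst sigma_finite_measure.nn_integral_fst[OF sigma_finite_lborel_pair fT, symmetric]) simp
  also have "\<dots> = (\<integral>\<^sup>+z. \<integral>\<^sup>+x. \<integral>\<^sup>+y. f (vec3 x y z) \<partial>lborel \<partial>lborel \<partial>lborel)"
    by (intro nn_integral_cong, subst lborel.nn_integral_fst[symmetric]) auto
  finally show ?thesis .
qed

text \<open>
  The squares are bounded by line integrals in each of the three directions: the first two bounds
  are multiplied to estimate the fourth power on planes, the third one controls the mass of a plane.
\<close>

lemma nn_Ladyzhenskaya:
  fixes a b :: "point \<Rightarrow> ennreal"
  assumes [measurable]: "a \<in> borel_measurable borel" "b \<in> borel_measurable borel"
    and h1: "\<And>x y z. (a (vec3 x y z))\<^sup>2 \<le> (\<integral>\<^sup>+t. a (vec3 t y z) * b (vec3 t y z) \<partial>lborel)"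
    and h2: "\<And>x y z. (a (vec3 x y z))\<^sup>2 \<le> (\<integral>\<^sup>+t. a (vec3 x t z) * b (vec3 x t z) \<partial>lborel)"
    and h3: "\<And>x y z. (a (vec3 x y z))\<^sup>2 \<le> (\<integral>\<^sup>+t. a (vec3 x y t) * b (vec3 x y t) \<partial>lborel)"
  shows "(\<integral>\<^sup>+p. (a p) ^ 4 \<partial>lborel)\<^sup>2 \<le> (\<integral>\<^sup>+p. (a p)\<^sup>2 \<partial>lborel) * (\<integral>\<^sup>+p. (b p)\<^sup>2 \<partial>lborel) ^ 3"
proof -
  define G where "G x y z = a (vec3 x y z) * b (vec3 x y z)" for x y z
  have [measurable]: "(\<lambda>w. G (f w) (g w) (h w)) \<in> borel_measurable M"
    if [measurable]: "f \<in> borel_measurable M" "g \<in> borel_measurable M" "h \<in> borel_measurable M" for f g h and M :: "'m measure"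
    unfolding G_def by measurable
  define M where "M = (\<integral>\<^sup>+p. a p * b p \<partial>lborel)"
  define n where "n z = (\<integral>\<^sup>+x. \<integral>\<^sup>+y. (b (vec3 x y z))\<^sup>2 \<partial>lborel \<partial>lborel)" for z
  define m where "m z = (\<integral>\<^sup>+x. \<integral>\<^sup>+y. (a (vec3 x y z))\<^sup>2 \<partial>lborel \<partial>lborel)" for z
  define g where "g z = (\<integral>\<^sup>+x. \<integral>\<^sup>+y. G x y z \<partial>lborel \<partial>lborel)" for z
  have [measurable]: "n \<in> borel_measurable borel" unfolding n_def[abs_def] by measurable
  \<comment> \<open>The total mass is rewritten with \<open>z\<close> innermost, so that it can be
    compared with the line integrals in \<open>h3\<close>.\<close>
  have M_eq: "M = (\<integral>\<^sup>+x. \<integral>\<^sup>+y. \<integral>\<^sup>+z. G x y z \<partial>lborel \<partial>lborel \<partial>lborel)"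
  proof -
    have "M = (\<integral>\<^sup>+z. \<integral>\<^sup>+x. \<integral>\<^sup>+y. G x y z \<partial>lborel \<partial>lborel \<partial>lborel)"
      unfolding M_def G_def by (subst nn_integral_vec3) auto
    also have "\<dots> = (\<integral>\<^sup>+x. \<integral>\<^sup>+z. \<integral>\<^sup>+y. G x y z \<partial>lborel \<partial>lborel \<partial>lborel)"
      by (rule lborel_pair.Fubini') measurable
    also have "\<dots> = (\<integral>\<^sup>+x. \<integral>\<^sup>+y. \<integral>\<^sup>+z. G x y z \<partial>lborel \<partial>lborel \<partial>lborel)"
      by (intro nn_integral_cong lborel_pair.Fubini') measurable
    finally show ?thesis .
  qed
  have m_le: "m z \<le> M" for z
    unfolding m_def M_eq G_def by (intro nn_integral_mono h3)
  have g_le: "(g z)\<^sup>2 \<le> m z * n z" for z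
  proof -
    let ?P = "lborel \<Otimes>\<^sub>M lborel :: (real \<times> real) measure"
    have F: "(\<integral>\<^sup>+x. \<integral>\<^sup>+y. f (vec3 x y z) \<partial>lborel \<partial>lborel) = (\<integral>\<^sup>+w. f (vec3 (fst w) (snd w) z) \<partial>?P)"
      if [measurable]: "f \<in> borel_measurable borel" for f :: "point \<Rightarrow> ennreal"
      by (subst lborel.nn_integral_fst[symmetric]) auto
    have g1: "g z = (\<integral>\<^sup>+w. a (vec3 (fst w) (snd w) z) * b (vec3 (fst w) (snd w) z) \<partial>?P)"
      unfolding g_def G_def using F[of "\<lambda>p. a p * b p"] by simp
    have m1: "m z = (\<integral>\<^sup>+w. (a (vec3 (fst w) (snd w) z))\<^sup>2 \<partial>?P)"
      unfolding m_def using F[of "\<lambda>p. (a p)\<^sup>2"] by simp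
    have n1: "n z = (\<integral>\<^sup>+w. (b (vec3 (fst w) (snd w) z))\<^sup>2 \<partial>?P)"
      unfolding n_def using F[of "\<lambda>p. (b p)\<^sup>2"] by simp
    show ?thesis unfolding g1 m1 n1 by (rule Cauchy_Schwarz_nn_integral) measurable
  qed
  have plane: "(\<integral>\<^sup>+x. \<integral>\<^sup>+y. (a (vec3 x y z)) ^ 4 \<partial>lborel \<partial>lborel) \<le> (g z)\<^sup>2" for z
  proof -
    have "(\<integral>\<^sup>+x. \<integral>\<^sup>+y. (a (vec3 x y z)) ^ 4 \<partial>lborel \<partial>lborel)
        \<le> (\<integral>\<^sup>+x. \<integral>\<^sup>+y. (\<integral>\<^sup>+t. G t y z \<partial>lborel) * (\<integral>\<^sup>+t. G x t z \<partial>lborel) \<partial>lborel \<partial>lborel)"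
    proof (intro nn_integral_mono)
      fix x y
      have "(a (vec3 x y z)) ^ 4 = (a (vec3 x y z))\<^sup>2 * (a (vec3 x y z))\<^sup>2"
        by (simp add: power2_eq_square power4_eq_xxxx mult.assoc)
      also have "\<dots> \<le> (\<integral>\<^sup>+t. G t y z \<partial>lborel) * (\<integral>\<^sup>+t. G x t z \<partial>lborel)"
        unfolding G_def by (intro mult_mono h1 h2) auto
      finally show "(a (vec3 x y z)) ^ 4 \<le> (\<integral>\<^sup>+t. G t y z \<partial>lborel) * (\<integral>\<^sup>+t. G x t z \<partial>lborel)" .
    qed
    \<comment> \<open>The first line integral does not depend on x and the second not on y, so the
      integral of their product over the plane factorizes.\<close>
    also have "\<dots> = (\<integral>\<^sup>+x. (\<integral>\<^sup>+y. \<integral>\<^sup>+t. G t y z \<partial>lborel \<partial>lborel) * (\<integral>\<^sup>+t. G x t z \<partial>lborel) \<partial>lborel)"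
      by (intro nn_integral_cong nn_integral_multc) measurable
    also have "\<dots> = (\<integral>\<^sup>+y. \<integral>\<^sup>+t. G t y z \<partial>lborel \<partial>lborel) * g z"
      unfolding g_def by (intro nn_integral_cmult) measurable
    also have "(\<integral>\<^sup>+y. \<integral>\<^sup>+t. G t y z \<partial>lborel \<partial>lborel) = g z"
      unfolding g_def by (rule lborel_pair.Fubini') measurable
    finally show ?thesis by (simp add: power2_eq_square)
  qed
  have "(\<integral>\<^sup>+p. (a p) ^ 4 \<partial>lborel) = (\<integral>\<^sup>+z. \<integral>\<^sup>+x. \<integral>\<^sup>+y. (a (vec3 x y z)) ^ 4 \<partial>lborel \<partial>lborel \<partial>lborel)"
    by (subst nn_integral_vec3) auto
  also have "\<dots> \<le> (\<integral>\<^sup>+z. M * n z \<partial>lborel)"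
    by (intro nn_integral_mono order_trans[OF plane] order_trans[OF g_le] mult_right_mono m_le) auto
  also have "\<dots> = M * (\<integral>\<^sup>+z. n z \<partial>lborel)"
    by (rule nn_integral_cmult) measurable
  also have "(\<integral>\<^sup>+z. n z \<partial>lborel) = (\<integral>\<^sup>+p. (b p)\<^sup>2 \<partial>lborel)"
    unfolding n_def by (subst nn_integral_vec3) auto
  finally have "(\<integral>\<^sup>+p. (a p) ^ 4 \<partial>lborel)\<^sup>2 \<le> (M * (\<integral>\<^sup>+p. (b p)\<^sup>2 \<partial>lborel))\<^sup>2"
    by (intro power_mono) auto
  also have "\<dots> = M\<^sup>2 * (\<integral>\<^sup>+p. (b p)\<^sup>2 \<partial>lborel)\<^sup>2" by (rule power_mult_distrib)
  also have "\<dots> \<le> ((\<integral>\<^sup>+p. (a p)\<^sup>2 \<partial>lborel) * (\<integral>\<^sup>+p. (b p)\<^sup>2 \<partial>lborel)) * (\<integral>\<^sup>+p. (b p)\<^sup>2 \<partial>lborel)\<^sup>2"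
    unfolding M_def by (intro mult_right_mono Cauchy_Schwarz_nn_integral) auto
  finally show ?thesis by (simp add: power3_eq_cube power2_eq_square mult_ac)
qed

section \<open>From derivatives along lines to Ladyzhenskaya's inequality\<close>

lemma norm_partial_deriv_le: "norm (partial_deriv j s x) \<le> norm (classical_grad s x)"
proof (rule power2_le_imp_le)
  have "(norm (partial_deriv j s x))\<^sup>2 = (\<Sum>i\<in>UNIV. (classical_grad s x $ i $ j)\<^sup>2)"
    unfolding power2_norm_eq_inner inner_vec_def classical_grad_def by (simp add: power2_eq_square)
  also have "\<dots> \<le> (\<Sum>i\<in>UNIV. \<Sum>k\<in>UNIV. (classical_grad s x $ i $ k)\<^sup>2)"
    by (intro sum_mono member_le_sum[of j UNIV "\<lambda>k. (classical_grad s x $ _ $ k)\<^sup>2"]) auto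
  also have "\<dots> = (norm (classical_grad s x))\<^sup>2"
    unfolding power2_norm_eq_inner inner_vec_def by (simp add: power2_eq_square)
  finally show "(norm (partial_deriv j s x))\<^sup>2 \<le> (norm (classical_grad s x))\<^sup>2" .
qed simp

text \<open>The fundamental theorem of calculus is applied from a point behind the support up to
  \<open>p\<close>; the segment is then enlarged to the whole line.\<close>

lemma test_function_le_line_integral:
  fixes \<phi> :: "point \<Rightarrow> real"
  assumes \<phi>: "\<phi> \<in> test_functions \<Omega>"
  shows "ennreal \<bar>\<phi> p\<bar> \<le> (\<integral>\<^sup>+t. ennreal \<bar>partial_deriv j \<phi> (p + t *\<^sub>R axis j 1)\<bar> \<partial>lborel)"
proof -
  let ?e = "axis j 1 :: point"
  obtain K where K: "compact K" "K \<subseteq> \<Omega>" "\<And>x. x \<notin> K \<Longrightarrow> \<phi> x = 0"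
    using assms unfolding test_functions_def by blast
  obtain R where R: "\<And>x. x \<in> K \<Longrightarrow> norm x \<le> R"
    using compact_imp_bounded[OF K(1)] bounded_iff by metis
  \<comment> \<open>\<open>r\<close> exceeds the sum of the radius of the support and the norm of
    \<open>p\<close>, so the line has left the support at the parameter -r.\<close>
  define r where "r = \<bar>R\<bar> + norm p + 1"
  have r: "r > 0" by (auto simp: r_def intro: add_nonneg_pos)
  have "norm (p + (- r) *\<^sub>R ?e) \<ge> r - norm p"
    using norm_triangle_ineq2[of "r *\<^sub>R ?e" p] r norm_minus_commute[of p "r *\<^sub>R ?e"] by simp
  then have "p + (- r) *\<^sub>R ?e \<notin> K" using R[of "p + (- r) *\<^sub>R ?e"] by (auto simp: r_def)
  then have zero: "\<phi> (p + (- r) *\<^sub>R ?e) = 0" by (rule K(3))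
  let ?f = "\<lambda>t. partial_deriv j \<phi> (p + t *\<^sub>R ?e)"
  have cont: "continuous_on S ?f" for S
    by (rule continuous_on_compose2[OF test_functions_continuous[OF test_functions_partial_deriv[OF \<phi>], of UNIV]])
      (auto intro!: continuous_intros)
  have [measurable]: "?f \<in> borel_measurable borel"
    by (rule borel_measurable_continuous_onI[OF cont])
  have "(LINT t|lborel. indicator {-r..0} t *\<^sub>R ?f t) = \<phi> (p + 0 *\<^sub>R ?e) - \<phi> (p + (- r) *\<^sub>R ?e)"
    using r test_functions_has_vector_derivative_line[OF \<phi>, of p ?e]
    by (intro integral_FTC_atLeastAtMost cont) (auto simp: partial_deriv_def)
  then have "ennreal \<bar>\<phi> p\<bar> = ennreal (norm (LINT t|lborel. indicator {-r..0} t *\<^sub>R ?f t))"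
    using zero by simp
  also have "\<dots> \<le> (\<integral>\<^sup>+t. ennreal (norm (indicator {-r..0} t *\<^sub>R ?f t)) \<partial>lborel)"
    by (rule integral_norm_bound_ennreal[OF borel_integrable_compact[OF compact_Icc cont]])
  also have "\<dots> \<le> (\<integral>\<^sup>+t. ennreal \<bar>?f t\<bar> \<partial>lborel)"
    by (intro nn_integral_mono) (auto simp: indicator_def)
  finally show ?thesis .
qed

text \<open>The line bound is applied to |s|^2, which is smooth, unlike |s|. Its derivative is at
  most 2 |s| |nabla s|, whence the factor 2 in \<open>b\<close>, and the cube of the integral of b^2
  contributes 4^3 = 64.\<close>

lemma Ladyzhenskaya_test_nn:
  fixes s :: field
  assumes s: "s \<in> test_functions \<Omega>"
  shows "(\<integral>\<^sup>+p. ennreal (norm (s p) ^ 4) \<partial>lborel)\<^sup>2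
     \<le> 64 * (\<integral>\<^sup>+p. ennreal ((norm (s p))\<^sup>2) \<partial>lborel) * (\<integral>\<^sup>+p. ennreal ((norm (classical_grad s p))\<^sup>2) \<partial>lborel) ^ 3"
proof -
  define a where "a p = ennreal (norm (s p))" for p
  define b where "b p = ennreal (2 * norm (classical_grad s p))" for p
  have meas [measurable]: "s \<in> borel_measurable borel" "classical_grad s \<in> borel_measurable borel"
    using test_functions_borel_measurable[OF s] test_functions_borel_measurable[OF test_functions_classical_grad[OF s]] .
  have ab [measurable]: "a \<in> borel_measurable borel" "b \<in> borel_measurable borel"
    unfolding a_def[abs_def] b_def[abs_def] by measurable
  let ?\<phi> = "\<lambda>p. s p \<bullet> s p"
  have \<phi>: "?\<phi> \<in> test_functions \<Omega>" by (rule test_functions_bilinear[OF bounded_bilinear_inner s s])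
  have D: "ennreal \<bar>partial_deriv j ?\<phi> p\<bar> \<le> a p * b p" for j p
  proof -
    have "partial_deriv j ?\<phi> p = 2 * (s p \<bullet> partial_deriv j s p)"
      by (simp add: partial_deriv_bilinear[OF bounded_bilinear_inner s s] inner_commute)
    also have "\<bar>\<dots>\<bar> \<le> norm (s p) * (2 * norm (classical_grad s p))"
      using Cauchy_Schwarz_ineq2[of "s p" "partial_deriv j s p"]
        mult_left_mono[OF norm_partial_deriv_le[of j s p] norm_ge_zero[of "s p"]] by (simp add: abs_mult)
    finally show ?thesis
      unfolding a_def b_def by (subst ennreal_mult[symmetric]) (auto intro: ennreal_leI)
  qed
  have line: "(a p)\<^sup>2 \<le> (\<integral>\<^sup>+t. a (p + t *\<^sub>R axis j 1) * b (p + t *\<^sub>R axis j 1) \<partial>lborel)" for p j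
  proof -
    have "(a p)\<^sup>2 = ennreal \<bar>?\<phi> p\<bar>"
      by (simp add: a_def ennreal_power power2_norm_eq_inner)
    also have "\<dots> \<le> (\<integral>\<^sup>+t. ennreal \<bar>partial_deriv j ?\<phi> (p + t *\<^sub>R axis j 1)\<bar> \<partial>lborel)"
      by (rule test_function_le_line_integral[OF \<phi>])
    also have "\<dots> \<le> (\<integral>\<^sup>+t. a (p + t *\<^sub>R axis j 1) * b (p + t *\<^sub>R axis j 1) \<partial>lborel)"
      by (intro nn_integral_mono D)
    finally show ?thesis .
  qed
  have L: "(\<integral>\<^sup>+p. (a p) ^ 4 \<partial>lborel)\<^sup>2 \<le> (\<integral>\<^sup>+p. (a p)\<^sup>2 \<partial>lborel) * (\<integral>\<^sup>+p. (b p)\<^sup>2 \<partial>lborel) ^ 3"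
  proof (rule nn_Ladyzhenskaya[OF ab])
    fix x y z
    \<comment> \<open>A coordinate line parametrized from the given point becomes the line of the
      hypothesis after a translation of the parameter.\<close>
    have shift: "vec3 x y z + t *\<^sub>R axis 1 1 = vec3 (x + t) y z"
      "vec3 x y z + t *\<^sub>R axis 2 1 = vec3 x (y + t) z" "vec3 x y z + t *\<^sub>R axis 3 1 = vec3 x y (z + t)" for t
      by (simp_all add: vec3_def algebra_simps)
    show "(a (vec3 x y z))\<^sup>2 \<le> (\<integral>\<^sup>+t. a (vec3 t y z) * b (vec3 t y z) \<partial>lborel)"
    proof -
      have "(\<lambda>t. a (vec3 t y z) * b (vec3 t y z)) \<in> borel_measurable borel" by measurable
      from lborel_nn_integral_translate[OF this, of x]
      show ?thesis using line[of "vec3 x y z" 1] unfolding shift by simp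
    qed
    show "(a (vec3 x y z))\<^sup>2 \<le> (\<integral>\<^sup>+t. a (vec3 x t z) * b (vec3 x t z) \<partial>lborel)"
    proof -
      have "(\<lambda>t. a (vec3 x t z) * b (vec3 x t z)) \<in> borel_measurable borel" by measurable
      from lborel_nn_integral_translate[OF this, of y]
      show ?thesis using line[of "vec3 x y z" 2] unfolding shift by simp
    qed
    show "(a (vec3 x y z))\<^sup>2 \<le> (\<integral>\<^sup>+t. a (vec3 x y t) * b (vec3 x y t) \<partial>lborel)"
    proof -
      have "(\<lambda>t. a (vec3 x y t) * b (vec3 x y t)) \<in> borel_measurable borel" by measurable
      from lborel_nn_integral_translate[OF this, of z]
      show ?thesis using line[of "vec3 x y z" 3] unfolding shift by simp
    qed
  qed
  have "(\<integral>\<^sup>+p. (b p)\<^sup>2 \<partial>lborel) = (\<integral>\<^sup>+p. 4 * ennreal ((norm (classical_grad s p))\<^sup>2) \<partial>lborel)"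
    unfolding b_def by (intro nn_integral_cong) (simp add: ennreal_power power_mult_distrib ennreal_mult')
  also have "\<dots> = 4 * (\<integral>\<^sup>+p. ennreal ((norm (classical_grad s p))\<^sup>2) \<partial>lborel)"
    by (rule nn_integral_cmult) measurable
  finally have b: "(\<integral>\<^sup>+p. (b p)\<^sup>2 \<partial>lborel) = 4 * (\<integral>\<^sup>+p. ennreal ((norm (classical_grad s p))\<^sup>2) \<partial>lborel)" .
  have "(4::ennreal) ^ 3 = 64" by simp
  then show ?thesis
    using L unfolding b power_mult_distrib by (simp add: a_def ennreal_power mult_ac)
qed

lemma ennreal_power2_le_imp_le:
  assumes "x\<^sup>2 \<le> (ennreal r)\<^sup>2" "0 \<le> r"
  shows "x \<le> ennreal r"
proof (cases x)
  case (real q)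
  then have "q\<^sup>2 \<le> r\<^sup>2" using assms by (simp add: ennreal_power)
  then show ?thesis using real assms(2) by (auto intro!: ennreal_leI power2_le_imp_le)
next
  case top
  then show ?thesis using assms by (simp add: ennreal_power power_eq_top_ennreal top_unique)
qed

context bounded_open begin

text \<open>The square root of the previous inequality: 64 becomes 8, and the sixth power of the
  gradient norm becomes the third.\<close>

lemma Ladyzhenskaya_test:
  assumes s: "s \<in> test_functions \<Omega>"
  shows "(\<integral>\<^sup>+x. ennreal (norm (s x) ^ 4) \<partial>lebesgue_on \<Omega>) \<le> ennreal (8 * l2_norm \<Omega> s * V_norm \<Omega> s ^ 3)"
proof -
  have z: "x \<notin> \<Omega> \<Longrightarrow> s x = 0" "x \<notin> \<Omega> \<Longrightarrow> classical_grad s x = 0" for x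
    using test_functions_zero[OF s] test_functions_zero[OF test_functions_classical_grad[OF s]] by auto
  have 1: "(\<integral>\<^sup>+x. ennreal (norm (s x) ^ 4) \<partial>lebesgue_on \<Omega>) = (\<integral>\<^sup>+x. ennreal (norm (s x) ^ 4) \<partial>lborel)"
    by (rule nn_integral_lebesgue_on_eq_lborel[OF domain_lebesgue]) (simp add: z)
  have 2: "ennreal ((l2_norm \<Omega> s)\<^sup>2) = (\<integral>\<^sup>+x. ennreal ((norm (s x))\<^sup>2) \<partial>lborel)"
    unfolding l2_norm_nn_integral[OF test_functions_L2[OF s]]
    by (rule nn_integral_lebesgue_on_eq_lborel[OF domain_lebesgue]) (simp add: z)
  have 3: "ennreal ((V_norm \<Omega> s)\<^sup>2) = (\<integral>\<^sup>+x. ennreal ((norm (classical_grad s x))\<^sup>2) \<partial>lborel)"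
    unfolding V_norm_test[OF s] l2_norm_nn_integral[OF test_functions_L2[OF test_functions_classical_grad[OF s]]]
    by (rule nn_integral_lebesgue_on_eq_lborel[OF domain_lebesgue]) (simp add: z)
  have "(\<integral>\<^sup>+x. ennreal (norm (s x) ^ 4) \<partial>lebesgue_on \<Omega>)\<^sup>2
      \<le> 64 * ennreal ((l2_norm \<Omega> s)\<^sup>2) * ennreal ((V_norm \<Omega> s)\<^sup>2) ^ 3"
    unfolding 1 2 3 by (rule Ladyzhenskaya_test_nn[OF s])
  also have "64 * ennreal ((l2_norm \<Omega> s)\<^sup>2) * ennreal ((V_norm \<Omega> s)\<^sup>2) ^ 3
      = ennreal (64 * (l2_norm \<Omega> s)\<^sup>2 * ((V_norm \<Omega> s)\<^sup>2) ^ 3)"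
    by (simp add: ennreal_mult' ennreal_power)
  also have "64 * (l2_norm \<Omega> s)\<^sup>2 * ((V_norm \<Omega> s)\<^sup>2) ^ 3 = (8 * l2_norm \<Omega> s * V_norm \<Omega> s ^ 3)\<^sup>2"
    by (simp add: power_mult_distrib flip: power_mult)
  also have "ennreal \<dots> = (ennreal (8 * l2_norm \<Omega> s * V_norm \<Omega> s ^ 3))\<^sup>2"
    by (simp add: ennreal_power l2_norm_nonneg V_norm_nonneg)
  finally show ?thesis by (rule ennreal_power2_le_imp_le) (simp add: l2_norm_nonneg V_norm_nonneg)
qed

text \<open>Convergence in the fourth-power norm is not known beforehand, so the inequality passes
  to the limit by Fatou's lemma, along an almost everywhere convergent subsequence of test
  functions; on the right-hand side both norms converge.\<close>

lemma Ladyzhenskaya: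
  assumes f: "f \<in> H10 \<Omega>"
  shows "(\<integral>\<^sup>+x. ennreal (norm (f x) ^ 4) \<partial>lebesgue_on \<Omega>) \<le> ennreal (8 * l2_norm \<Omega> f * V_norm \<Omega> f ^ 3)"
proof -
  obtain s where s: "\<And>n. s n \<in> test_functions \<Omega>" "(\<lambda>n. l2_norm \<Omega> (\<lambda>x. s n x - f x)) \<longlonglongrightarrow> 0"
    "(\<lambda>n. V_norm \<Omega> (\<lambda>x. s n x - f x)) \<longlonglongrightarrow> 0" using H10_approx[OF f] by blast
  have fH: "f \<in> H1 \<Omega>" "f \<in> L2 \<Omega>" using f by (auto simp: H10_H1 H1_L2)
  have sL: "s n \<in> L2 \<Omega>" for n by (rule test_functions_L2[OF s(1)])
  have [measurable]: "f \<in> borel_measurable (lebesgue_on \<Omega>)" "s n \<in> borel_measurable (lebesgue_on \<Omega>)" for n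
    using fH sL by (auto simp: L2_measurable)
  have "\<exists>r::nat\<Rightarrow>nat. strict_mono r \<and> (AE x in lebesgue_on \<Omega>. (\<lambda>n. (norm (s (r n) x - f x))\<^sup>2) \<longlonglongrightarrow> 0)"
  proof (rule tendsto_L1_AE_subseq)
    show "integrable (lebesgue_on \<Omega>) (\<lambda>x. (norm (s n x - f x))\<^sup>2)" for n
      using L2_diff[OF sL fH(2)] by (simp add: L2_def)
    have "(\<lambda>n. (l2_norm \<Omega> (\<lambda>x. s n x - f x))\<^sup>2) \<longlonglongrightarrow> 0\<^sup>2" by (intro tendsto_power s)
    then show "(\<lambda>n. LINT x|lebesgue_on \<Omega>. norm ((norm (s n x - f x))\<^sup>2)) \<longlonglongrightarrow> 0"
      by (simp add: l2_norm_sq_integral)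
  qed
  then obtain r where r: "strict_mono r" "AE x in lebesgue_on \<Omega>. (\<lambda>n. (norm (s (r n) x - f x))\<^sup>2) \<longlonglongrightarrow> 0"
    by blast
  have "AE x in lebesgue_on \<Omega>. liminf (\<lambda>n. ennreal (norm (s (r n) x) ^ 4)) = ennreal (norm (f x) ^ 4)"
    using r(2)
  proof eventually_elim
    case (elim x)
    then have "(\<lambda>n. norm (s (r n) x - f x)) \<longlonglongrightarrow> 0" using tendsto_real_sqrt by fastforce
    then have "(\<lambda>n. s (r n) x) \<longlonglongrightarrow> f x" by (simp add: LIM_zero_iff tendsto_norm_zero_iff)
    then have "(\<lambda>n. ennreal (norm (s (r n) x) ^ 4)) \<longlonglongrightarrow> ennreal (norm (f x) ^ 4)"
      by (intro tendsto_ennrealI tendsto_power tendsto_norm)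
    then show ?case by (rule lim_imp_Liminf[OF sequentially_bot])
  qed
  then have "(\<integral>\<^sup>+x. ennreal (norm (f x) ^ 4) \<partial>lebesgue_on \<Omega>)
      = (\<integral>\<^sup>+x. liminf (\<lambda>n. ennreal (norm (s (r n) x) ^ 4)) \<partial>lebesgue_on \<Omega>)"
    by (intro nn_integral_cong_AE) (auto elim: eventually_mono)
  also have "\<dots> \<le> liminf (\<lambda>n. \<integral>\<^sup>+x. ennreal (norm (s (r n) x) ^ 4) \<partial>lebesgue_on \<Omega>)"
    by (rule nn_integral_liminf) measurable
  also have "\<dots> \<le> liminf (\<lambda>n. ennreal (8 * l2_norm \<Omega> (s (r n)) * V_norm \<Omega> (s (r n)) ^ 3))"
    by (intro Liminf_mono always_eventually allI Ladyzhenskaya_test s)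
  also have "\<dots> = ennreal (8 * l2_norm \<Omega> f * V_norm \<Omega> f ^ 3)"
  proof (rule lim_imp_Liminf[OF sequentially_bot])
    have 1: "(\<lambda>n. l2_norm \<Omega> (s n)) \<longlonglongrightarrow> l2_norm \<Omega> f"
      using sL fH s(2) by (intro l2_norm_tendsto) auto
    have 2: "(\<lambda>n. V_norm \<Omega> (s n)) \<longlonglongrightarrow> V_norm \<Omega> f"
      unfolding V_norm_def
      using s(3) wgrad_L2[OF test_H1[OF s(1)]] wgrad_L2[OF fH(1)]
      by (intro l2_norm_tendsto) (auto simp: V_norm_diff[OF test_H1[OF s(1)] fH(1)])
    show "(\<lambda>n. ennreal (8 * l2_norm \<Omega> (s (r n)) * V_norm \<Omega> (s (r n)) ^ 3)) \<longlonglongrightarrow> ennreal (8 * l2_norm \<Omega> f * V_norm \<Omega> f ^ 3)"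
      using LIMSEQ_subseq_LIMSEQ[OF 1 r(1)] LIMSEQ_subseq_LIMSEQ[OF 2 r(1)]
      by (intro tendsto_ennrealI tendsto_intros) (auto simp: o_def)
  qed
  finally show ?thesis .
qed

end

section \<open>Completeness\<close>

lemma null_seq_le_inverse:
  fixes a b :: "nat \<Rightarrow> real"
  assumes "b \<longlonglongrightarrow> 0" "\<And>n. 0 \<le> a n" "\<And>n. a n \<le> 1 / real (Suc n) + b n"
  shows "a \<longlonglongrightarrow> 0"
proof -
  have "(\<lambda>n. 1 / real (Suc n) + b n) \<longlonglongrightarrow> 0 + 0"
    using LIMSEQ_inverse_real_of_nat by (intro tendsto_add assms(1)) (simp add: inverse_eq_divide)
  then have lim: "(\<lambda>n. 1 / real (Suc n) + b n) \<longlonglongrightarrow> 0" by simp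
  show ?thesis
  proof (rule tendsto_sandwich[OF _ _ tendsto_const lim])
    show "eventually (\<lambda>n. 0 \<le> a n) sequentially" using assms(2) by simp
    show "eventually (\<lambda>n. a n \<le> 1 / real (Suc n) + b n) sequentially" using assms(3) by simp
  qed
qed

context bounded_open begin

lemma integral_norm_le_l2_norm:
  "f \<in> L2 \<Omega> \<Longrightarrow> (LINT x|lebesgue_on \<Omega>. norm (f x)) \<le> l2_norm \<Omega> f * sqrt (measure lebesgue \<Omega>)"
proof -
  assume f: "f \<in> L2 \<Omega>"
  have 1: "(\<lambda>_. 1::real) \<in> L2 \<Omega>" by (simp add: L2_def)
  have "l2_norm \<Omega> (\<lambda>_. 1::real) = sqrt (measure lebesgue \<Omega>)"
    using domain_lebesgue by (simp add: l2_norm_def l2_inner_def measure_restrict_space)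
  moreover have "l2_norm \<Omega> (\<lambda>x. norm (f x)) = l2_norm \<Omega> f"
    by (simp add: l2_norm_def l2_inner_def dot_square_norm power2_eq_square)
  ultimately show ?thesis
    using l2_Cauchy_Schwarz[OF L2_norm[OF f] 1] by (simp add: l2_inner_def)
qed

lemma l2_norm_le_nn:
  assumes f: "f \<in> borel_measurable (lebesgue_on \<Omega>)" "0 \<le> e"
    "(\<integral>\<^sup>+x. ennreal ((norm (f x))\<^sup>2) \<partial>lebesgue_on \<Omega>) \<le> ennreal (e\<^sup>2)"
  shows "f \<in> L2 \<Omega> \<and> l2_norm \<Omega> f \<le> e"
proof -
  have L: "f \<in> L2 \<Omega>" using f(1) le_less_trans[OF f(3)] by (intro L2_I) auto
  then have "ennreal ((l2_norm \<Omega> f)\<^sup>2) \<le> ennreal (e\<^sup>2)" using f(3) by (simp add: l2_norm_nn_integral)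
  then have "(l2_norm \<Omega> f)\<^sup>2 \<le> e\<^sup>2" by (simp add: ennreal_le_iff)
  then show ?thesis using L f(2) power2_le_imp_le by blast
qed

text \<open>Riesz-Fischer. On a finite measure space an \<open>L2\<close> Cauchy sequence is Cauchy
  in L1, which yields a subsequence converging almost everywhere; Fatou's lemma then bounds the
  distance of each late term to the limit.\<close>

lemma L2_complete:
  fixes F :: "nat \<Rightarrow> point \<Rightarrow> 'b::euclidean_space"
  assumes F: "\<And>n. F n \<in> L2 \<Omega>"
    and C: "\<And>e. e > 0 \<Longrightarrow> \<exists>N. \<forall>m\<ge>N. \<forall>n\<ge>N. l2_norm \<Omega> (\<lambda>x. F m x - F n x) < e"
  shows "\<exists>f\<in>L2 \<Omega>. (\<lambda>n. l2_norm \<Omega> (\<lambda>x. F n x - f x)) \<longlonglongrightarrow> 0"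
proof -
  let ?M = "lebesgue_on \<Omega>"
  have Fm [measurable]: "F n \<in> borel_measurable ?M" for n by (rule L2_measurable[OF F])
  define c where "c = sqrt (measure lebesgue \<Omega>)"
  have c: "c \<ge> 0" by (simp add: c_def)
  have int: "integrable ?M (F n)" for n
    using L2_integrable[OF L2_norm[OF F[of n]]] Fm by (simp add: integrable_norm_iff)
  have L1: "\<exists>N. \<forall>i\<ge>N. \<forall>j\<ge>N. (LINT x|?M. norm (F i x - F j x)) < e" if e: "e > 0" for e
  proof -
    \<comment> \<open>The summand 1 keeps the quotient meaningful when the domain has measure
      zero.\<close>
    have "e / (c + 1) > 0" using e c by simp
    from C[OF this] obtain N where N: "\<And>m n. m \<ge> N \<Longrightarrow> n \<ge> N \<Longrightarrow> l2_norm \<Omega> (\<lambda>x. F m x - F n x) < e / (c + 1)"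
      by blast
    have "(LINT x|?M. norm (F i x - F j x)) < e" if "i \<ge> N" "j \<ge> N" for i j
    proof -
      have "(LINT x|?M. norm (F i x - F j x)) \<le> l2_norm \<Omega> (\<lambda>x. F i x - F j x) * c"
        unfolding c_def by (rule integral_norm_le_l2_norm[OF L2_diff[OF F F]])
      also have "\<dots> \<le> e / (c + 1) * c" using N[OF that] c by (intro mult_right_mono) auto
      also have "\<dots> < e" using e c by (simp add: field_simps)
      finally show ?thesis .
    qed
    then show ?thesis by blast
  qed
  obtain r where r: "strict_mono (r::nat\<Rightarrow>nat)" "AE x in ?M. Cauchy (\<lambda>i. F (r i) x)"
    by (rule cauchy_L1_AE_cauchy_subseq[OF int L1])
  define f where "f x = lim (\<lambda>i. F (r i) x)" for x
  have fm [measurable]: "f \<in> borel_measurable ?M" unfolding f_def[abs_def] by (rule borel_measurable_lim_metric[OF Fm])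
  have lim: "AE x in ?M. (\<lambda>i. F (r i) x) \<longlonglongrightarrow> f x"
    using r(2) by eventually_elim (simp add: f_def Cauchy_convergent_iff convergent_LIMSEQ_iff)
  have key: "(\<lambda>x. F n x - f x) \<in> L2 \<Omega> \<and> l2_norm \<Omega> (\<lambda>x. F n x - f x) \<le> e"
    if N: "\<And>m. m \<ge> N \<Longrightarrow> l2_norm \<Omega> (\<lambda>x. F n x - F m x) < e" and e: "e > 0" for n N e
  proof (rule l2_norm_le_nn)
    have "AE x in ?M. ennreal ((norm (F n x - f x))\<^sup>2) = liminf (\<lambda>i. ennreal ((norm (F n x - F (r i) x))\<^sup>2))"
      using lim
    proof eventually_elim
      case (elim x)
      have "(\<lambda>i. ennreal ((norm (F n x - F (r i) x))\<^sup>2)) \<longlonglongrightarrow> ennreal ((norm (F n x - f x))\<^sup>2)"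
        by (intro tendsto_ennrealI tendsto_intros elim)
      then show ?case by (rule lim_imp_Liminf[OF sequentially_bot, symmetric])
    qed
    then have "(\<integral>\<^sup>+x. ennreal ((norm (F n x - f x))\<^sup>2) \<partial>?M) = (\<integral>\<^sup>+x. liminf (\<lambda>i. ennreal ((norm (F n x - F (r i) x))\<^sup>2)) \<partial>?M)"
      by (rule nn_integral_cong_AE)
    also have "\<dots> \<le> liminf (\<lambda>i. \<integral>\<^sup>+x. ennreal ((norm (F n x - F (r i) x))\<^sup>2) \<partial>?M)"
      by (rule nn_integral_liminf) measurable
    also have "\<dots> \<le> liminf (\<lambda>i. ennreal (e\<^sup>2))"
    proof (rule Liminf_mono)
      show "eventually (\<lambda>i. (\<integral>\<^sup>+x. ennreal ((norm (F n x - F (r i) x))\<^sup>2) \<partial>?M) \<le> ennreal (e\<^sup>2)) sequentially"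
        using eventually_ge_at_top[of N]
      proof eventually_elim
        case (elim i)
        then have "r i \<ge> N" using seq_suble[OF r(1), of i] by simp
        then have "l2_norm \<Omega> (\<lambda>x. F n x - F (r i) x) \<le> e" using N less_imp_le by blast
        then show ?case
          unfolding l2_norm_nn_integral[OF L2_diff[OF F F], symmetric]
          by (intro ennreal_leI power_mono l2_norm_nonneg)
      qed
    qed
    also have "\<dots> = ennreal (e\<^sup>2)" by (simp add: Liminf_const)
    finally show "(\<integral>\<^sup>+x. ennreal ((norm (F n x - f x))\<^sup>2) \<partial>?M) \<le> ennreal (e\<^sup>2)" .
  qed (use e in auto)
  \<comment> \<open>One fixed term at finite distance from the limit suffices for the limit to be
    square integrable.\<close>
  obtain N1 where "\<And>m n. m \<ge> N1 \<Longrightarrow> n \<ge> N1 \<Longrightarrow> l2_norm \<Omega> (\<lambda>x. F m x - F n x) < 1" using C[of 1] by auto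
  then have "(\<lambda>x. F N1 x - f x) \<in> L2 \<Omega>" using key[of N1 N1 1] by auto
  from L2_diff[OF F[of N1] this] have fL: "f \<in> L2 \<Omega>" by simp
  moreover have "(\<lambda>n. l2_norm \<Omega> (\<lambda>x. F n x - f x)) \<longlonglongrightarrow> 0"
  proof (rule LIMSEQ_I)
    fix e :: real assume e: "e > 0"
    then obtain N where N: "\<And>m n. m \<ge> N \<Longrightarrow> n \<ge> N \<Longrightarrow> l2_norm \<Omega> (\<lambda>x. F m x - F n x) < e / 2"
      using C[of "e/2"] by auto
    have "norm (l2_norm \<Omega> (\<lambda>x. F n x - f x) - 0) < e" if "n \<ge> N" for n
      using key[of N n "e/2"] N[OF that] e l2_norm_nonneg[of \<Omega> "\<lambda>x. F n x - f x"] by auto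
    then show "\<exists>no. \<forall>n\<ge>no. norm (l2_norm \<Omega> (\<lambda>x. F n x - f x) - 0) < e" by blast
  qed
  ultimately show ?thesis by blast
qed

lemma l2_norm_nth_le:
  fixes f :: "point \<Rightarrow> 'b::euclidean_space ^ 'n"
  assumes "f \<in> L2 \<Omega>"
  shows "l2_norm \<Omega> (\<lambda>x. f x $ i) \<le> l2_norm \<Omega> f"
proof -
  have "(l2_norm \<Omega> (\<lambda>x. f x $ i))\<^sup>2 \<le> (l2_norm \<Omega> f)\<^sup>2"
    unfolding l2_norm_sq_integral
    using assms L2_nth[OF assms, of i] Finite_Cartesian_Product.norm_nth_le
    by (intro integral_mono) (auto simp: L2_def intro!: power_mono)
  then show ?thesis by (rule power2_le_imp_le) (rule l2_norm_nonneg)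
qed

text \<open>The weak gradient is a closed operator: for each test function, both sides of its
  defining identity are continuous in the \<open>L2\<close> norm.\<close>

lemma has_weak_grad_limit:
  assumes f: "\<And>n. F n \<in> L2 \<Omega>" "f \<in> L2 \<Omega>" "(\<lambda>n. l2_norm \<Omega> (\<lambda>x. F n x - f x)) \<longlonglongrightarrow> 0"
    and G: "\<And>n. G n \<in> L2 \<Omega>" "g \<in> L2 \<Omega>" "(\<lambda>n. l2_norm \<Omega> (\<lambda>x. G n x - g x)) \<longlonglongrightarrow> 0"
    and w: "\<And>n. has_weak_grad \<Omega> (F n) (G n)"
  shows "has_weak_grad \<Omega> f g"
  unfolding has_weak_grad_def
proof (intro ballI allI)
  fix \<phi> :: "point \<Rightarrow> real" and i j assume \<phi>: "\<phi> \<in> test_functions \<Omega>"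
  have c: "(\<lambda>n. LINT x|lebesgue_on \<Omega>. h n x * \<psi> x) \<longlonglongrightarrow> (LINT x|lebesgue_on \<Omega>. k x * \<psi> x)"
    if h: "\<And>n. h n \<in> L2 \<Omega>" "k \<in> L2 \<Omega>" "(\<lambda>n. l2_norm \<Omega> (\<lambda>x. h n x - k x)) \<longlonglongrightarrow> 0"
      and \<psi>: "\<psi> \<in> test_functions \<Omega>" for h k and \<psi> :: "point \<Rightarrow> real"
  proof -
    have "(\<lambda>n. l2_inner \<Omega> (h n) \<psi>) \<longlonglongrightarrow> l2_inner \<Omega> k \<psi>"
      by (rule l2_inner_tendsto[OF _ h(2,3) _ test_functions_L2[OF \<psi>]])
        (simp_all add: h test_functions_L2[OF \<psi>] l2_norm_def l2_inner_def)
    then show ?thesis by (simp add: l2_inner_def)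
  qed
  have c1: "(\<lambda>n. l2_norm \<Omega> (\<lambda>x. F n x $ i - f x $ i)) \<longlonglongrightarrow> 0"
    using l2_norm_nth_le[OF L2_diff[OF f(1) f(2)], of _ i]
    by (intro tendsto_sandwich[OF always_eventually always_eventually tendsto_const f(3)])
      (auto simp: l2_norm_nonneg)
  have "l2_norm \<Omega> (\<lambda>x. G n x $ i $ j - g x $ i $ j) \<le> l2_norm \<Omega> (\<lambda>x. G n x - g x)" for n
    using order_trans[OF l2_norm_nth_le[OF L2_nth[OF L2_diff[OF G(1) G(2)]], of n i j]
        l2_norm_nth_le[OF L2_diff[OF G(1) G(2)], of n i]] by simp
  then have c2: "(\<lambda>n. l2_norm \<Omega> (\<lambda>x. G n x $ i $ j - g x $ i $ j)) \<longlonglongrightarrow> 0"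
    by (intro tendsto_sandwich[OF always_eventually always_eventually tendsto_const G(3)])
      (auto simp: l2_norm_nonneg)
  have "(\<lambda>n. LINT x|lebesgue_on \<Omega>. F n x $ i * partial_deriv j \<phi> x) \<longlonglongrightarrow> (LINT x|lebesgue_on \<Omega>. f x $ i * partial_deriv j \<phi> x)"
    by (rule c[OF L2_nth[OF f(1)] L2_nth[OF f(2)] c1 test_functions_partial_deriv[OF \<phi>]])
  moreover have "(\<lambda>n. - (LINT x|lebesgue_on \<Omega>. G n x $ i $ j * \<phi> x)) \<longlonglongrightarrow> - (LINT x|lebesgue_on \<Omega>. g x $ i $ j * \<phi> x)"
    by (rule tendsto_minus[OF c[OF L2_nth[OF L2_nth[OF G(1)]] L2_nth[OF L2_nth[OF G(2)]] c2 \<phi>]])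
  moreover have "(LINT x|lebesgue_on \<Omega>. F n x $ i * partial_deriv j \<phi> x) = - (LINT x|lebesgue_on \<Omega>. G n x $ i $ j * \<phi> x)" for n
    using bspec[OF w[of n, unfolded has_weak_grad_def] \<phi>, rule_format, of i j] .
  ultimately show "(LINT x|lebesgue_on \<Omega>. f x $ i * partial_deriv j \<phi> x) = - (LINT x|lebesgue_on \<Omega>. g x $ i $ j * \<phi> x)"
    using LIMSEQ_unique by simp
qed

lemma H10_approx_within:
  assumes "f \<in> H10 \<Omega>" "e > 0"
  shows "\<exists>s\<in>test_functions \<Omega>. l2_norm \<Omega> (\<lambda>x. s x - f x) < e \<and> V_norm \<Omega> (\<lambda>x. s x - f x) < e"
proof -
  obtain s where s: "\<And>n. s n \<in> test_functions \<Omega>" "(\<lambda>n. l2_norm \<Omega> (\<lambda>x. s n x - f x)) \<longlonglongrightarrow> 0"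
    "(\<lambda>n. V_norm \<Omega> (\<lambda>x. s n x - f x)) \<longlonglongrightarrow> 0" using H10_approx[OF assms(1)] by blast
  have "eventually (\<lambda>n. l2_norm \<Omega> (\<lambda>x. s n x - f x) < e \<and> V_norm \<Omega> (\<lambda>x. s n x - f x) < e) sequentially"
    using order_tendstoD(2)[OF s(2) assms(2)] order_tendstoD(2)[OF s(3) assms(2)] by eventually_elim simp
  then show ?thesis using s(1) eventually_happens'[OF sequentially_bot] by blast
qed

lemma H_space_approx_within:
  assumes "f \<in> H_space \<Omega>" "e > 0"
  shows "\<exists>s\<in>solenoidal_test_fields \<Omega>. l2_norm \<Omega> (\<lambda>x. s x - f x) < e"
proof -
  obtain s where s: "\<And>n. s n \<in> solenoidal_test_fields \<Omega>" "(\<lambda>n. l2_norm \<Omega> (\<lambda>x. s n x - f x)) \<longlonglongrightarrow> 0"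
    using assms(1) unfolding H_space_def by blast
  show ?thesis using s(1) order_tendstoD(2)[OF s(2) assms(2)] eventually_happens'[OF sequentially_bot] by blast
qed

text \<open>Closedness of the weak gradient identifies the gradient of the limit. For membership in
  \<open>H10\<close> and in \<open>H_space\<close> a new approximation is built diagonally, from
  test fields within 1/(n+1) of \<open>w n\<close>, separately for the two spaces.\<close>

lemma V_complete:
  assumes w: "\<And>n. w n \<in> V_space \<Omega>"
    and C: "\<And>e. e > 0 \<Longrightarrow> \<exists>N. \<forall>m\<ge>N. \<forall>n\<ge>N. l2_norm \<Omega> (\<lambda>x. w m x - w n x) < e"
    and D: "\<And>e. e > 0 \<Longrightarrow> \<exists>N. \<forall>m\<ge>N. \<forall>n\<ge>N. V_norm \<Omega> (\<lambda>x. w m x - w n x) < e"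
  shows "\<exists>v\<in>V_space \<Omega>. (\<lambda>n. l2_norm \<Omega> (\<lambda>x. w n x - v x)) \<longlonglongrightarrow> 0 \<and> (\<lambda>n. V_norm \<Omega> (\<lambda>x. w n x - v x)) \<longlonglongrightarrow> 0"
proof -
  have wH: "w n \<in> H1 \<Omega>" "w n \<in> L2 \<Omega>" for n using w by (auto simp: V_H1 V_L2)
  obtain f where f: "f \<in> L2 \<Omega>" "(\<lambda>n. l2_norm \<Omega> (\<lambda>x. w n x - f x)) \<longlonglongrightarrow> 0"
    using L2_complete[of w, OF wH(2) C] by blast
  have "\<exists>N. \<forall>m\<ge>N. \<forall>n\<ge>N. l2_norm \<Omega> (\<lambda>x. wgrad \<Omega> (w m) x - wgrad \<Omega> (w n) x) < e" if "e > 0" for e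
    using D[OF that] by (simp add: V_norm_diff[OF wH(1) wH(1)])
  from L2_complete[of "\<lambda>n. wgrad \<Omega> (w n)", OF wgrad_L2[OF wH(1)] this]
  obtain G where G: "G \<in> L2 \<Omega>" "(\<lambda>n. l2_norm \<Omega> (\<lambda>x. wgrad \<Omega> (w n) x - G x)) \<longlonglongrightarrow> 0"
    by blast
  have wg: "has_weak_grad \<Omega> f G"
    by (rule has_weak_grad_limit[OF wH(2) f wgrad_L2[OF wH(1)] G wgrad_has_weak_grad[OF wH(1)]])
  have fH: "f \<in> H1 \<Omega>" by (rule H1_I[OF f(1) G(1) wg])
  have "V_norm \<Omega> (\<lambda>x. w n x - f x) = l2_norm \<Omega> (\<lambda>x. wgrad \<Omega> (w n) x - G x)" for n
  proof -
    have "AE x in lebesgue_on \<Omega>. wgrad \<Omega> (w n) x - wgrad \<Omega> f x = wgrad \<Omega> (w n) x - G x"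
      using wgrad_eqI[OF f(1) G(1) wg] by eventually_elim simp
    from l2_norm_cong_AE[OF this L2_diff[OF wgrad_L2[OF wH(1)] wgrad_L2[OF fH]] L2_diff[OF wgrad_L2[OF wH(1)] G(1)]]
    show ?thesis unfolding V_norm_diff[OF wH(1) fH] .
  qed
  then have fV: "(\<lambda>n. V_norm \<Omega> (\<lambda>x. w n x - f x)) \<longlonglongrightarrow> 0" using G(2) by simp
  have "\<forall>n. \<exists>s. s \<in> test_functions \<Omega> \<and> l2_norm \<Omega> (\<lambda>x. s x - w n x) < 1 / real (Suc n)
      \<and> V_norm \<Omega> (\<lambda>x. s x - w n x) < 1 / real (Suc n)"
  proof
    fix n
    have "0 < 1 / real (Suc n)" by simp
    from H10_approx_within[OF V_H10[OF w[of n]] this]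
    show "\<exists>s. s \<in> test_functions \<Omega> \<and> l2_norm \<Omega> (\<lambda>x. s x - w n x) < 1 / real (Suc n)
      \<and> V_norm \<Omega> (\<lambda>x. s x - w n x) < 1 / real (Suc n)" by blast
  qed
  from choice[OF this] obtain s where s: "\<forall>n. s n \<in> test_functions \<Omega> \<and> l2_norm \<Omega> (\<lambda>x. s n x - w n x) < 1 / real (Suc n)
      \<and> V_norm \<Omega> (\<lambda>x. s n x - w n x) < 1 / real (Suc n)" ..
  have sT: "s n \<in> test_functions \<Omega>" for n using s by blast
  have "f \<in> H10 \<Omega>"
  proof (rule H10_I[OF fH sT])
    show "(\<lambda>n. l2_norm \<Omega> (\<lambda>x. s n x - f x)) \<longlonglongrightarrow> 0"
    proof (rule null_seq_le_inverse[OF f(2) l2_norm_nonneg])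
      show "l2_norm \<Omega> (\<lambda>x. s n x - f x) \<le> 1 / real (Suc n) + l2_norm \<Omega> (\<lambda>x. w n x - f x)" for n
        using l2_norm_triangle_diff[OF test_functions_L2[OF sT[of n]] wH(2)[of n] f(1)] spec[OF s, of n] by linarith
    qed
    show "(\<lambda>n. V_norm \<Omega> (\<lambda>x. s n x - f x)) \<longlonglongrightarrow> 0"
    proof (rule null_seq_le_inverse[OF fV V_norm_nonneg])
      show "V_norm \<Omega> (\<lambda>x. s n x - f x) \<le> 1 / real (Suc n) + V_norm \<Omega> (\<lambda>x. w n x - f x)" for n
        using V_norm_triangle[OF H1_diff[OF test_H1[OF sT[of n]] wH(1)[of n]] H1_diff[OF wH(1)[of n] fH]] spec[OF s, of n]
        by simp
    qed
  qed
  moreover have "f \<in> H_space \<Omega>"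
  proof -
    have "\<forall>n. \<exists>s. s \<in> solenoidal_test_fields \<Omega> \<and> l2_norm \<Omega> (\<lambda>x. s x - w n x) < 1 / real (Suc n)"
    proof
      fix n
      have "0 < 1 / real (Suc n)" by simp
      from H_space_approx_within[OF V_H[OF w[of n]] this]
      show "\<exists>s. s \<in> solenoidal_test_fields \<Omega> \<and> l2_norm \<Omega> (\<lambda>x. s x - w n x) < 1 / real (Suc n)" by blast
    qed
    from choice[OF this] obtain q where q: "\<forall>n. q n \<in> solenoidal_test_fields \<Omega> \<and> l2_norm \<Omega> (\<lambda>x. q n x - w n x) < 1 / real (Suc n)" ..
    have qL: "q n \<in> L2 \<Omega>" for n
      using q test_functions_L2 unfolding solenoidal_test_fields_def by blast
    have "(\<lambda>n. l2_norm \<Omega> (\<lambda>x. q n x - f x)) \<longlonglongrightarrow> 0"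
    proof (rule null_seq_le_inverse[OF f(2) l2_norm_nonneg])
      show "l2_norm \<Omega> (\<lambda>x. q n x - f x) \<le> 1 / real (Suc n) + l2_norm \<Omega> (\<lambda>x. w n x - f x)" for n
        using l2_norm_triangle_diff[OF qL[of n] wH(2)[of n] f(1)] spec[OF q, of n] by linarith
    qed
    then show ?thesis using f(1) q unfolding H_space_def by blast
  qed
  ultimately show ?thesis using f(2) fV unfolding V_space_def by blast
qed

end

section \<open>Rellich's compactness theorem\<close>

text \<open>The norm of a matrix is here the Frobenius norm, so Cauchy-Schwarz on each row
  suffices.\<close>

lemma norm_matrix_vector_le: "norm ((A :: real ^ 3 ^ 3) *v u) \<le> norm A * norm u"
proof (rule power2_le_imp_le)
  have "(norm (A *v u))\<^sup>2 = (\<Sum>i\<in>UNIV. (A $ i \<bullet> u)\<^sup>2)"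
    unfolding power2_norm_eq_inner inner_vec_def[of "A *v u"]
    by (simp add: matrix_vector_mult_def inner_vec_def power2_eq_square)
  also have "\<dots> \<le> (\<Sum>i\<in>UNIV. (norm (A $ i))\<^sup>2 * (norm u)\<^sup>2)"
    using Cauchy_Schwarz_ineq by (intro sum_mono) (simp add: power2_norm_eq_inner)
  also have "\<dots> = (norm A * norm u)\<^sup>2"
    unfolding power_mult_distrib sum_distrib_right[symmetric]
    by (simp add: power2_norm_eq_inner inner_vec_def)
  finally show "(norm (A *v u))\<^sup>2 \<le> (norm A * norm u)\<^sup>2" .
qed simp

lemma frechet_derivative_eq_classical_grad:
  assumes "s \<in> test_functions \<Omega>"
  shows "frechet_derivative s (at x) h = classical_grad s x *v h"
proof -
  have L: "linear (frechet_derivative s (at x))"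
    using test_functions_has_derivative[OF assms] by (rule has_derivative_linear)
  have "classical_grad s x = matrix (frechet_derivative s (at x))"
    by (simp add: classical_grad_def partial_deriv_def matrix_def)
  then show ?thesis using L by (simp add: matrix_works)
qed

text \<open>The fundamental theorem of calculus along the segment from x to x + h, Cauchy-Schwarz on
  the unit interval, then Tonelli and translation invariance: each shifted copy of the gradient has
  the same integral.\<close>

lemma translation_estimate:
  fixes s :: field
  assumes s: "s \<in> test_functions \<Omega>"
  shows "(\<integral>\<^sup>+x. ennreal ((norm (s (x + h) - s x))\<^sup>2) \<partial>lborel)
    \<le> ennreal ((norm h)\<^sup>2) * (\<integral>\<^sup>+x. ennreal ((norm (classical_grad s x))\<^sup>2) \<partial>lborel)"
proof -
  let ?g = "classical_grad s"
  have gT: "?g \<in> test_functions \<Omega>" by (rule test_functions_classical_grad[OF s])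
  have [measurable]: "s \<in> borel_measurable borel" "?g \<in> borel_measurable borel"
    using test_functions_borel_measurable[OF s] test_functions_borel_measurable[OF gT] .
  let ?I = "indicator {0..1::real}"
  let ?J = "\<lambda>x t. ?I t * ennreal ((norm (?g (x + t *\<^sub>R h)))\<^sup>2)"
  have pt: "ennreal ((norm (s (x + h) - s x))\<^sup>2)
      \<le> ennreal ((norm h)\<^sup>2) * (\<integral>\<^sup>+t. ?J x t \<partial>lborel)" for x
  proof -
    let ?D = "\<lambda>t. frechet_derivative s (at (x + t *\<^sub>R h)) h"
    have cont: "continuous_on {0..1} ?D"
      by (rule continuous_on_compose2[OF test_functions_continuous[OF test_functions_frechet[OF s], of UNIV]])
        (auto intro!: continuous_intros)
    have "(LINT t|lborel. ?I t *\<^sub>R ?D t) = s (x + 1 *\<^sub>R h) - s (x + 0 *\<^sub>R h)"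
      using test_functions_has_vector_derivative_line[OF s]
      by (intro integral_FTC_atLeastAtMost cont) auto
    then have "ennreal (norm (s (x + h) - s x)) = ennreal (norm (LINT t|lborel. ?I t *\<^sub>R ?D t))" by simp
    also have "\<dots> \<le> (\<integral>\<^sup>+t. ennreal (norm (?I t *\<^sub>R ?D t)) \<partial>lborel)"
      by (rule integral_norm_bound_ennreal[OF borel_integrable_compact[OF compact_Icc cont]])
    \<comment> \<open>The indicator is idempotent; splitting it over both factors keeps both on the
      unit interval after Cauchy-Schwarz.\<close>
    also have "\<dots> \<le> (\<integral>\<^sup>+t. (ennreal (norm h) * ?I t) * (?I t * ennreal (norm (?g (x + t *\<^sub>R h)))) \<partial>lborel)"
    proof (intro nn_integral_mono)
      fix t :: real
      have "norm (?D t) \<le> norm h * norm (?g (x + t *\<^sub>R h))"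
        unfolding frechet_derivative_eq_classical_grad[OF s]
        using norm_matrix_vector_le[of "?g (x + t *\<^sub>R h)" h] by (simp add: mult.commute)
      then show "ennreal (norm (?I t *\<^sub>R ?D t)) \<le> (ennreal (norm h) * ?I t) * (?I t * ennreal (norm (?g (x + t *\<^sub>R h))))"
        by (auto simp: indicator_def ennreal_mult[symmetric] intro: ennreal_leI)
    qed
    finally have "(ennreal (norm (s (x + h) - s x)))\<^sup>2 \<le> (\<integral>\<^sup>+t. (ennreal (norm h) * ?I t) * (?I t * ennreal (norm (?g (x + t *\<^sub>R h)))) \<partial>lborel)\<^sup>2"
      by (intro power_mono) auto
    also have "\<dots> \<le> (\<integral>\<^sup>+t. (ennreal (norm h) * ?I t)\<^sup>2 \<partial>lborel) * (\<integral>\<^sup>+t. (?I t * ennreal (norm (?g (x + t *\<^sub>R h))))\<^sup>2 \<partial>lborel)"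
      by (rule Cauchy_Schwarz_nn_integral) measurable
    also have "(\<integral>\<^sup>+t. (ennreal (norm h) * ?I t)\<^sup>2 \<partial>lborel) = (\<integral>\<^sup>+t. ennreal ((norm h)\<^sup>2) * ?I t \<partial>lborel)"
      by (intro nn_integral_cong) (auto simp: indicator_def ennreal_power)
    also have "\<dots> = ennreal ((norm h)\<^sup>2)" by (simp add: nn_integral_cmult_indicator)
    also have "(\<integral>\<^sup>+t. (?I t * ennreal (norm (?g (x + t *\<^sub>R h))))\<^sup>2 \<partial>lborel) = (\<integral>\<^sup>+t. ?J x t \<partial>lborel)"
      by (intro nn_integral_cong) (auto simp: indicator_def ennreal_power)
    finally show ?thesis by (simp add: ennreal_power)
  qed
  have "(\<integral>\<^sup>+x. ennreal ((norm (s (x + h) - s x))\<^sup>2) \<partial>lborel)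
      \<le> (\<integral>\<^sup>+x. ennreal ((norm h)\<^sup>2) * (\<integral>\<^sup>+t. ?J x t \<partial>lborel) \<partial>lborel)"
    by (intro nn_integral_mono pt)
  also have "\<dots> = ennreal ((norm h)\<^sup>2) * (\<integral>\<^sup>+x. \<integral>\<^sup>+t. ?J x t \<partial>lborel \<partial>lborel)"
    by (rule nn_integral_cmult) measurable
  also have "(\<integral>\<^sup>+x. \<integral>\<^sup>+t. ?J x t \<partial>lborel \<partial>lborel)
      = (\<integral>\<^sup>+t. \<integral>\<^sup>+x. ?J x t \<partial>lborel \<partial>lborel)"
    by (rule lborel_pair.Fubini'[symmetric]) measurable
  also have "\<dots> = (\<integral>\<^sup>+t. ?I t * (\<integral>\<^sup>+x. ennreal ((norm (?g x))\<^sup>2) \<partial>lborel) \<partial>lborel)"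
  proof (intro nn_integral_cong)
    fix t :: real
    have m: "(\<lambda>x. ennreal ((norm (?g x))\<^sup>2)) \<in> borel_measurable borel" by measurable
    have "(\<integral>\<^sup>+x. ?J x t \<partial>lborel) = ?I t * (\<integral>\<^sup>+x. ennreal ((norm (?g (x + t *\<^sub>R h)))\<^sup>2) \<partial>lborel)"
      by (rule nn_integral_cmult) measurable
    also have "(\<integral>\<^sup>+x. ennreal ((norm (?g (x + t *\<^sub>R h)))\<^sup>2) \<partial>lborel) = (\<integral>\<^sup>+x. ennreal ((norm (?g x))\<^sup>2) \<partial>lborel)"
      using lborel_nn_integral_translate[OF m, of "t *\<^sub>R h"] by (simp only: add.commute)
    finally show "(\<integral>\<^sup>+x. ?J x t \<partial>lborel) = ?I t * (\<integral>\<^sup>+x. ennreal ((norm (?g x))\<^sup>2) \<partial>lborel)" .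
  qed
  also have "\<dots> = (\<integral>\<^sup>+x. ennreal ((norm (?g x))\<^sup>2) \<partial>lborel)"
    by (subst nn_integral_multc) auto
  finally show ?thesis .
qed

section \<open>Averages over a grid of cubes\<close>

text \<open>Cells are cut out by floors, hence half open for positive \<epsilon>, so that every
  point lies in exactly one cell, the one with index \<open>grid_index\<close>.\<close>

definition grid_cell :: "real \<Rightarrow> (3 \<Rightarrow> int) \<Rightarrow> point set" where
  "grid_cell \<epsilon> k = {y. \<forall>i. \<lfloor>y $ i / \<epsilon>\<rfloor> = k i}"

definition grid_index :: "real \<Rightarrow> point \<Rightarrow> 3 \<Rightarrow> int" where
  "grid_index \<epsilon> x i = \<lfloor>x $ i / \<epsilon>\<rfloor>"

lemma grid_cell_borel [measurable]: "grid_cell \<epsilon> k \<in> sets borel"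
proof -
  have [measurable]: "(\<lambda>y::point. y $ i) \<in> borel_measurable borel" for i
    by (intro borel_measurable_continuous_onI continuous_on_component continuous_on_id)
  have "{y \<in> space borel. \<forall>i\<in>(UNIV::3 set). of_int (k i) \<le> (y::point) $ i / \<epsilon> \<and> y $ i / \<epsilon> < of_int (k i) + 1} \<in> sets borel"
    by measurable
  then show ?thesis by (simp add: grid_cell_def floor_eq_iff)
qed

text \<open>A cell lies between the open and the closed cube with the same corners, which have equal
  volume.\<close>

lemma emeasure_grid_cell:
  assumes "\<epsilon> > 0"
  shows "emeasure lborel (grid_cell \<epsilon> k) = ennreal (\<epsilon> ^ 3)"
proof -
  define l u :: point where "l = (\<chi> i. \<epsilon> * k i)" and "u = (\<chi> i. \<epsilon> * k i + \<epsilon>)"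
  have c: "y \<in> grid_cell \<epsilon> k \<longleftrightarrow> (\<forall>i. l $ i \<le> y $ i \<and> y $ i < u $ i)" for y
    using assms by (simp add: grid_cell_def l_def u_def floor_eq_iff field_simps)
  have sub: "box l u \<subseteq> grid_cell \<epsilon> k" "grid_cell \<epsilon> k \<subseteq> cbox l u"
    using c by (auto simp: mem_box_cart less_imp_le)
  have le: "l \<bullet> b \<le> u \<bullet> b" if "b \<in> Basis" for b
    using that assms by (auto simp: Basis_vec_def inner_axis l_def u_def)
  have P: "(\<Prod>b\<in>Basis. (u - l) \<bullet> b) = \<epsilon> ^ 3"
    unfolding prod_Basis_vec3 by (simp add: l_def u_def power3_eq_cube)
  have "emeasure lborel (box l u) = ennreal (\<epsilon> ^ 3)" "emeasure lborel (cbox l u) = ennreal (\<epsilon> ^ 3)"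
    using le P by (simp_all add: emeasure_lborel_box_eq emeasure_lborel_cbox_eq)
  then show ?thesis
    using emeasure_mono[OF sub(1), of lborel] emeasure_mono[OF sub(2), of lborel]
    by (auto intro: antisym)
qed

text \<open>The value at x is the mean over its cell plus the mean of s x - s y. The latter is
  controlled by Cauchy-Schwarz over the cell, and y - x ranges in a cube around 0 that is the same
  for all x, which allows the order of integration to be exchanged later. The factor 2 is that of (a
  + b)^2 \<le> 2 a^2 + 2 b^2.\<close>

lemma grid_cell_average_estimate:
  fixes s :: field
  assumes s: "s \<in> test_functions \<Omega>" and e: "\<epsilon> > 0" and d: "\<delta> \<ge> 0"
    and avg: "norm (LINT y|lborel. indicator (grid_cell \<epsilon> (grid_index \<epsilon> x)) y *\<^sub>R s y) \<le> \<delta> * \<epsilon> ^ 3"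
  shows "ennreal ((norm (s x))\<^sup>2) \<le>
     ennreal (2 / \<epsilon> ^ 3) * (\<integral>\<^sup>+h. indicator (cbox (\<chi> i. - \<epsilon>) (\<chi> i. \<epsilon>)) h * ennreal ((norm (s (x + h) - s x))\<^sup>2) \<partial>lborel)
     + ennreal (2 * \<delta>\<^sup>2)"
proof -
  let ?Q = "grid_cell \<epsilon> (grid_index \<epsilon> x)" and ?C = "cbox (\<chi> i. - \<epsilon>) (\<chi> i. \<epsilon>) :: point set"
  let ?I = "\<integral>\<^sup>+h. indicator ?C h * ennreal ((norm (s (x + h) - s x))\<^sup>2) \<partial>lborel"
  have e3: "\<epsilon> ^ 3 > 0" using e by simp
  have [measurable]: "s \<in> borel_measurable borel" by (rule test_functions_borel_measurable[OF s])
  \<comment> \<open>One factor 1/\<epsilon>^3 is consumed by the volume of the cell in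
    Cauchy-Schwarz, which leaves 2/\<epsilon>^3.\<close>
  define K where "K = 2 / (\<epsilon> ^ 3)\<^sup>2"
  have K: "0 \<le> K" by (simp add: K_def)
  have "2 / c\<^sup>2 * c = 2 / c" for c :: real by (simp add: power2_eq_square)
  then have K2: "K * \<epsilon> ^ 3 = 2 / \<epsilon> ^ 3" unfolding K_def .
  define J where "J = (LINT y|lborel. indicator ?Q y *\<^sub>R s y)"
  have fin: "emeasure lborel ?Q < \<infinity>" by (simp add: emeasure_grid_cell[OF e])
  have i1: "integrable lborel (\<lambda>y. indicator ?Q y *\<^sub>R s x)"
    using fin by (intro integrable_scaleR_left integrable_real_indicator) auto
  have i2: "integrable lborel (\<lambda>y. indicator ?Q y *\<^sub>R s y)"
    using test_functions_integrable[OF s] by (intro integrable_mult_indicator) auto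
  have mQ: "measure lborel ?Q = \<epsilon> ^ 3" using e3 by (simp add: measure_def emeasure_grid_cell[OF e])
  have "(LINT y|lborel. indicator ?Q y *\<^sub>R s x) = measure lborel ?Q *\<^sub>R s x"
    using fin by (subst integral_scaleR_left) (auto intro!: integrable_real_indicator)
  then have "(LINT y|lborel. indicator ?Q y *\<^sub>R (s x - s y)) = \<epsilon> ^ 3 *\<^sub>R s x - J"
    unfolding J_def scaleR_diff_right Bochner_Integration.integral_diff[OF i1 i2] by (simp add: mQ)
  then have "ennreal (norm (\<epsilon> ^ 3 *\<^sub>R s x - J)) \<le> (\<integral>\<^sup>+y. ennreal (norm (indicator ?Q y *\<^sub>R (s x - s y))) \<partial>lborel)"
    using integral_norm_bound_ennreal[OF Bochner_Integration.integrable_diff[OF i1 i2]]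
    by (simp add: scaleR_diff_right)
  also have "\<dots> = (\<integral>\<^sup>+y. indicator ?Q y * (indicator ?Q y * ennreal (norm (s y - s x))) \<partial>lborel)"
    by (intro nn_integral_cong) (auto simp: indicator_def norm_minus_commute)
  finally have "(ennreal (norm (\<epsilon> ^ 3 *\<^sub>R s x - J)))\<^sup>2 \<le> \<dots>\<^sup>2" by (intro power_mono) auto
  also have "\<dots> \<le> (\<integral>\<^sup>+y. (indicator ?Q y)\<^sup>2 \<partial>lborel) * (\<integral>\<^sup>+y. (indicator ?Q y * ennreal (norm (s y - s x)))\<^sup>2 \<partial>lborel)"
    by (rule Cauchy_Schwarz_nn_integral) measurable
  also have "(\<integral>\<^sup>+y. (indicator ?Q y)\<^sup>2 \<partial>lborel) = (\<integral>\<^sup>+y. indicator ?Q y \<partial>lborel)"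
    by (intro nn_integral_cong) (auto simp: indicator_def)
  also have "\<dots> = ennreal (\<epsilon> ^ 3)" by (simp add: emeasure_grid_cell[OF e])
  also have "(\<integral>\<^sup>+y. (indicator ?Q y * ennreal (norm (s y - s x)))\<^sup>2 \<partial>lborel)
      \<le> (\<integral>\<^sup>+y. indicator ?C (- x + y) * ennreal ((norm (s (x + (- x + y)) - s x))\<^sup>2) \<partial>lborel)"
  proof (intro nn_integral_mono)
    fix y
    have "- x + y \<in> ?C" if "y \<in> ?Q"
    proof -
      have "\<bar>y $ i - x $ i\<bar> \<le> \<epsilon>" for i
      proof -
        have "\<lfloor>y $ i / \<epsilon>\<rfloor> = \<lfloor>x $ i / \<epsilon>\<rfloor>" using that by (simp add: grid_cell_def grid_index_def)
        \<comment> \<open>Equal floors mean that the scaled coordinates are at most 1 apart.\<close>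
        then have "\<bar>y $ i / \<epsilon> - x $ i / \<epsilon>\<bar> \<le> 1" by linarith
        then show ?thesis using e by (simp add: diff_divide_distrib[symmetric] abs_divide pos_divide_le_eq)
      qed
      then show ?thesis by (simp add: mem_box_cart abs_le_iff) (smt (verit))
    qed
    then show "(indicator ?Q y * ennreal (norm (s y - s x)))\<^sup>2
        \<le> indicator ?C (- x + y) * ennreal ((norm (s (x + (- x + y)) - s x))\<^sup>2)"
      by (cases "y \<in> ?Q") (auto simp: indicator_def ennreal_power)
  qed
  also have "\<dots> = ?I"
    by (rule lborel_nn_integral_translate[where f="\<lambda>h. indicator ?C h * ennreal ((norm (s (x + h) - s x))\<^sup>2)"]) measurable
  finally have A: "ennreal ((norm (\<epsilon> ^ 3 *\<^sub>R s x - J))\<^sup>2)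
      \<le> ennreal (\<epsilon> ^ 3) * ?I"
    by (simp add: ennreal_power mult_left_mono)
  have "norm (\<epsilon> ^ 3 *\<^sub>R s x) \<le> norm (\<epsilon> ^ 3 *\<^sub>R s x - J) + norm J"
    using norm_triangle_ineq[of "\<epsilon> ^ 3 *\<^sub>R s x - J" J] by simp
  then have "norm (\<epsilon> ^ 3 *\<^sub>R s x) \<le> norm (\<epsilon> ^ 3 *\<^sub>R s x - J) + \<delta> * \<epsilon> ^ 3"
    using avg unfolding J_def by linarith
  then have "(norm (\<epsilon> ^ 3 *\<^sub>R s x))\<^sup>2 \<le> (norm (\<epsilon> ^ 3 *\<^sub>R s x - J) + \<delta> * \<epsilon> ^ 3)\<^sup>2"
    by (intro power_mono) auto
  also have "\<dots> \<le> 2 * (norm (\<epsilon> ^ 3 *\<^sub>R s x - J))\<^sup>2 + 2 * (\<delta> * \<epsilon> ^ 3)\<^sup>2"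
    using sum_squares_bound[of "norm (\<epsilon> ^ 3 *\<^sub>R s x - J)" "\<delta> * \<epsilon> ^ 3"] by (simp add: power2_sum)
  finally have "(\<epsilon> ^ 3)\<^sup>2 * (norm (s x))\<^sup>2 \<le> 2 * (norm (\<epsilon> ^ 3 *\<^sub>R s x - J))\<^sup>2 + 2 * (\<delta> * \<epsilon> ^ 3)\<^sup>2"
    using e3 by (simp add: power_mult_distrib)
  then have "(norm (s x))\<^sup>2 \<le> (2 * (norm (\<epsilon> ^ 3 *\<^sub>R s x - J))\<^sup>2 + 2 * (\<delta> * \<epsilon> ^ 3)\<^sup>2) / (\<epsilon> ^ 3)\<^sup>2"
    using e3 by (subst pos_le_divide_eq) (auto simp: mult.commute)
  also have "\<dots> = K * (norm (\<epsilon> ^ 3 *\<^sub>R s x - J))\<^sup>2 + 2 * \<delta>\<^sup>2"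
    using e3 by (simp add: K_def add_divide_distrib power_mult_distrib)
  finally have "ennreal ((norm (s x))\<^sup>2) \<le> ennreal (K * (norm (\<epsilon> ^ 3 *\<^sub>R s x - J))\<^sup>2 + 2 * \<delta>\<^sup>2)"
    by (rule ennreal_leI)
  also have "\<dots> = ennreal K * ennreal ((norm (\<epsilon> ^ 3 *\<^sub>R s x - J))\<^sup>2) + ennreal (2 * \<delta>\<^sup>2)"
    using K by (simp add: ennreal_mult' ennreal_plus)
  also have "\<dots> \<le> ennreal K * (ennreal (\<epsilon> ^ 3) * ?I) + ennreal (2 * \<delta>\<^sup>2)"
    by (intro add_right_mono mult_left_mono A) auto
  also have "ennreal K * (ennreal (\<epsilon> ^ 3) * ?I)
      = ennreal (2 / \<epsilon> ^ 3) * ?I"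
    unfolding K2[symmetric] mult.assoc[symmetric] ennreal_mult'[OF K] by (rule refl)
  finally show ?thesis .
qed

context bounded_open begin

text \<open>The quantitative core of compactness: apart from a small multiple of the gradient, the
  norm is controlled by the averages over the cells that meet \<Omega>. The constant 48 is the
  product of 2 from the pointwise estimate, 3 from |h|^2 \<le> 3 \<epsilon>^2 on the cube of shifts,
  and 8 from its volume 8 \<epsilon>^3.\<close>

lemma l2_norm_le_grid_averages:
  assumes s: "s \<in> test_functions \<Omega>" and e: "\<epsilon> > 0" and d: "\<delta> \<ge> 0"
    and avg: "\<And>k. k \<in> grid_index \<epsilon> ` \<Omega> \<Longrightarrow> norm (LINT y|lborel. indicator (grid_cell \<epsilon> k) y *\<^sub>R s y) \<le> \<delta> * \<epsilon> ^ 3"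
  shows "(l2_norm \<Omega> s)\<^sup>2 \<le> 48 * \<epsilon>\<^sup>2 * (V_norm \<Omega> s)\<^sup>2 + 2 * \<delta>\<^sup>2 * measure lebesgue \<Omega>"
proof -
  let ?C = "cbox (\<chi> i. - \<epsilon>) (\<chi> i. \<epsilon>) :: point set"
  let ?I = "\<lambda>x. \<integral>\<^sup>+h. indicator ?C h * ennreal ((norm (s (x + h) - s x))\<^sup>2) \<partial>lborel"
  have sm [measurable]: "s \<in> borel_measurable borel" by (rule test_functions_borel_measurable[OF s])
  have \<Omega>b: "\<Omega> \<in> sets borel" using open_domain by simp
  have \<Omega>m: "emeasure lborel \<Omega> = ennreal (measure lebesgue \<Omega>)"
  proof -
    have "emeasure lborel \<Omega> \<noteq> \<infinity>"
      using emeasure_bounded_finite[OF bounded_domain] by simp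
    moreover have "measure lebesgue \<Omega> = measure lborel \<Omega>"
      using \<Omega>b by (intro measure_completion) simp
    ultimately show ?thesis by (simp add: emeasure_eq_ennreal_measure)
  qed
  have V: "ennreal ((V_norm \<Omega> s)\<^sup>2) = (\<integral>\<^sup>+x. ennreal ((norm (classical_grad s x))\<^sup>2) \<partial>lborel)"
    unfolding V_norm_test[OF s] l2_norm_nn_integral[OF test_functions_L2[OF test_functions_classical_grad[OF s]]]
    by (rule nn_integral_lebesgue_on_eq_lborel[OF domain_lebesgue])
      (simp add: test_functions_zero[OF test_functions_classical_grad[OF s]])
  have eC: "emeasure lborel ?C = ennreal (8 * \<epsilon> ^ 3)"
  proof -
    have "(\<Prod>b\<in>Basis. ((\<chi> i. \<epsilon>) - (\<chi> i. - \<epsilon>) :: point) \<bullet> b) = 8 * \<epsilon> ^ 3"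
      unfolding prod_Basis_vec3 by (simp add: power3_eq_cube)
    moreover have "(\<chi> i. - \<epsilon>) \<bullet> b \<le> (\<chi> i. \<epsilon>) \<bullet> b" if "b \<in> Basis" for b :: point
      using that e by (auto simp: Basis_vec_def inner_axis)
    ultimately show ?thesis by (simp add: emeasure_lborel_cbox_eq)
  qed
  have nC: "(norm h)\<^sup>2 \<le> 3 * \<epsilon>\<^sup>2" if "h \<in> ?C" for h
  proof -
    have "\<bar>h $ i\<bar> \<le> \<epsilon>" for i using that by (auto simp: mem_box_cart abs_le_iff) (smt (verit))
    then have "(h $ i)\<^sup>2 \<le> \<epsilon>\<^sup>2" for i using power_mono[of "\<bar>h $ i\<bar>" \<epsilon> 2] by simp
    then show ?thesis
      unfolding power2_norm_eq_inner inner_vec_def sum_3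
      by (simp add: power2_eq_square) (smt (verit))
  qed
  have ennreal_collect: "ennreal a * (ennreal b * ennreal c * ennreal d) + ennreal p * ennreal q = ennreal (a * (b * c * d) + p * q)"
    if "0 \<le> a" "0 \<le> b" "0 \<le> c" "0 \<le> d" "0 \<le> p" "0 \<le> q" for a b c d p q
    using that by (simp add: ennreal_mult ennreal_plus)
  define T where "T h = (\<integral>\<^sup>+x. ennreal ((norm (s (x + h) - s x))\<^sup>2) \<partial>lborel)" for h
  have T_le: "T h \<le> ennreal (3 * \<epsilon>\<^sup>2) * ennreal ((V_norm \<Omega> s)\<^sup>2)" if "h \<in> ?C" for h
    unfolding T_def V
    by (rule order_trans[OF translation_estimate[OF s]]) (intro mult_right_mono ennreal_leI nC that, simp)
  have "ennreal ((l2_norm \<Omega> s)\<^sup>2) = (\<integral>\<^sup>+x. ennreal ((norm (s x))\<^sup>2) * indicator \<Omega> x \<partial>lborel)"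
  proof -
    have "ennreal ((l2_norm \<Omega> s)\<^sup>2) = (\<integral>\<^sup>+x. ennreal ((norm (s x))\<^sup>2) \<partial>lborel)"
      unfolding l2_norm_nn_integral[OF test_functions_L2[OF s]]
      by (rule nn_integral_lebesgue_on_eq_lborel[OF domain_lebesgue]) (simp add: test_functions_zero[OF s])
    also have "\<dots> = (\<integral>\<^sup>+x. ennreal ((norm (s x))\<^sup>2) * indicator \<Omega> x \<partial>lborel)"
      by (intro nn_integral_cong) (auto simp: indicator_def test_functions_zero[OF s])
    finally show ?thesis .
  qed
  also have "\<dots> \<le> (\<integral>\<^sup>+x. ennreal (2 / \<epsilon> ^ 3) * ?I x
     + ennreal (2 * \<delta>\<^sup>2) * indicator \<Omega> x \<partial>lborel)"
  proof (intro nn_integral_mono)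
    fix x
    show "ennreal ((norm (s x))\<^sup>2) * indicator \<Omega> x \<le> ennreal (2 / \<epsilon> ^ 3) * ?I x
     + ennreal (2 * \<delta>\<^sup>2) * indicator \<Omega> x"
      using grid_cell_average_estimate[OF s e d avg[of "grid_index \<epsilon> x"]] by (cases "x \<in> \<Omega>") auto
  qed
  also have "\<dots> = (\<integral>\<^sup>+x. ennreal (2 / \<epsilon> ^ 3) * ?I x \<partial>lborel)
     + (\<integral>\<^sup>+x. ennreal (2 * \<delta>\<^sup>2) * indicator \<Omega> x \<partial>lborel)"
    using \<Omega>b by (intro nn_integral_add) auto
  also have "(\<integral>\<^sup>+x. ennreal (2 * \<delta>\<^sup>2) * indicator \<Omega> x \<partial>lborel) = ennreal (2 * \<delta>\<^sup>2) * ennreal (measure lebesgue \<Omega>)"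
    using \<Omega>b by (subst nn_integral_cmult_indicator) (auto simp: \<Omega>m)
  also have "(\<integral>\<^sup>+x. ennreal (2 / \<epsilon> ^ 3) * ?I x \<partial>lborel)
      = ennreal (2 / \<epsilon> ^ 3) * (\<integral>\<^sup>+x. ?I x \<partial>lborel)"
    by (rule nn_integral_cmult) measurable
  also have "(\<integral>\<^sup>+x. ?I x \<partial>lborel)
      = (\<integral>\<^sup>+h. \<integral>\<^sup>+x. indicator ?C h * ennreal ((norm (s (x + h) - s x))\<^sup>2) \<partial>lborel \<partial>lborel)"
    by (rule lborel_pair.Fubini'[symmetric]) measurable
  also have "\<dots> = (\<integral>\<^sup>+h. indicator ?C h * T h \<partial>lborel)"
    unfolding T_def by (intro nn_integral_cong nn_integral_cmult) measurable
  also have "(\<integral>\<^sup>+h. indicator ?C h * T h \<partial>lborel) \<le> (\<integral>\<^sup>+h. ennreal (3 * \<epsilon>\<^sup>2) * ennreal ((V_norm \<Omega> s)\<^sup>2) * indicator ?C h \<partial>lborel)"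
    using T_le by (intro nn_integral_mono) (auto simp: indicator_def)
  also have "\<dots> = ennreal (3 * \<epsilon>\<^sup>2) * ennreal ((V_norm \<Omega> s)\<^sup>2) * ennreal (8 * \<epsilon> ^ 3)"
    by (subst nn_integral_cmult_indicator) (auto simp: eC)
  finally have "ennreal ((l2_norm \<Omega> s)\<^sup>2) \<le> ennreal (2 / \<epsilon> ^ 3) * (ennreal (3 * \<epsilon>\<^sup>2) * ennreal ((V_norm \<Omega> s)\<^sup>2) * ennreal (8 * \<epsilon> ^ 3))
      + ennreal (2 * \<delta>\<^sup>2) * ennreal (measure lebesgue \<Omega>)"
    by (simp add: add_mono mult_left_mono)
  also have "\<dots> = ennreal (2 / \<epsilon> ^ 3 * (3 * \<epsilon>\<^sup>2 * (V_norm \<Omega> s)\<^sup>2 * (8 * \<epsilon> ^ 3)) + 2 * \<delta>\<^sup>2 * measure lebesgue \<Omega>)"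
    by (rule ennreal_collect) (use e in auto)
  finally have "(l2_norm \<Omega> s)\<^sup>2 \<le> 2 / \<epsilon> ^ 3 * (3 * \<epsilon>\<^sup>2 * (V_norm \<Omega> s)\<^sup>2 * (8 * \<epsilon> ^ 3)) + 2 * \<delta>\<^sup>2 * measure lebesgue \<Omega>"
    using e by (subst (asm) ennreal_le_iff) auto
  also have "2 / \<epsilon> ^ 3 * (3 * \<epsilon>\<^sup>2 * (V_norm \<Omega> s)\<^sup>2 * (8 * \<epsilon> ^ 3)) = 48 * \<epsilon>\<^sup>2 * (V_norm \<Omega> s)\<^sup>2"
    using e by simp
  finally show ?thesis .
qed

lemma finite_grid_index:
  assumes "\<epsilon> > 0" shows "finite (grid_index \<epsilon> ` \<Omega>)"
proof -
  obtain B where B: "\<forall>x\<in>\<Omega>. norm x \<le> B" using bounded_domain unfolding bounded_iff by blast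
  have "grid_index \<epsilon> ` \<Omega> \<subseteq> PiE UNIV (\<lambda>_. {\<lfloor>- B / \<epsilon>\<rfloor>..\<lfloor>B / \<epsilon>\<rfloor>})"
  proof (intro subsetI)
    fix k assume "k \<in> grid_index \<epsilon> ` \<Omega>"
    then obtain x where x: "x \<in> \<Omega>" "k = grid_index \<epsilon> x" by blast
    have "\<lfloor>- B / \<epsilon>\<rfloor> \<le> k i \<and> k i \<le> \<lfloor>B / \<epsilon>\<rfloor>" for i
    proof -
      have "\<bar>x $ i\<bar> \<le> B" using component_le_norm_cart[of x i] bspec[OF B x(1)] by linarith
      then have "- B \<le> x $ i" "x $ i \<le> B" by auto
      then have "- B / \<epsilon> \<le> x $ i / \<epsilon>" "x $ i / \<epsilon> \<le> B / \<epsilon>"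
        using assms by (intro divide_right_mono; simp)+
      then show ?thesis unfolding x(2) grid_index_def by (intro conjI floor_mono)
    qed
    then show "k \<in> PiE UNIV (\<lambda>_. {\<lfloor>- B / \<epsilon>\<rfloor>..\<lfloor>B / \<epsilon>\<rfloor>})" by (simp add: PiE_UNIV_domain)
  qed
  then show ?thesis by (rule finite_subset) (intro finite_PiE; simp)
qed

text \<open>A diagonal subsequence makes the averages over all cells of all grids of mesh 1/(m+1)
  converge; these are countably many bounded sequences. For a given tolerance one mesh makes the
  gradient term small, and then only the finitely many cells meeting \<Omega> matter.\<close>

lemma Rellich:
  assumes s: "\<And>n. s n \<in> test_functions \<Omega>" and M: "\<And>n. V_norm \<Omega> (s n) \<le> M" "\<And>n. l2_norm \<Omega> (s n) \<le> M"
  shows "\<exists>r. strict_mono (r :: nat \<Rightarrow> nat) \<and>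
    (\<forall>e>0. \<exists>N. \<forall>m\<ge>N. \<forall>n\<ge>N. l2_norm \<Omega> (\<lambda>x. s (r m) x - s (r n) x) < e)"
proof -
  define c where "c = measure lebesgue \<Omega>"
  have c: "c \<ge> 0" by (simp add: c_def)
  have M0: "M \<ge> 0" using M(2)[of 0] l2_norm_nonneg[of \<Omega> "s 0"] by linarith
  define J where "J n w = (case w of (m, k) \<Rightarrow> LINT y|lborel. indicator (grid_cell (1 / real (Suc m)) k) y *\<^sub>R s n y)"
    for n and w :: "nat \<times> (3 \<Rightarrow> int)"
  have int: "integrable lborel (\<lambda>y. indicator (grid_cell \<epsilon> k) y *\<^sub>R s n y)" for \<epsilon> k n
    using test_functions_integrable[OF s] by (intro integrable_mult_indicator) auto
  have bound: "norm (J n w) \<le> M * sqrt c" for n w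
  proof (cases w)
    case (Pair m k)
    have "norm (J n w) \<le> (LINT y|lborel. norm (indicator (grid_cell (1 / real (Suc m)) k) y *\<^sub>R s n y))"
      unfolding J_def Pair prod.case by (rule integral_norm_bound)
    also have "\<dots> \<le> (LINT y|lborel. norm (s n y))"
      by (rule integral_mono[OF integrable_norm[OF int] integrable_norm[OF test_functions_integrable[OF s]]])
        (auto simp: indicator_def)
    also have "\<dots> = (LINT y|lebesgue_on \<Omega>. norm (s n y))"
      using test_functions_borel_measurable[OF s[of n]]
      by (intro integral_lebesgue_on_eq_lborel(1)[symmetric] domain_lebesgue) (auto simp: test_functions_zero[OF s])
    also have "\<dots> \<le> l2_norm \<Omega> (s n) * sqrt c"
      unfolding c_def by (rule integral_norm_le_l2_norm[OF test_functions_L2[OF s]])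
    also have "\<dots> \<le> M * sqrt c" using c by (intro mult_right_mono M) auto
    finally show ?thesis .
  qed
  obtain r where r: "strict_mono (r :: nat \<Rightarrow> nat)" "\<And>w. w \<in> UNIV \<Longrightarrow> \<exists>l. (\<lambda>n. J (r n) w) \<longlonglongrightarrow> l"
    by (rule function_convergent_subsequence[of UNIV J "M * sqrt c"]) (simp_all add: bound)
  have "\<exists>N. \<forall>m\<ge>N. \<forall>n\<ge>N. l2_norm \<Omega> (\<lambda>x. s (r m) x - s (r n) x) < e" if e: "e > 0" for e
  proof -
    \<comment> \<open>The number 14 is chosen because 14^2 = 196 exceeds 48 * 2^2 = 192, where 2 M
      bounds the gradient norm of a difference. The summand 1 covers M = 0.\<close>
    have "0 < e / (2 * (14 * M + 1))" using e M0 by simp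
    from reals_Archimedean[OF this] obtain m where m: "1 / real (Suc m) < e / (2 * (14 * M + 1))"
      by (auto simp: inverse_eq_divide)
    define \<epsilon> where "\<epsilon> = 1 / real (Suc m)"
    have \<epsilon>: "\<epsilon> > 0" by (simp add: \<epsilon>_def)
    have "\<epsilon> * (14 * M + 1) \<le> e / 2"
      using m M0 unfolding \<epsilon>_def[symmetric] by (simp add: field_simps)
    then have "\<epsilon> * (14 * M) \<le> e / 2" using \<epsilon> by (simp add: algebra_simps)
    then have "(\<epsilon> * (14 * M))\<^sup>2 \<le> (e / 2)\<^sup>2" using \<epsilon> M0 by (intro power_mono) auto
    moreover have "(\<epsilon> * (14 * M))\<^sup>2 = 196 * (\<epsilon>\<^sup>2 * M\<^sup>2)" "48 * \<epsilon>\<^sup>2 * (2 * M)\<^sup>2 = 192 * (\<epsilon>\<^sup>2 * M\<^sup>2)"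
      "(e / 2)\<^sup>2 = e\<^sup>2 / 4" "0 \<le> \<epsilon>\<^sup>2 * M\<^sup>2" by (simp_all add: power_mult_distrib power_divide)
    ultimately have b1: "48 * \<epsilon>\<^sup>2 * (2 * M)\<^sup>2 \<le> e\<^sup>2 / 4" by linarith
    \<comment> \<open>This leaves at most e^2/8 for the averages, after e^2/4 for the gradient
      term.\<close>
    define \<delta> where "\<delta> = e / (4 * (sqrt c + 1))"
    have \<delta>: "\<delta> > 0" using e c by (simp add: \<delta>_def add_nonneg_pos)
    have "e / (4 * q) * q = e / 4" if "q > 0" for q using that by simp
    from this[of "sqrt c + 1"] have "\<delta> * (sqrt c + 1) = e / 4"
      using c unfolding \<delta>_def by (simp add: add_nonneg_pos)
    then have "\<delta> * sqrt c \<le> e / 4" using \<delta> by (simp add: algebra_simps)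
    then have "(\<delta> * sqrt c)\<^sup>2 \<le> (e / 4)\<^sup>2" using \<delta> c by (intro power_mono) auto
    then have b2: "2 * \<delta>\<^sup>2 * c \<le> e\<^sup>2 / 8"
      using c by (simp add: power_mult_distrib power_divide)
    have "eventually (\<lambda>N. \<forall>i\<ge>N. \<forall>j\<ge>N. norm (J (r i) (m, k) - J (r j) (m, k)) \<le> \<delta> * \<epsilon> ^ 3) sequentially" for k
    proof -
      have "Cauchy (\<lambda>n. J (r n) (m, k))"
        using r(2)[of "(m, k)"] LIMSEQ_imp_Cauchy by blast
      moreover have "\<delta> * \<epsilon> ^ 3 > 0" using \<delta> \<epsilon> by simp
      ultimately obtain N where N: "\<And>i j. i \<ge> N \<Longrightarrow> j \<ge> N \<Longrightarrow> norm (J (r i) (m, k) - J (r j) (m, k)) < \<delta> * \<epsilon> ^ 3"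
        unfolding Cauchy_iff by meson
      show ?thesis
        using eventually_ge_at_top[of N]
        by eventually_elim (meson N less_imp_le order_trans)
    qed
    then have "eventually (\<lambda>N. \<forall>k\<in>grid_index \<epsilon> ` \<Omega>. \<forall>i\<ge>N. \<forall>j\<ge>N. norm (J (r i) (m, k) - J (r j) (m, k)) \<le> \<delta> * \<epsilon> ^ 3) sequentially"
      by (intro eventually_ball_finite finite_grid_index \<epsilon> ballI)
    then obtain N where N: "\<And>k i j. k \<in> grid_index \<epsilon> ` \<Omega> \<Longrightarrow> i \<ge> N \<Longrightarrow> j \<ge> N \<Longrightarrow> norm (J (r i) (m, k) - J (r j) (m, k)) \<le> \<delta> * \<epsilon> ^ 3"
      unfolding eventually_sequentially by blast
    have "l2_norm \<Omega> (\<lambda>x. s (r i) x - s (r j) x) < e" if ij: "i \<ge> N" "j \<ge> N" for i j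
    proof -
      let ?d = "\<lambda>x. s (r i) x - s (r j) x"
      have dT: "?d \<in> test_functions \<Omega>" by (rule test_functions_diff[OF s s])
      have V: "V_norm \<Omega> ?d \<le> 2 * M"
        using V_norm_triangle[OF test_H1[OF s[of "r i"]] H1_scaleR[OF test_H1[OF s[of "r j"]], of "-1"]]
          V_norm_scaleR[OF test_H1[OF s[of "r j"]], of "-1"] M(1)[of "r i"] M(1)[of "r j"] by simp
      have "(l2_norm \<Omega> ?d)\<^sup>2 \<le> 48 * \<epsilon>\<^sup>2 * (V_norm \<Omega> ?d)\<^sup>2 + 2 * \<delta>\<^sup>2 * measure lebesgue \<Omega>"
      proof (rule l2_norm_le_grid_averages[OF dT \<epsilon> less_imp_le[OF \<delta>]])
        fix k assume k: "k \<in> grid_index \<epsilon> ` \<Omega>"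
        have "(LINT y|lborel. indicator (grid_cell \<epsilon> k) y *\<^sub>R ?d y) = J (r i) (m, k) - J (r j) (m, k)"
          unfolding J_def prod.case \<epsilon>_def[symmetric] scaleR_diff_right by (rule Bochner_Integration.integral_diff[OF int int])
        then show "norm (LINT y|lborel. indicator (grid_cell \<epsilon> k) y *\<^sub>R ?d y) \<le> \<delta> * \<epsilon> ^ 3"
          using N[OF k ij] by simp
      qed
      also have "\<dots> \<le> 48 * \<epsilon>\<^sup>2 * (2 * M)\<^sup>2 + 2 * \<delta>\<^sup>2 * c"
        unfolding c_def using V V_norm_nonneg by (intro add_right_mono mult_left_mono power_mono) auto
      also have "\<dots> < e\<^sup>2" using b1 b2 e zero_less_power[OF e, of 2] by linarith
      finally show ?thesis using e by (simp add: power2_less_imp_less)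
    qed
    then show ?thesis by blast
  qed
  then show ?thesis using r(1) by blast
qed

section \<open>The first eigenvalue of the Stokes operator\<close>

lemma stokes_eq: "\<phi> \<in> V_space \<Omega> \<Longrightarrow> stokes \<Omega> w \<phi> = grad_inner w \<phi>"
  by (simp add: stokes_def leray_def vector_laplacian_def grad_inner_def)

text \<open>Cauchy-Schwarz against the constant 1, followed by Ladyzhenskaya's inequality. This
  crude form of Poincare's inequality shows that a field in \<open>H10\<close> without gradient
  vanishes, before anything is known about the first eigenvalue.\<close>

lemma l2_norm_le_quartic: "f \<in> H10 \<Omega> \<Longrightarrow> (l2_norm \<Omega> f) ^ 4 \<le> measure lebesgue \<Omega> * (8 * l2_norm \<Omega> f * V_norm \<Omega> f ^ 3)"
proof -
  assume f: "f \<in> H10 \<Omega>"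
  have fL: "f \<in> L2 \<Omega>" using f by (simp add: H10_H1 H1_L2)
  have m [measurable]: "f \<in> borel_measurable (lebesgue_on \<Omega>)" by (rule L2_measurable[OF fL])
  have 1: "(\<integral>\<^sup>+x. 1 \<partial>lebesgue_on \<Omega>) = ennreal (measure lebesgue \<Omega>)"
    using domain_lebesgue emeasure_eq_measure[of \<Omega>] by (simp add: measure_restrict_space)
  have "(ennreal ((l2_norm \<Omega> f)\<^sup>2))\<^sup>2 \<le> (\<integral>\<^sup>+x. (1::ennreal)\<^sup>2 \<partial>lebesgue_on \<Omega>) * (\<integral>\<^sup>+x. (ennreal ((norm (f x))\<^sup>2))\<^sup>2 \<partial>lebesgue_on \<Omega>)"
    unfolding l2_norm_nn_integral[OF fL]
    using Cauchy_Schwarz_nn_integral[of "\<lambda>_. 1" "lebesgue_on \<Omega>" "\<lambda>x. ennreal ((norm (f x))\<^sup>2)"] by simp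
  also have "(\<integral>\<^sup>+x. (1::ennreal)\<^sup>2 \<partial>lebesgue_on \<Omega>) = ennreal (measure lebesgue \<Omega>)" using 1 by simp
  also have "(\<integral>\<^sup>+x. (ennreal ((norm (f x))\<^sup>2))\<^sup>2 \<partial>lebesgue_on \<Omega>) = (\<integral>\<^sup>+x. ennreal (norm (f x) ^ 4) \<partial>lebesgue_on \<Omega>)"
    by (intro nn_integral_cong) (simp add: ennreal_power flip: power_mult)
  also have "ennreal (measure lebesgue \<Omega>) * \<dots> \<le> ennreal (measure lebesgue \<Omega>) * ennreal (8 * l2_norm \<Omega> f * V_norm \<Omega> f ^ 3)"
    by (intro mult_left_mono Ladyzhenskaya[OF f]) auto
  finally have "ennreal ((l2_norm \<Omega> f) ^ 4) \<le> ennreal (measure lebesgue \<Omega> * (8 * l2_norm \<Omega> f * V_norm \<Omega> f ^ 3))"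
    by (simp add: ennreal_power ennreal_mult' flip: power_mult)
  then show ?thesis
    by (subst (asm) ennreal_le_iff) (auto simp: l2_norm_nonneg V_norm_nonneg)
qed

lemma V_norm_eq_0_imp: "f \<in> H10 \<Omega> \<Longrightarrow> V_norm \<Omega> f = 0 \<Longrightarrow> l2_norm \<Omega> f = 0"
  using l2_norm_le_quartic[of f] l2_norm_nonneg[of \<Omega> f] by (cases "l2_norm \<Omega> f = 0") auto

lemma l2_norm_sq_add_scaleR:
  assumes "f \<in> L2 \<Omega>" "g \<in> L2 \<Omega>"
  shows "(l2_norm \<Omega> (\<lambda>x. f x + t *\<^sub>R g x))\<^sup>2 = (l2_norm \<Omega> f)\<^sup>2 + 2 * t * l2_inner \<Omega> f g + t\<^sup>2 * (l2_norm \<Omega> g)\<^sup>2"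
  unfolding l2_norm_sq using assms by (simp add: l2_inner_add_left l2_inner_add_right L2_add L2_scaleR l2_inner_scaleR_left
      l2_inner_scaleR_right l2_inner_commute[of \<Omega> g f] power2_eq_square algebra_simps)

lemma V_norm_sq_add_scaleR:
  assumes "f \<in> H1 \<Omega>" "g \<in> H1 \<Omega>"
  shows "(V_norm \<Omega> (\<lambda>x. f x + t *\<^sub>R g x))\<^sup>2 = (V_norm \<Omega> f)\<^sup>2 + 2 * t * grad_inner f g + t\<^sup>2 * (V_norm \<Omega> g)\<^sup>2"
  unfolding V_norm_sq using assms by (simp add: grad_inner_add_left grad_inner_add_right H1_add H1_scaleR grad_inner_scaleR_left
      grad_inner_scaleR_right grad_inner_commute[of g f] power2_eq_square algebra_simps)

text \<open>
  A minimizing sequence of the Rayleigh quotient has, by Rellich's theorem, an \<open>L\<^sup>2\<close>-convergent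
  subsequence, which the parallelogram law makes converge in \<open>V\<close>.
\<close>

lemma Rayleigh_quotient_minimizer:
  assumes "\<exists>w\<in>V_space \<Omega>. l2_norm \<Omega> w \<noteq> 0"
  shows "\<exists>\<mu>>0. \<exists>w\<in>V_space \<Omega>. l2_norm \<Omega> w = 1 \<and> (V_norm \<Omega> w)\<^sup>2 = \<mu> \<and>
    (\<forall>f\<in>V_space \<Omega>. \<mu> * (l2_norm \<Omega> f)\<^sup>2 \<le> (V_norm \<Omega> f)\<^sup>2)"
proof -
  define S where "S = {(V_norm \<Omega> w)\<^sup>2 | w. w \<in> V_space \<Omega> \<and> l2_norm \<Omega> w = 1}"
  have normalize: "(\<lambda>x. (1 / l2_norm \<Omega> w) *\<^sub>R w x) \<in> V_space \<Omega>" "l2_norm \<Omega> (\<lambda>x. (1 / l2_norm \<Omega> w) *\<^sub>R w x) = 1"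
    "V_norm \<Omega> (\<lambda>x. (1 / l2_norm \<Omega> w) *\<^sub>R w x) = V_norm \<Omega> w / l2_norm \<Omega> w"
    if w: "w \<in> V_space \<Omega>" "l2_norm \<Omega> w \<noteq> 0" for w
    using V_scaleR[OF w(1)] w(2) l2_norm_nonneg[of \<Omega> w]
    by (simp_all add: l2_norm_scaleR V_norm_scaleR[OF V_H1[OF w(1)]])
  have S_ne: "S \<noteq> {}" using assms normalize unfolding S_def by blast
  have S_bdd: "bdd_below S" unfolding S_def by (intro bdd_belowI[of _ 0]) auto
  define \<mu> where "\<mu> = Inf S"
  have \<mu>_le: "\<mu> * (l2_norm \<Omega> f)\<^sup>2 \<le> (V_norm \<Omega> f)\<^sup>2" if f: "f \<in> V_space \<Omega>" for f
  proof (cases "l2_norm \<Omega> f = 0")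
    case False
    have "(V_norm \<Omega> f / l2_norm \<Omega> f)\<^sup>2 \<in> S"
      using normalize[OF f False] unfolding S_def by force
    then have "\<mu> \<le> (V_norm \<Omega> f / l2_norm \<Omega> f)\<^sup>2" unfolding \<mu>_def by (rule cInf_lower[OF _ S_bdd])
    then show ?thesis using False by (simp add: power_divide pos_le_divide_eq)
  qed simp
  have \<mu>0: "\<mu> \<ge> 0" unfolding \<mu>_def using S_ne by (rule cInf_greatest) (auto simp: S_def)
  have "\<forall>n. \<exists>w. w \<in> V_space \<Omega> \<and> l2_norm \<Omega> w = 1 \<and> (V_norm \<Omega> w)\<^sup>2 < \<mu> + 1 / real (Suc n)"
  proof
    fix n
    have "Inf S < \<mu> + 1 / real (Suc n)" by (simp add: \<mu>_def)
    from cInf_lessD[OF S_ne this] show "\<exists>w. w \<in> V_space \<Omega> \<and> l2_norm \<Omega> w = 1 \<and> (V_norm \<Omega> w)\<^sup>2 < \<mu> + 1 / real (Suc n)"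
      unfolding S_def by blast
  qed
  from choice[OF this] obtain w where w': "\<forall>n. w n \<in> V_space \<Omega> \<and> l2_norm \<Omega> (w n) = 1 \<and> (V_norm \<Omega> (w n))\<^sup>2 < \<mu> + 1 / real (Suc n)" ..
  then have w: "w n \<in> V_space \<Omega>" "l2_norm \<Omega> (w n) = 1" "(V_norm \<Omega> (w n))\<^sup>2 < \<mu> + 1 / real (Suc n)" for n by blast+
  have wH: "w n \<in> H1 \<Omega>" "w n \<in> L2 \<Omega>" for n using w(1) by (auto simp: V_H1 V_L2)
  have wb: "V_norm \<Omega> (w n) \<le> \<mu> + 1" for n
  proof -
    have "1 / real (Suc n) \<le> 1" by simp
    then have "(V_norm \<Omega> (w n))\<^sup>2 \<le> \<mu> + 1" using w(3)[of n] by linarith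
    also have "\<dots> \<le> (\<mu> + 1)\<^sup>2" using \<mu>0 by (simp add: power2_eq_square algebra_simps)
    finally have "(V_norm \<Omega> (w n))\<^sup>2 \<le> (\<mu> + 1)\<^sup>2" .
    then show ?thesis by (rule power2_le_imp_le) (use \<mu>0 in simp)
  qed
  \<comment> \<open>Rellich's theorem is available for test functions, so each \<open>w n\<close> is
    replaced by one at distance below 1/(n+1) in both norms.\<close>
  have "\<forall>n. \<exists>s. s \<in> test_functions \<Omega> \<and> l2_norm \<Omega> (\<lambda>x. s x - w n x) < 1 / real (Suc n)
      \<and> V_norm \<Omega> (\<lambda>x. s x - w n x) < 1 / real (Suc n)"
  proof
    fix n
    have "0 < 1 / real (Suc n)" by simp
    from H10_approx_within[OF V_H10[OF w(1)[of n]] this]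
    show "\<exists>s. s \<in> test_functions \<Omega> \<and> l2_norm \<Omega> (\<lambda>x. s x - w n x) < 1 / real (Suc n)
      \<and> V_norm \<Omega> (\<lambda>x. s x - w n x) < 1 / real (Suc n)" by blast
  qed
  from choice[OF this] obtain s where s': "\<forall>n. s n \<in> test_functions \<Omega> \<and> l2_norm \<Omega> (\<lambda>x. s n x - w n x) < 1 / real (Suc n)
      \<and> V_norm \<Omega> (\<lambda>x. s n x - w n x) < 1 / real (Suc n)" ..
  then have s: "s n \<in> test_functions \<Omega>" "l2_norm \<Omega> (\<lambda>x. s n x - w n x) < 1 / real (Suc n)"
    "V_norm \<Omega> (\<lambda>x. s n x - w n x) < 1 / real (Suc n)" for n by blast+
  have sL: "s n \<in> L2 \<Omega>" "s n \<in> H1 \<Omega>" for n using s(1)[of n] by (auto simp: test_functions_L2 test_H1)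
  have one: "1 / real (Suc n) \<le> 1" for n by simp
  have "V_norm \<Omega> (s n) \<le> \<mu> + 2" for n
  proof -
    have "V_norm \<Omega> (s n) \<le> V_norm \<Omega> (\<lambda>x. s n x - w n x) + V_norm \<Omega> (w n)"
      using V_norm_triangle[OF H1_diff[OF sL(2)[of n] wH(1)[of n]] wH(1)[of n]] by simp
    then show ?thesis using s(3)[of n] wb[of n] one[of n] by linarith
  qed
  moreover have "l2_norm \<Omega> (s n) \<le> \<mu> + 2" for n
  proof -
    have "l2_norm \<Omega> (s n) \<le> l2_norm \<Omega> (\<lambda>x. s n x - w n x) + l2_norm \<Omega> (w n)"
      using l2_norm_triangle[OF L2_diff[OF sL(1)[of n] wH(2)[of n]] wH(2)[of n]] by simp
    then show ?thesis using s(2)[of n] w(2)[of n] one[of n] \<mu>0 by linarith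
  qed
  ultimately obtain r where r: "strict_mono (r :: nat \<Rightarrow> nat)"
    "\<And>e. e > 0 \<Longrightarrow> \<exists>N. \<forall>m\<ge>N. \<forall>n\<ge>N. l2_norm \<Omega> (\<lambda>x. s (r m) x - s (r n) x) < e"
    using Rellich[of s "\<mu> + 2"] s(1) by blast
  have inv_le: "1 / real (Suc (r n)) \<le> 1 / real (Suc N)" if "n \<ge> N" for n N
    using seq_suble[OF r(1), of n] that by (intro divide_left_mono) auto
  have C: "\<exists>N. \<forall>m\<ge>N. \<forall>n\<ge>N. l2_norm \<Omega> (\<lambda>x. w (r m) x - w (r n) x) < e" if e: "e > 0" for e
  proof -
    obtain N1 where N1: "\<And>m n. m \<ge> N1 \<Longrightarrow> n \<ge> N1 \<Longrightarrow> l2_norm \<Omega> (\<lambda>x. s (r m) x - s (r n) x) < e / 3"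
      using r(2)[of "e / 3"] e by auto
    obtain N2 where N2: "1 / real (Suc N2) < e / 3"
      using reals_Archimedean[of "e / 3"] e by (auto simp: inverse_eq_divide)
    have "l2_norm \<Omega> (\<lambda>x. w (r m) x - w (r n) x) < e" if mn: "m \<ge> max N1 N2" "n \<ge> max N1 N2" for m n
    proof -
      have "l2_norm \<Omega> (\<lambda>x. w (r m) x - w (r n) x)
        \<le> l2_norm \<Omega> (\<lambda>x. w (r m) x - s (r m) x) + l2_norm \<Omega> (\<lambda>x. s (r m) x - w (r n) x)"
        by (rule l2_norm_triangle_diff[OF wH(2) sL(1) wH(2)])
      also have "l2_norm \<Omega> (\<lambda>x. s (r m) x - w (r n) x)
        \<le> l2_norm \<Omega> (\<lambda>x. s (r m) x - s (r n) x) + l2_norm \<Omega> (\<lambda>x. s (r n) x - w (r n) x)"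
        by (rule l2_norm_triangle_diff[OF sL(1) sL(1) wH(2)])
      finally show ?thesis
        using N1[of m n] N2 mn inv_le[of N2 m] inv_le[of N2 n] s(2)[of "r m"] s(2)[of "r n"]
          l2_norm_minus_commute[of \<Omega> "w (r m)" "s (r m)"] by simp
    qed
    then show ?thesis by blast
  qed
  \<comment> \<open>The parallelogram law, with the sum f + g bounded from below by \<mu>. For two
    almost minimizers of norm 1 the first terms nearly cancel, so the \<open>L2\<close> distance
    controls the gradient distance.\<close>
  have para: "(V_norm \<Omega> (\<lambda>x. f x - g x))\<^sup>2 \<le> 2 * (V_norm \<Omega> f)\<^sup>2 + 2 * (V_norm \<Omega> g)\<^sup>2
      - 2 * \<mu> * ((l2_norm \<Omega> f)\<^sup>2 + (l2_norm \<Omega> g)\<^sup>2) + \<mu> * (l2_norm \<Omega> (\<lambda>x. f x - g x))\<^sup>2"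
    if f: "f \<in> V_space \<Omega>" and g: "g \<in> V_space \<Omega>" for f g
  proof -
    have e1: "\<mu> * (l2_norm \<Omega> (\<lambda>x. f x + 1 *\<^sub>R g x))\<^sup>2 \<le> (V_norm \<Omega> (\<lambda>x. f x + 1 *\<^sub>R g x))\<^sup>2"
      using \<mu>_le[OF V_add[OF f g]] by simp
    have e2: "(V_norm \<Omega> (\<lambda>x. f x - g x))\<^sup>2 = (V_norm \<Omega> f)\<^sup>2 - 2 * grad_inner f g + (V_norm \<Omega> g)\<^sup>2"
      using V_norm_sq_add_scaleR[OF V_H1[OF f] V_H1[OF g], of "-1"] by simp
    have e3: "(l2_norm \<Omega> (\<lambda>x. f x - g x))\<^sup>2 = (l2_norm \<Omega> f)\<^sup>2 - 2 * l2_inner \<Omega> f g + (l2_norm \<Omega> g)\<^sup>2"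
      using l2_norm_sq_add_scaleR[OF V_L2[OF f] V_L2[OF g], of "-1"] by simp
    show ?thesis
      using e1 unfolding e2 e3 V_norm_sq_add_scaleR[OF V_H1[OF f] V_H1[OF g]] l2_norm_sq_add_scaleR[OF V_L2[OF f] V_L2[OF g]]
      by (simp add: algebra_simps)
  qed
  have D: "\<exists>N. \<forall>m\<ge>N. \<forall>n\<ge>N. V_norm \<Omega> (\<lambda>x. w (r m) x - w (r n) x) < e" if e: "e > 0" for e
  proof -
    have "e / (2 * (\<mu> + 1)) > 0" using e \<mu>0 by simp
    from C[OF this] obtain N1 where N1: "\<And>m n. m \<ge> N1 \<Longrightarrow> n \<ge> N1 \<Longrightarrow> l2_norm \<Omega> (\<lambda>x. w (r m) x - w (r n) x) < e / (2 * (\<mu> + 1))"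
      by blast
    have "e\<^sup>2 / 8 > 0" using e by simp
    \<comment> \<open>Both excesses over \<mu> are below e^2/8 and enter with the factor 2, which
      gives e^2/2; the \<open>L2\<close> term adds at most e^2/4.\<close>
    from reals_Archimedean[OF this] obtain N2 where N2: "1 / real (Suc N2) < e\<^sup>2 / 8"
      by (auto simp: inverse_eq_divide)
    have "V_norm \<Omega> (\<lambda>x. w (r m) x - w (r n) x) < e" if mn: "m \<ge> max N1 N2" "n \<ge> max N1 N2" for m n
    proof -
      let ?l = "l2_norm \<Omega> (\<lambda>x. w (r m) x - w (r n) x)"
      have "(V_norm \<Omega> (\<lambda>x. w (r m) x - w (r n) x))\<^sup>2 \<le> 2 * (V_norm \<Omega> (w (r m)))\<^sup>2 + 2 * (V_norm \<Omega> (w (r n)))\<^sup>2 - 4 * \<mu> + \<mu> * ?l\<^sup>2"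
        using para[OF w(1)[of "r m"] w(1)[of "r n"]] by (simp add: w(2))
      moreover have "(V_norm \<Omega> (w (r m)))\<^sup>2 < \<mu> + e\<^sup>2 / 8" "(V_norm \<Omega> (w (r n)))\<^sup>2 < \<mu> + e\<^sup>2 / 8"
        using w(3)[of "r m"] w(3)[of "r n"] inv_le[of N2 m] inv_le[of N2 n] mn N2 by auto
      moreover have "\<mu> * ?l\<^sup>2 \<le> e\<^sup>2 / 4"
      proof -
        have "(\<mu> + 1) * ?l \<le> e / 2"
          using N1[of m n] mn \<mu>0 by (simp add: field_simps)
        then have "((\<mu> + 1) * ?l)\<^sup>2 \<le> (e / 2)\<^sup>2"
          using \<mu>0 by (intro power_mono mult_nonneg_nonneg) (auto simp: l2_norm_nonneg)
        then have "(\<mu> + 1)\<^sup>2 * ?l\<^sup>2 \<le> e\<^sup>2 / 4" by (simp add: power_mult_distrib power_divide)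
        moreover have "\<mu> * ?l\<^sup>2 \<le> (\<mu> + 1)\<^sup>2 * ?l\<^sup>2"
          using \<mu>0 by (intro mult_right_mono) (auto simp: power2_eq_square algebra_simps)
        ultimately show ?thesis by linarith
      qed
      ultimately have "(V_norm \<Omega> (\<lambda>x. w (r m) x - w (r n) x))\<^sup>2 < e\<^sup>2" using zero_less_power[OF e, of 2] by linarith
      then show ?thesis using e by (simp add: power2_less_imp_less)
    qed
    then show ?thesis by blast
  qed
  obtain v where v: "v \<in> V_space \<Omega>" "(\<lambda>n. l2_norm \<Omega> (\<lambda>x. w (r n) x - v x)) \<longlonglongrightarrow> 0" "(\<lambda>n. V_norm \<Omega> (\<lambda>x. w (r n) x - v x)) \<longlonglongrightarrow> 0"
    using V_complete[of "\<lambda>n. w (r n)", OF w(1) C D] by blast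
  have "(\<lambda>n. l2_norm \<Omega> (w (r n))) \<longlonglongrightarrow> l2_norm \<Omega> v"
    by (rule l2_norm_tendsto[OF always_eventually V_L2[OF v(1)] v(2)]) (simp add: wH)
  then have v1: "l2_norm \<Omega> v = 1" by (simp add: w(2) LIMSEQ_const_iff)
  have "(\<lambda>n. l2_norm \<Omega> (wgrad \<Omega> (w (r n)))) \<longlonglongrightarrow> l2_norm \<Omega> (wgrad \<Omega> v)"
    using v(3) wgrad_L2[OF wH(1)] wgrad_L2[OF V_H1[OF v(1)]]
    by (intro l2_norm_tendsto) (simp_all add: V_norm_diff[OF wH(1) V_H1[OF v(1)]])
  then have "(\<lambda>n. (V_norm \<Omega> (w (r n)))\<^sup>2) \<longlonglongrightarrow> (V_norm \<Omega> v)\<^sup>2"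
    unfolding V_norm_def by (rule tendsto_power)
  moreover have "(\<lambda>n. \<mu> + 1 / real (Suc n)) \<longlonglongrightarrow> \<mu> + 0"
    using LIMSEQ_inverse_real_of_nat by (intro tendsto_intros) (simp add: inverse_eq_divide)
  moreover have "(V_norm \<Omega> (w (r n)))\<^sup>2 \<le> \<mu> + 1 / real (Suc n)" for n
    using w(3)[of "r n"] inv_le[of n n] by linarith
  ultimately have "(V_norm \<Omega> v)\<^sup>2 \<le> \<mu> + 0" by (intro LIMSEQ_le[where X="\<lambda>n. (V_norm \<Omega> (w (r n)))\<^sup>2"]) auto
  then have v2: "(V_norm \<Omega> v)\<^sup>2 = \<mu>" using \<mu>_le[OF v(1)] v1 by simp
  \<comment> \<open>Otherwise the minimizer would have no gradient and hence norm 0.\<close>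
  have "\<mu> \<noteq> 0" using V_norm_eq_0_imp[OF V_H10[OF v(1)]] v1 v2 by auto
  then show ?thesis using \<mu>0 \<mu>_le v(1) v1 v2 by (intro exI[of _ \<mu>]) auto
qed

text \<open>A minimizer of the Rayleigh quotient is an eigenfunction by first variation, and every
  eigenvalue is the Rayleigh quotient of its eigenfunction, so the infimum of the eigenvalues is
  attained at \<mu>. The assumption excludes a trivial space, where there is no eigenvalue and
  \<open>Inf\<close> carries no information.\<close>

lemma stokes_lambda1_Rayleigh:
  assumes "\<exists>w\<in>V_space \<Omega>. l2_norm \<Omega> w \<noteq> 0"
  shows "stokes_lambda1 \<Omega> > 0" and "f \<in> V_space \<Omega> \<Longrightarrow> stokes_lambda1 \<Omega> * (l2_norm \<Omega> f)\<^sup>2 \<le> (V_norm \<Omega> f)\<^sup>2"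
proof -
  obtain \<mu> w where \<mu>: "\<mu> > 0" "w \<in> V_space \<Omega>" "l2_norm \<Omega> w = 1" "(V_norm \<Omega> w)\<^sup>2 = \<mu>"
    "\<And>f. f \<in> V_space \<Omega> \<Longrightarrow> \<mu> * (l2_norm \<Omega> f)\<^sup>2 \<le> (V_norm \<Omega> f)\<^sup>2"
    using Rayleigh_quotient_minimizer[OF assms] by blast
  have "grad_inner w \<phi> = \<mu> * l2_inner \<Omega> w \<phi>" if \<phi>: "\<phi> \<in> V_space \<Omega>" for \<phi>
  proof -
    \<comment> \<open>The Rayleigh inequality for w + t \<phi> is an equality at t = 0, and a
      nonnegative quadratic without constant term has no linear term.\<close>
    have "0 \<le> ((V_norm \<Omega> \<phi>)\<^sup>2 - \<mu> * (l2_norm \<Omega> \<phi>)\<^sup>2) * t\<^sup>2 + 2 * (grad_inner w \<phi> - \<mu> * l2_inner \<Omega> w \<phi>) * t + 0" for t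
      using \<mu>(5)[OF V_add[OF \<mu>(2) V_scaleR[OF \<phi>, of t]]]
      unfolding V_norm_sq_add_scaleR[OF V_H1[OF \<mu>(2)] V_H1[OF \<phi>]] l2_norm_sq_add_scaleR[OF V_L2[OF \<mu>(2)] V_L2[OF \<phi>]]
      by (simp add: \<mu>(3,4) algebra_simps)
    from quadratic_nonneg_discriminant[OF this] show ?thesis by simp
  qed
  then have ev: "stokes_eigenvalue \<Omega> \<mu>"
    unfolding stokes_eigenvalue_def using \<mu>(2,3)
    by (intro bexI[of _ w]) (auto simp: stokes_eq l2_functional_def l2_inner_scaleR_left)
  have le: "\<mu> \<le> \<kappa>" if ev': "stokes_eigenvalue \<Omega> \<kappa>" for \<kappa>
  proof -
    obtain f where f: "f \<in> V_space \<Omega>" "l2_norm \<Omega> f \<noteq> 0" "\<And>\<phi>. \<phi> \<in> V_space \<Omega> \<Longrightarrow> stokes \<Omega> f \<phi> = l2_functional \<Omega> (\<lambda>x. \<kappa> *\<^sub>R f x) \<phi>"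
      using ev' unfolding stokes_eigenvalue_def by blast
    have "(V_norm \<Omega> f)\<^sup>2 = \<kappa> * (l2_norm \<Omega> f)\<^sup>2"
      using f(3)[OF f(1)] by (simp add: stokes_eq[OF f(1)] l2_functional_def l2_inner_scaleR_left V_norm_sq l2_norm_sq)
    then show ?thesis using \<mu>(5)[OF f(1)] f(2) by simp
  qed
  have "stokes_lambda1 \<Omega> = \<mu>"
    unfolding stokes_lambda1_def using ev le by (intro cInf_eq_minimum) auto
  then show "stokes_lambda1 \<Omega> > 0" "f \<in> V_space \<Omega> \<Longrightarrow> stokes_lambda1 \<Omega> * (l2_norm \<Omega> f)\<^sup>2 \<le> (V_norm \<Omega> f)\<^sup>2"
    using \<mu> by auto
qed

end

section \<open>The trilinear form\<close>

context bounded_open begin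

text \<open>The root of the right-hand side of Ladyzhenskaya's inequality; it bounds the square of
  the fourth-power norm, not the norm itself.\<close>

definition L4_bound :: "field \<Rightarrow> real" where
  "L4_bound f = sqrt (8 * l2_norm \<Omega> f * V_norm \<Omega> f ^ 3)"

lemma L4_bound_nonneg: "0 \<le> L4_bound f"
  by (simp add: L4_bound_def l2_norm_nonneg V_norm_nonneg)

lemma norm_sq_L2:
  assumes f: "f \<in> H10 \<Omega>"
  shows "(\<lambda>x. (norm (f x))\<^sup>2) \<in> L2 \<Omega>" and "l2_norm \<Omega> (\<lambda>x. (norm (f x))\<^sup>2) \<le> L4_bound f"
proof -
  have [measurable]: "f \<in> borel_measurable (lebesgue_on \<Omega>)"
    using f by (simp add: L2_measurable H10_H1 H1_L2)
  have "(\<integral>\<^sup>+x. ennreal ((norm ((norm (f x))\<^sup>2))\<^sup>2) \<partial>lebesgue_on \<Omega>) = (\<integral>\<^sup>+x. ennreal (norm (f x) ^ 4) \<partial>lebesgue_on \<Omega>)"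
    by (intro nn_integral_cong) (simp flip: power_mult)
  also have "\<dots> \<le> ennreal ((L4_bound f)\<^sup>2)"
    using Ladyzhenskaya[OF f] by (simp add: L4_bound_def l2_norm_nonneg V_norm_nonneg)
  finally have *: "(\<integral>\<^sup>+x. ennreal ((norm ((norm (f x))\<^sup>2))\<^sup>2) \<partial>lebesgue_on \<Omega>) \<le> ennreal ((L4_bound f)\<^sup>2)" .
  have m: "(\<lambda>x. (norm (f x))\<^sup>2) \<in> borel_measurable (lebesgue_on \<Omega>)" by measurable
  from l2_norm_le_nn[OF m L4_bound_nonneg *]
  show "(\<lambda>x. (norm (f x))\<^sup>2) \<in> L2 \<Omega>" "l2_norm \<Omega> (\<lambda>x. (norm (f x))\<^sup>2) \<le> L4_bound f" by auto
qed

lemma norm_mult_L2: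
  assumes f: "f \<in> H10 \<Omega>" and g: "g \<in> H10 \<Omega>"
  shows "(\<lambda>x. norm (f x) * norm (g x)) \<in> L2 \<Omega>"
    and "l2_norm \<Omega> (\<lambda>x. norm (f x) * norm (g x)) \<le> sqrt (L4_bound f * L4_bound g)"
proof -
  have [measurable]: "f \<in> borel_measurable (lebesgue_on \<Omega>)" "g \<in> borel_measurable (lebesgue_on \<Omega>)"
    using f g by (simp_all add: L2_measurable H10_H1 H1_L2)
  show L: "(\<lambda>x. norm (f x) * norm (g x)) \<in> L2 \<Omega>"
    using L2_integrable_mult[OF norm_sq_L2(1)[OF f] norm_sq_L2(1)[OF g]]
    by (simp add: L2_def power_mult_distrib)
  have "(l2_norm \<Omega> (\<lambda>x. norm (f x) * norm (g x)))\<^sup>2 = l2_inner \<Omega> (\<lambda>x. (norm (f x))\<^sup>2) (\<lambda>x. (norm (g x))\<^sup>2)"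
    unfolding l2_norm_sq_integral l2_inner_def by (simp add: power_mult_distrib)
  also have "\<dots> \<le> l2_norm \<Omega> (\<lambda>x. (norm (f x))\<^sup>2) * l2_norm \<Omega> (\<lambda>x. (norm (g x))\<^sup>2)"
    using l2_Cauchy_Schwarz[OF norm_sq_L2(1)[OF f] norm_sq_L2(1)[OF g]] by simp
  also have "\<dots> \<le> L4_bound f * L4_bound g"
    by (intro mult_mono norm_sq_L2 f g L4_bound_nonneg l2_norm_nonneg)
  finally show "l2_norm \<Omega> (\<lambda>x. norm (f x) * norm (g x)) \<le> sqrt (L4_bound f * L4_bound g)"
    by (rule real_le_rsqrt)
qed

text \<open>Hoelder's inequality with exponents 2, 4, 4. The matrix field \<open>G\<close> is
  general because weak and classical gradients are both inserted.\<close>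

lemma trilinear:
  assumes G: "G \<in> L2 \<Omega>" and u: "u \<in> H10 \<Omega>" and \<phi>: "\<phi> \<in> H10 \<Omega>"
  shows trilinear_integrable: "integrable (lebesgue_on \<Omega>) (\<lambda>x. (G x *v u x) \<bullet> \<phi> x)"
    and trilinear_bound: "\<bar>LINT x|lebesgue_on \<Omega>. (G x *v u x) \<bullet> \<phi> x\<bar> \<le> l2_norm \<Omega> G * sqrt (L4_bound u * L4_bound \<phi>)"
proof -
  let ?p = "\<lambda>x. norm (u x) * norm (\<phi> x)"
  have uL: "u \<in> L2 \<Omega>" "\<phi> \<in> L2 \<Omega>" using u \<phi> by (simp_all add: H10_H1 H1_L2)
  have [measurable]: "(\<lambda>x. G x $ i $ j) \<in> borel_measurable (lebesgue_on \<Omega>)" "(\<lambda>x. u x $ i) \<in> borel_measurable (lebesgue_on \<Omega>)"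
    "(\<lambda>x. \<phi> x $ i) \<in> borel_measurable (lebesgue_on \<Omega>)" for i j
    using L2_measurable[OF L2_nth[OF L2_nth[OF G]]] L2_measurable[OF L2_nth[OF uL(1)]] L2_measurable[OF L2_nth[OF uL(2)]] by auto
  have m: "(\<lambda>x. (G x *v u x) \<bullet> \<phi> x) \<in> borel_measurable (lebesgue_on \<Omega>)"
    unfolding inner_vec_def matrix_vector_mult_def by simp
  have I: "integrable (lebesgue_on \<Omega>) (\<lambda>x. norm (G x) * ?p x)"
    by (rule L2_integrable_mult[OF L2_norm[OF G] norm_mult_L2(1)[OF u \<phi>]])
  have le: "\<bar>(G x *v u x) \<bullet> \<phi> x\<bar> \<le> norm (G x) * ?p x" for x
  proof -
    have "\<bar>(G x *v u x) \<bullet> \<phi> x\<bar> \<le> norm (G x *v u x) * norm (\<phi> x)" by (rule Cauchy_Schwarz_ineq2)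
    also have "\<dots> \<le> norm (G x) * norm (u x) * norm (\<phi> x)"
      by (intro mult_right_mono norm_matrix_vector_le) auto
    finally show ?thesis by (simp add: mult.assoc)
  qed
  show int: "integrable (lebesgue_on \<Omega>) (\<lambda>x. (G x *v u x) \<bullet> \<phi> x)"
    by (rule Bochner_Integration.integrable_bound[OF I m]) (use le in \<open>auto intro!: AE_I2 order_trans[OF le]\<close>)
  have "\<bar>LINT x|lebesgue_on \<Omega>. (G x *v u x) \<bullet> \<phi> x\<bar> \<le> (LINT x|lebesgue_on \<Omega>. \<bar>(G x *v u x) \<bullet> \<phi> x\<bar>)"
    by (rule integral_abs_bound)
  also have "\<dots> \<le> (LINT x|lebesgue_on \<Omega>. norm (G x) * ?p x)"
    by (rule integral_mono[OF integrable_abs[OF int] I le])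
  also have "\<dots> = l2_inner \<Omega> (\<lambda>x. norm (G x)) ?p" by (simp add: l2_inner_def)
  also have "\<dots> \<le> l2_norm \<Omega> (\<lambda>x. norm (G x)) * l2_norm \<Omega> ?p"
    using l2_Cauchy_Schwarz[OF L2_norm[OF G] norm_mult_L2(1)[OF u \<phi>]] by simp
  also have "l2_norm \<Omega> (\<lambda>x. norm (G x)) = l2_norm \<Omega> G"
    by (simp add: l2_norm_def l2_inner_def dot_square_norm power2_eq_square)
  also have "l2_norm \<Omega> G * l2_norm \<Omega> ?p \<le> l2_norm \<Omega> G * sqrt (L4_bound u * L4_bound \<phi>)"
    by (intro mult_left_mono norm_mult_L2 u \<phi> l2_norm_nonneg)
  finally show "\<bar>LINT x|lebesgue_on \<Omega>. (G x *v u x) \<bullet> \<phi> x\<bar> \<le> l2_norm \<Omega> G * sqrt (L4_bound u * L4_bound \<phi>)" .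
qed

text \<open>The form b(u, v, \<phi>) of Navier-Stokes theory: \<open>u\<close> transports and
  \<open>v\<close> is differentiated.\<close>

definition tri :: "field \<Rightarrow> field \<Rightarrow> field \<Rightarrow> real" where
  "tri u v \<phi> = (LINT x|lebesgue_on \<Omega>. (wgrad \<Omega> v x *v u x) \<bullet> \<phi> x)"

lemma bilin_B_eq: "\<phi> \<in> V_space \<Omega> \<Longrightarrow> bilin_B \<Omega> u v \<phi> = tri u v \<phi>"
  by (simp add: bilin_B_def leray_def l2_functional_def l2_inner_def tri_def)

lemma tri_bound:
  "u \<in> H10 \<Omega> \<Longrightarrow> v \<in> H1 \<Omega> \<Longrightarrow> \<phi> \<in> H10 \<Omega> \<Longrightarrow> \<bar>tri u v \<phi>\<bar> \<le> V_norm \<Omega> v * sqrt (L4_bound u * L4_bound \<phi>)"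
  unfolding tri_def V_norm_def by (rule trilinear_bound[OF wgrad_L2])

lemma tri_integrable:
  "u \<in> H10 \<Omega> \<Longrightarrow> v \<in> H1 \<Omega> \<Longrightarrow> \<phi> \<in> H10 \<Omega> \<Longrightarrow> integrable (lebesgue_on \<Omega>) (\<lambda>x. (wgrad \<Omega> v x *v u x) \<bullet> \<phi> x)"
  by (rule trilinear_integrable[OF wgrad_L2])

lemma tri_diff_middle:
  assumes "u \<in> H10 \<Omega>" "v \<in> H1 \<Omega>" "v' \<in> H1 \<Omega>" "\<phi> \<in> H10 \<Omega>"
  shows "tri u (\<lambda>x. v x - v' x) \<phi> = tri u v \<phi> - tri u v' \<phi>"
proof -
  have "tri u (\<lambda>x. v x - v' x) \<phi> = (LINT x|lebesgue_on \<Omega>. (wgrad \<Omega> v x *v u x) \<bullet> \<phi> x - (wgrad \<Omega> v' x *v u x) \<bullet> \<phi> x)"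
    unfolding tri_def
  proof (rule integral_cong_AE)
    show "AE x in lebesgue_on \<Omega>. (wgrad \<Omega> (\<lambda>x. v x - v' x) x *v u x) \<bullet> \<phi> x
        = (wgrad \<Omega> v x *v u x) \<bullet> \<phi> x - (wgrad \<Omega> v' x *v u x) \<bullet> \<phi> x"
      using wgrad_diff[OF assms(2,3)] by eventually_elim (simp add: matrix_vector_mult_diff_rdistrib inner_diff_left)
    show "(\<lambda>x. (wgrad \<Omega> (\<lambda>x. v x - v' x) x *v u x) \<bullet> \<phi> x) \<in> borel_measurable (lebesgue_on \<Omega>)"
      by (rule borel_measurable_integrable[OF tri_integrable[OF assms(1) H1_diff[OF assms(2,3)] assms(4)]])
    show "(\<lambda>x. (wgrad \<Omega> v x *v u x) \<bullet> \<phi> x - (wgrad \<Omega> v' x *v u x) \<bullet> \<phi> x) \<in> borel_measurable (lebesgue_on \<Omega>)"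
      by (intro borel_measurable_integrable Bochner_Integration.integrable_diff tri_integrable assms)
  qed
  also have "\<dots> = tri u v \<phi> - tri u v' \<phi>"
    unfolding tri_def by (intro Bochner_Integration.integral_diff tri_integrable assms)
  finally show ?thesis .
qed

lemma tri_diff_right:
  assumes "u \<in> H10 \<Omega>" "v \<in> H1 \<Omega>" "\<phi> \<in> H10 \<Omega>" "\<phi>' \<in> H10 \<Omega>"
  shows "tri u v (\<lambda>x. \<phi> x - \<phi>' x) = tri u v \<phi> - tri u v \<phi>'"
  unfolding tri_def inner_diff_right by (intro Bochner_Integration.integral_diff tri_integrable assms)

lemma tri_diff_left:
  assumes "u \<in> H10 \<Omega>" "u' \<in> H10 \<Omega>" "v \<in> H1 \<Omega>" "\<phi> \<in> H10 \<Omega>"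
  shows "tri (\<lambda>x. u x - u' x) v \<phi> = tri u v \<phi> - tri u' v \<phi>"
  unfolding tri_def matrix_vector_mult_diff_distrib inner_diff_left by (intro Bochner_Integration.integral_diff tri_integrable assms)

section \<open>Cancellation of the convective term\<close>

text \<open>Integration by parts moves the derivative onto the solenoidal test fields, where it
  becomes the divergence, and the identity survives the \<open>L2\<close> limit that defines
  \<open>H_space\<close>. Incompressibility enters the cancellation here.\<close>

lemma H_space_orthogonal_gradient:
  fixes \<phi> :: "point \<Rightarrow> real"
  assumes v: "v \<in> H_space \<Omega>" and \<phi>: "\<phi> \<in> test_functions \<Omega>"
  shows "l2_inner \<Omega> v (\<lambda>x. \<chi> j. partial_deriv j \<phi> x) = 0"
proof -
  let ?g = "\<lambda>x. (\<chi> j. partial_deriv j \<phi> x) :: point"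
  note T = test_functions_bilinear[OF bounded_bilinear_mult]
  have gT: "?g \<in> test_functions \<Omega>"
  proof -
    have "?g = (\<lambda>x. \<Sum>j\<in>UNIV. partial_deriv j \<phi> x *\<^sub>R axis j 1)"
      by (simp add: fun_eq_iff vec_eq_iff axis_def if_distrib cong: if_cong)
    then show ?thesis
      by (simp only:) (rule test_functions_sum[OF finite
          test_functions_linear[OF bounded_linear_scaleR_left test_functions_partial_deriv[OF \<phi>]]])
  qed
  obtain s where s: "\<And>n. s n \<in> solenoidal_test_fields \<Omega>" "(\<lambda>n. l2_norm \<Omega> (\<lambda>x. s n x - v x)) \<longlonglongrightarrow> 0"
    using v unfolding H_space_def by blast
  have sT: "s n \<in> test_functions \<Omega>" and div: "(\<Sum>i\<in>UNIV. partial_deriv i (s n) x $ i) = 0" for n x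
    using s(1)[of n] by (auto simp: solenoidal_test_fields_def)
  have zero: "l2_inner \<Omega> (s n) ?g = 0" for n
  proof -
    have c: "(\<lambda>x. s n x $ j) \<in> test_functions \<Omega>" for j by (rule test_functions_nth[OF sT])
    have pd: "partial_deriv j (\<lambda>x. s n x $ j) x = partial_deriv j (s n) x $ j" for j x
      by (rule partial_deriv_linear[OF bounded_linear_vec_nth sT])
    have "l2_inner \<Omega> (s n) ?g = (LINT x|lborel. s n x \<bullet> ?g x)"
      unfolding l2_inner_def
      using test_functions_bilinear[OF bounded_bilinear_inner sT gT]
      by (intro integral_lebesgue_on_eq_lborel domain_lebesgue test_functions_borel_measurable test_functions_zero)
    also have "\<dots> = (\<Sum>j\<in>UNIV. LINT x|lborel. s n x $ j * partial_deriv j \<phi> x)"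
      unfolding inner_vec_def
      by (subst Bochner_Integration.integral_sum[symmetric])
        (auto intro!: test_functions_integrable T[OF c test_functions_partial_deriv[OF \<phi>]])
    also have "\<dots> = (\<Sum>j\<in>UNIV. - (LINT x|lborel. partial_deriv j (s n) x $ j * \<phi> x))"
      by (intro sum.cong refl) (simp add: integration_by_parts_test[OF c \<phi>] pd)
    also have "\<dots> = - (LINT x|lborel. (\<Sum>j\<in>UNIV. partial_deriv j (s n) x $ j * \<phi> x))"
      unfolding sum_negf
      by (subst Bochner_Integration.integral_sum)
        (auto intro!: test_functions_integrable T[OF test_functions_nth[OF test_functions_partial_deriv[OF sT]] \<phi>])
    also have "\<dots> = 0" by (simp add: sum_distrib_right[symmetric] div)
    finally show ?thesis .
  qed
  have "(\<lambda>n. l2_inner \<Omega> (s n) ?g) \<longlonglongrightarrow> l2_inner \<Omega> v ?g"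
  proof (rule l2_inner_tendsto[OF _ H_space_L2[OF v] s(2) _ test_functions_L2[OF gT]])
    show "eventually (\<lambda>n. s n \<in> L2 \<Omega>) sequentially" by (simp add: test_functions_L2[OF sT])
    show "eventually (\<lambda>n::nat. ?g \<in> L2 \<Omega>) sequentially" by (simp add: test_functions_L2[OF gT])
    show "(\<lambda>n::nat. l2_norm \<Omega> (\<lambda>x. ?g x - ?g x)) \<longlonglongrightarrow> 0" by (simp add: l2_norm_def l2_inner_def)
  qed
  then show ?thesis by (simp add: zero LIMSEQ_const_iff)
qed

text \<open>Pointwise, (v . nabla) s . s is half of v . nabla |s|^2, and |s|^2 is again a test
  function, so the orthogonality to gradients applies.\<close>

lemma tri_self_test:
  assumes v: "v \<in> H10 \<Omega>" "v \<in> H_space \<Omega>" and s: "s \<in> test_functions \<Omega>"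
  shows "tri v s s = 0"
proof -
  let ?\<phi> = "\<lambda>x. s x \<bullet> s x"
  have \<phi>: "?\<phi> \<in> test_functions \<Omega>" by (rule test_functions_bilinear[OF bounded_bilinear_inner s s])
  have pd: "partial_deriv j ?\<phi> x = 2 * (s x \<bullet> partial_deriv j s x)" for j x
    by (simp add: partial_deriv_bilinear[OF bounded_bilinear_inner s s] inner_commute)
  have pt: "(classical_grad s x *v v x) \<bullet> s x = (1 / 2) * (v x \<bullet> (\<chi> j. partial_deriv j ?\<phi> x))" for x
  proof -
    have "(classical_grad s x *v v x) \<bullet> s x = (\<Sum>i\<in>UNIV. \<Sum>j\<in>UNIV. partial_deriv j s x $ i * v x $ j * s x $ i)"
      by (simp add: inner_vec_def matrix_vector_mult_def classical_grad_def sum_distrib_right)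
    also have "\<dots> = (\<Sum>j\<in>UNIV. \<Sum>i\<in>UNIV. partial_deriv j s x $ i * v x $ j * s x $ i)"
      by (rule sum.swap)
    also have "\<dots> = (\<Sum>j\<in>UNIV. v x $ j * (s x \<bullet> partial_deriv j s x))"
      unfolding inner_vec_def by (simp add: sum_distrib_left mult_ac)
    also have "\<dots> = (1 / 2) * (v x \<bullet> (\<chi> j. partial_deriv j ?\<phi> x))"
      unfolding pd inner_vec_def[of "v x"] by (simp add: sum_distrib_left)
    finally show ?thesis .
  qed
  have "tri v s s = (LINT x|lebesgue_on \<Omega>. (classical_grad s x *v v x) \<bullet> s x)"
    unfolding tri_def
  proof (rule integral_cong_AE)
    show "AE x in lebesgue_on \<Omega>. (wgrad \<Omega> s x *v v x) \<bullet> s x = (classical_grad s x *v v x) \<bullet> s x"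
      using wgrad_test[OF s] by eventually_elim simp
  qed (rule borel_measurable_integrable[OF trilinear_integrable[OF _ v(1) test_H10[OF s]]];
      intro wgrad_L2 test_H1 s test_functions_L2[OF test_functions_classical_grad[OF s]])+
  also have "\<dots> = (1 / 2) * l2_inner \<Omega> v (\<lambda>x. \<chi> j. partial_deriv j ?\<phi> x)"
    unfolding pt l2_inner_def by simp
  also have "\<dots> = 0" using H_space_orthogonal_gradient[OF v(2) \<phi>] by simp
  finally show ?thesis .
qed

text \<open>The transporting field stays fixed while \<open>w\<close> is approximated by test
  functions in both norms; the errors in the two occurrences of \<open>w\<close> are bounded by
  \<open>tri_bound\<close> and tend to 0.\<close>

lemma tri_self:
  assumes v: "v \<in> V_space \<Omega>" and w: "w \<in> H10 \<Omega>"
  shows "tri v w w = 0"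
proof -
  have v': "v \<in> H10 \<Omega>" "v \<in> H_space \<Omega>" using v by (auto simp: V_H10 V_H)
  obtain s where s: "\<And>n. s n \<in> test_functions \<Omega>" "(\<lambda>n. l2_norm \<Omega> (\<lambda>x. s n x - w x)) \<longlonglongrightarrow> 0"
    "(\<lambda>n. V_norm \<Omega> (\<lambda>x. s n x - w x)) \<longlonglongrightarrow> 0" using H10_approx[OF w] by blast
  have wH: "w \<in> H1 \<Omega>" "w \<in> L2 \<Omega>" using w by (auto simp: H10_H1 H1_L2)
  have sH: "s n \<in> H10 \<Omega>" "s n \<in> H1 \<Omega>" "s n \<in> L2 \<Omega>" for n
    using s(1)[of n] by (auto simp: test_H10 test_H1 test_functions_L2)
  have l: "(\<lambda>n. l2_norm \<Omega> (s n)) \<longlonglongrightarrow> l2_norm \<Omega> w"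
    using sH wH s(2) by (intro l2_norm_tendsto) auto
  have V: "(\<lambda>n. V_norm \<Omega> (s n)) \<longlonglongrightarrow> V_norm \<Omega> w"
    unfolding V_norm_def using s(3) wgrad_L2[OF sH(2)] wgrad_L2[OF wH(1)]
    by (intro l2_norm_tendsto) (simp_all add: V_norm_diff[OF sH(2) wH(1)])
  have "(\<lambda>n. V_norm \<Omega> (\<lambda>x. s n x - w x) * sqrt (L4_bound v * L4_bound (s n)) + V_norm \<Omega> w * sqrt (L4_bound v * L4_bound (\<lambda>x. s n x - w x)))
     \<longlonglongrightarrow> 0 * sqrt (L4_bound v * L4_bound w) + V_norm \<Omega> w * sqrt (L4_bound v * sqrt (8 * 0 * 0 ^ 3))"
    unfolding L4_bound_def by (intro tendsto_intros l V s)
  then have lim: "(\<lambda>n. V_norm \<Omega> (\<lambda>x. s n x - w x) * sqrt (L4_bound v * L4_bound (s n)) + V_norm \<Omega> w * sqrt (L4_bound v * L4_bound (\<lambda>x. s n x - w x)))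
     \<longlonglongrightarrow> 0" by simp
  have bound: "\<bar>tri v w w\<bar> \<le> V_norm \<Omega> (\<lambda>x. s n x - w x) * sqrt (L4_bound v * L4_bound (s n)) + V_norm \<Omega> w * sqrt (L4_bound v * L4_bound (\<lambda>x. s n x - w x))" for n
  proof -
    have "tri v (\<lambda>x. s n x - w x) (s n) = tri v (s n) (s n) - tri v w (s n)"
      by (rule tri_diff_middle[OF v'(1) sH(2) wH(1) sH(1)])
    moreover have "tri v w (\<lambda>x. s n x - w x) = tri v w (s n) - tri v w w"
      by (rule tri_diff_right[OF v'(1) wH(1) sH(1) w])
    moreover have "tri v (s n) (s n) = 0" by (rule tri_self_test[OF v' s(1)])
    moreover have "\<bar>tri v (\<lambda>x. s n x - w x) (s n)\<bar> \<le> V_norm \<Omega> (\<lambda>x. s n x - w x) * sqrt (L4_bound v * L4_bound (s n))"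
      by (rule tri_bound[OF v'(1) H1_diff[OF sH(2) wH(1)] sH(1)])
    moreover have "\<bar>tri v w (\<lambda>x. s n x - w x)\<bar> \<le> V_norm \<Omega> w * sqrt (L4_bound v * L4_bound (\<lambda>x. s n x - w x))"
      by (rule tri_bound[OF v'(1) wH(1) H10_diff[OF sH(1) w]])
    ultimately show ?thesis by linarith
  qed
  have "\<bar>tri v w w\<bar> \<le> 0"
    by (rule LIMSEQ_le_const[OF lim]) (use bound in blast)
  then show ?thesis by simp
qed

section \<open>Bounds drawn from the first eigenvalue\<close>

text \<open>The \<open>L2\<close> norm is traded for the power -1/2 of the first eigenvalue times
  the gradient norm; under the square root the exponent becomes -1/4. If the norm of
  \<open>w\<close> is 0, there may be no eigenvalue, but then the left-hand side is 0.\<close>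

lemma L4_bound_le:
  assumes w: "w \<in> V_space \<Omega>"
  shows "L4_bound w \<le> sqrt 8 * stokes_lambda1 \<Omega> powr (- 1/4) * (V_norm \<Omega> w)\<^sup>2"
proof (cases "l2_norm \<Omega> w = 0")
  case False
  then have ex: "\<exists>w\<in>V_space \<Omega>. l2_norm \<Omega> w \<noteq> 0" using w by blast
  let ?m = "stokes_lambda1 \<Omega>" and ?c = "stokes_lambda1 \<Omega> powr (- 1/4)"
  have m: "?m > 0" by (rule stokes_lambda1_Rayleigh(1)[OF ex])
  have c: "?c > 0" using m by simp
  have c4: "?m * ?c ^ 4 = 1"
  proof -
    have "?c ^ 4 = ?m powr (-1)" using m by (simp add: powr_powr flip: powr_realpow)
    then show ?thesis using m by (simp add: powr_minus)
  qed
  have "(l2_norm \<Omega> w)\<^sup>2 = ?c ^ 4 * (?m * (l2_norm \<Omega> w)\<^sup>2)" using c4 by (simp add: mult.assoc[symmetric] mult.commute)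
  also have "\<dots> \<le> ?c ^ 4 * (V_norm \<Omega> w)\<^sup>2"
    by (intro mult_left_mono stokes_lambda1_Rayleigh(2)[OF ex w]) auto
  also have "\<dots> = (?c\<^sup>2 * V_norm \<Omega> w)\<^sup>2" by (simp add: power_mult_distrib flip: power_mult)
  finally have l: "l2_norm \<Omega> w \<le> ?c\<^sup>2 * V_norm \<Omega> w"
    by (rule power2_le_imp_le) (simp add: V_norm_nonneg)
  have "8 * l2_norm \<Omega> w * V_norm \<Omega> w ^ 3 \<le> 8 * (?c\<^sup>2 * V_norm \<Omega> w) * V_norm \<Omega> w ^ 3"
    by (intro mult_right_mono mult_left_mono l) (auto simp: V_norm_nonneg)
  also have "\<dots> = (sqrt 8 * ?c * (V_norm \<Omega> w)\<^sup>2)\<^sup>2"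
    by (simp add: power_mult_distrib power2_eq_square power3_eq_cube)
  finally have "L4_bound w \<le> sqrt ((sqrt 8 * ?c * (V_norm \<Omega> w)\<^sup>2)\<^sup>2)"
    unfolding L4_bound_def by (rule real_sqrt_le_mono)
  then show ?thesis by simp
qed (simp add: L4_bound_def)

text \<open>The constant is the power -1/2 of the first eigenvalue, or 0 on a trivial space. Its
  existence serves qualitative ends: finite suprema and convergence in \<open>L2\<close>.\<close>

lemma Poincare: "\<exists>P\<ge>0. \<forall>f\<in>V_space \<Omega>. l2_norm \<Omega> f \<le> P * V_norm \<Omega> f"
proof (cases "\<exists>w\<in>V_space \<Omega>. l2_norm \<Omega> w \<noteq> 0")
  case True
  let ?m = "stokes_lambda1 \<Omega>"
  have m: "?m > 0" by (rule stokes_lambda1_Rayleigh(1)[OF True])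
  have "l2_norm \<Omega> f \<le> 1 / sqrt ?m * V_norm \<Omega> f" if "f \<in> V_space \<Omega>" for f
  proof -
    have "sqrt (?m * (l2_norm \<Omega> f)\<^sup>2) \<le> sqrt ((V_norm \<Omega> f)\<^sup>2)"
      by (intro real_sqrt_le_mono stokes_lambda1_Rayleigh(2)[OF True that])
    then have "sqrt ?m * l2_norm \<Omega> f \<le> V_norm \<Omega> f"
      by (simp add: real_sqrt_mult l2_norm_nonneg V_norm_nonneg)
    then show ?thesis using m by (simp add: field_simps)
  qed
  then show ?thesis using m by (intro exI[of _ "1 / sqrt ?m"]) auto
next
  case False
  then show ?thesis by (intro exI[of _ 0]) auto
qed

text \<open>The dual norm is a supremum of reals, so it dominates its members only once boundedness
  is known, which Poincare's inequality provides; then \<phi> is normalized. A field without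
  gradient cannot be normalized and is treated apart.\<close>

lemma V_dual_norm_bound:
  assumes h: "h \<in> L2 \<Omega>" and \<phi>: "\<phi> \<in> V_space \<Omega>"
  shows "\<bar>l2_inner \<Omega> h \<phi>\<bar> \<le> V_dual_norm \<Omega> (l2_functional \<Omega> h) * V_norm \<Omega> \<phi>"
proof (cases "V_norm \<Omega> \<phi> = 0")
  case True
  then have "l2_norm \<Omega> \<phi> = 0" using V_norm_eq_0_imp[OF V_H10[OF \<phi>]] by simp
  then show ?thesis using l2_Cauchy_Schwarz[OF h V_L2[OF \<phi>]] True by simp
next
  case False
  then have pos: "V_norm \<Omega> \<phi> > 0" using V_norm_nonneg[of \<phi>] by simp
  obtain P where P: "P \<ge> 0" "\<And>f. f \<in> V_space \<Omega> \<Longrightarrow> l2_norm \<Omega> f \<le> P * V_norm \<Omega> f" using Poincare by blast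
  let ?S = "{\<phi> \<in> V_space \<Omega>. V_norm \<Omega> \<phi> \<le> 1}"
  have bdd: "bdd_above ((\<lambda>\<phi>. \<bar>l2_functional \<Omega> h \<phi>\<bar>) ` ?S)"
  proof (rule bdd_aboveI2)
    fix f assume f: "f \<in> ?S"
    have "\<bar>l2_functional \<Omega> h f\<bar> \<le> l2_norm \<Omega> h * l2_norm \<Omega> f"
      unfolding l2_functional_def using f by (intro l2_Cauchy_Schwarz h V_L2) auto
    also have "\<dots> \<le> l2_norm \<Omega> h * (P * 1)"
      using f P(1) by (intro mult_left_mono order_trans[OF P(2)] l2_norm_nonneg) auto
    finally show "\<bar>l2_functional \<Omega> h f\<bar> \<le> l2_norm \<Omega> h * (P * 1)" .
  qed
  let ?\<psi> = "\<lambda>x. (1 / V_norm \<Omega> \<phi>) *\<^sub>R \<phi> x"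
  have "?\<psi> \<in> ?S" using V_scaleR[OF \<phi>] pos by (simp add: V_norm_scaleR[OF V_H1[OF \<phi>]])
  then have "\<bar>l2_functional \<Omega> h ?\<psi>\<bar> \<le> V_dual_norm \<Omega> (l2_functional \<Omega> h)"
    unfolding V_dual_norm_def by (rule cSUP_upper[OF _ bdd])
  then show ?thesis using pos by (simp add: l2_functional_def l2_inner_scaleR_right abs_mult field_simps)
qed

end

section \<open>Energy estimates\<close>

text \<open>The function exp (-K s) y(s) - a s is nonincreasing. Replacing exp (-K s) by 1 in the
  source term costs sharpness but yields a product form, matching the factor \<open>D_const\<close>
  times exp T.\<close>

lemma Gronwall:
  fixes y :: "real \<Rightarrow> real"
  assumes der: "\<And>t. 0 \<le> t \<Longrightarrow> (y has_real_derivative y' t) (at t within {0..})"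
    and le: "\<And>t. 0 \<le> t \<Longrightarrow> t \<le> T \<Longrightarrow> y' t \<le> a + K * y t"
    and "0 \<le> a" "0 \<le> K" and t: "0 \<le> t" "t \<le> T"
  shows "y t \<le> (y 0 + a * t) * exp (K * t)"
proof -
  define z where "z s = y s * exp (- K * s) - a * s" for s
  have dz: "(z has_real_derivative (y' s - K * y s) * exp (- K * s) - a) (at s within {0..})" if "0 \<le> s" for s
    unfolding z_def[abs_def]
    by (rule derivative_eq_intros der that refl | simp add: algebra_simps)+
  have "z t \<le> z 0"
  proof (rule DERIV_nonpos_imp_decreasing_open[OF t(1)])
    fix s assume s: "0 < s" "s < t"
    \<comment> \<open>In the interior of the half line the one-sided filter is the full one.\<close>
    have "at s within {0..} = at s"
      using s by (intro at_within_interior) simp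
    then have "(z has_real_derivative (y' s - K * y s) * exp (- K * s) - a) (at s)"
      using dz[of s] s by simp
    moreover have "(y' s - K * y s) * exp (- K * s) - a \<le> 0"
    proof -
      have "y' s - K * y s \<le> a" using le[of s] s t by simp
      then have "(y' s - K * y s) * exp (- K * s) \<le> a * exp (- K * s)" by (rule mult_right_mono) simp
      also have "\<dots> \<le> a * 1" using assms(3,4) s by (intro mult_left_mono) auto
      finally show ?thesis by simp
    qed
    ultimately show "\<exists>D. (z has_real_derivative D) (at s) \<and> D \<le> 0" by blast
  next
    show "continuous_on {0..t} z"
      unfolding continuous_on_eq_continuous_within
    proof
      fix s assume "s \<in> {0..t}"
      then have "continuous (at s within {0..}) z" by (intro DERIV_continuous[OF dz]) simp
      then show "continuous (at s within {0..t}) z" by (rule continuous_within_subset) auto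
    qed
  qed
  then have "y t * exp (- K * t) \<le> y 0 + a * t" by (simp add: z_def)
  then have "y t * exp (- K * t) * exp (K * t) \<le> (y 0 + a * t) * exp (K * t)" by (rule mult_right_mono) simp
  then show ?thesis by (simp add: mult.assoc flip: exp_add)
qed

context bounded_open begin

text \<open>Differentiability is assumed in the gradient norm; Poincare's inequality transfers it to
  the \<open>L2\<close> norm, and the linearity of \<open>wgrad\<close> turns it into convergence of
  the difference quotients of the gradients. It is applied with \<alpha>^2 for
  \<open>c\<close>.\<close>

lemma energy_has_derivative:
  assumes v: "\<And>s. s \<ge> 0 \<Longrightarrow> v s \<in> V_space \<Omega>" "v' \<in> V_space \<Omega>" and t: "t \<ge> 0"
    and d: "((\<lambda>s. V_norm \<Omega> (\<lambda>x. (v s x - v t x) /\<^sub>R (s - t) - v' x)) \<longlongrightarrow> 0) (at t within {0..})"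
  shows "((\<lambda>s. (l2_norm \<Omega> (v s))\<^sup>2 + c * (V_norm \<Omega> (v s))\<^sup>2) has_real_derivative
    2 * (l2_inner \<Omega> v' (v t) + c * grad_inner v' (v t))) (at t within {0..})"
proof -
  let ?F = "at t within {0..}" and ?q = "\<lambda>s x. (v s x - v t x) /\<^sub>R (s - t) - v' x"
  have ev: "eventually (\<lambda>s. s \<in> {0..}) ?F" by (auto simp: eventually_at_filter)
  have q: "?q s \<in> V_space \<Omega>" if "s \<ge> 0" for s
    by (intro V_diff V_scaleR v that t)
  obtain P where P: "\<And>f. f \<in> V_space \<Omega> \<Longrightarrow> l2_norm \<Omega> f \<le> P * V_norm \<Omega> f" using Poincare by blast
  have d1: "((\<lambda>s. l2_norm \<Omega> (?q s)) \<longlongrightarrow> 0) ?F"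
  proof (rule tendsto_sandwich[OF _ _ tendsto_const tendsto_mult_right_zero[OF d]])
    show "eventually (\<lambda>s. 0 \<le> l2_norm \<Omega> (?q s)) ?F" by (simp add: l2_norm_nonneg)
    show "eventually (\<lambda>s. l2_norm \<Omega> (?q s) \<le> P * V_norm \<Omega> (?q s)) ?F"
      using ev by eventually_elim (simp add: P q)
  qed
  have d2: "((\<lambda>s. l2_norm \<Omega> (\<lambda>x. (wgrad \<Omega> (v s) x - wgrad \<Omega> (v t) x) /\<^sub>R (s - t) - wgrad \<Omega> v' x)) \<longlongrightarrow> 0) ?F"
  proof (rule Lim_transform_eventually[OF d])
    show "eventually (\<lambda>s. V_norm \<Omega> (?q s) =
      l2_norm \<Omega> (\<lambda>x. (wgrad \<Omega> (v s) x - wgrad \<Omega> (v t) x) /\<^sub>R (s - t) - wgrad \<Omega> v' x)) ?F"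
      using ev
    proof eventually_elim
      case (elim s)
      have H: "v s \<in> H1 \<Omega>" "v t \<in> H1 \<Omega>" "v' \<in> H1 \<Omega>" using v t elim by (simp_all add: V_H1)
      have "AE x in lebesgue_on \<Omega>. wgrad \<Omega> (\<lambda>x. (v s x - v t x) /\<^sub>R (s - t)) x - wgrad \<Omega> v' x
         = (wgrad \<Omega> (v s) x - wgrad \<Omega> (v t) x) /\<^sub>R (s - t) - wgrad \<Omega> v' x"
        using wgrad_scaleR[OF H1_diff[OF H(1,2)], of "inverse (s - t)"] wgrad_diff[OF H(1,2)]
        by eventually_elim simp
      from l2_norm_cong_AE[OF this] show ?case
        unfolding V_norm_diff[OF H1_scaleR[OF H1_diff[OF H(1,2)]] H(3)]
        by (simp add: L2_diff L2_scaleR wgrad_L2 H H1_scaleR H1_diff)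
    qed
  qed
  have D1: "((\<lambda>s. l2_inner \<Omega> (v s) (v s)) has_real_derivative 2 * l2_inner \<Omega> v' (v t)) ?F"
    by (rule l2_inner_has_derivative[OF _ _ t d1]) (simp_all add: v V_L2)
  have D2: "((\<lambda>s. l2_inner \<Omega> (wgrad \<Omega> (v s)) (wgrad \<Omega> (v s))) has_real_derivative 2 * l2_inner \<Omega> (wgrad \<Omega> v') (wgrad \<Omega> (v t))) ?F"
    by (rule l2_inner_has_derivative[OF _ _ t d2]) (simp_all add: v V_H1 wgrad_L2)
  have "((\<lambda>s. l2_inner \<Omega> (v s) (v s) + c * l2_inner \<Omega> (wgrad \<Omega> (v s)) (wgrad \<Omega> (v s))) has_real_derivative
     2 * l2_inner \<Omega> v' (v t) + c * (2 * l2_inner \<Omega> (wgrad \<Omega> v') (wgrad \<Omega> (v t)))) ?F"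
    by (intro DERIV_add DERIV_cmult D1 D2)
  then show ?thesis
    by (simp add: l2_norm_sq V_norm_sq grad_inner_def algebra_simps)
qed

section \<open>Energy bounds for weak solutions and for their difference\<close>

abbreviation weak_equation ::
  "real \<Rightarrow> real \<Rightarrow> field \<Rightarrow> (real \<Rightarrow> field) \<Rightarrow> (real \<Rightarrow> field) \<Rightarrow> bool" where
  "weak_equation \<nu> \<alpha> h v v' \<equiv> \<forall>t\<ge>0. \<forall>\<phi>\<in>V_space \<Omega>.
     l2_functional \<Omega> (v' t) \<phi> + \<nu> * stokes \<Omega> (v t) \<phi> + \<alpha>\<^sup>2 * stokes \<Omega> (v' t) \<phi>
       + bilin_B \<Omega> (v t) (v t) \<phi> = l2_functional \<Omega> h \<phi>"

lemma weak_solution_eq: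
  assumes "weak_equation \<nu> \<alpha> h v v'"
    and "t \<ge> 0" "\<phi> \<in> V_space \<Omega>"
  shows "l2_inner \<Omega> (v' t) \<phi> + \<alpha>\<^sup>2 * grad_inner (v' t) \<phi> = l2_inner \<Omega> h \<phi> - \<nu> * grad_inner (v t) \<phi> - tri (v t) (v t) \<phi>"
  using assms(1)[rule_format, OF assms(2,3)] assms(3)
  by (simp add: l2_functional_def stokes_eq bilin_B_eq)

text \<open>The energy bound below, stated for \<nu> \<ge> 0, thereby covers both solutions.\<close>

lemma Bardina_iff_inviscid_NSV: "Bardina_weak_solution \<Omega> \<alpha> h v0 u \<longleftrightarrow> NSV_weak_solution \<Omega> 0 \<alpha> h v0 u"
  by (simp add: Bardina_weak_solution_def NSV_weak_solution_def)

lemma D_const_nonneg: "T \<ge> 0 \<Longrightarrow> 0 \<le> D_const \<Omega> \<alpha> h v0 T"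
  unfolding D_const_def by (intro divide_nonneg_nonneg add_nonneg_nonneg mult_nonneg_nonneg) auto

text \<open>Tested with the solution itself, the convective term vanishes and the viscous term has a
  good sign, so the bound does not depend on \<nu>. Young's inequality for the forcing leaves the
  energy with coefficient 1, hence the factor exp T.\<close>

lemma V_norm_weak_solution_le:
  assumes \<alpha>: "\<alpha> > 0" and \<nu>: "\<nu> \<ge> 0" and h: "h \<in> H_space \<Omega>" and v0: "v0 \<in> V_space \<Omega>"
    and sol: "NSV_weak_solution \<Omega> \<nu> \<alpha> h v0 v" and t: "0 \<le> t" "t \<le> T"
  shows "(V_norm \<Omega> (v t))\<^sup>2 \<le> D_const \<Omega> \<alpha> h v0 T * exp T"
proof -
  obtain v' where C1: "C1_in_V \<Omega> v v'" and eq: "weak_equation \<nu> \<alpha> h v v'" and init: "AE x in lebesgue_on \<Omega>. v 0 x = v0 x"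
    using sol unfolding NSV_weak_solution_def by blast
  have V: "v s \<in> V_space \<Omega>" "v' s \<in> V_space \<Omega>"
    "((\<lambda>r. V_norm \<Omega> (\<lambda>x. (v r x - v s x) /\<^sub>R (r - s) - v' s x)) \<longlongrightarrow> 0) (at s within {0..})" if "s \<ge> 0" for s
    using C1 that unfolding C1_in_V_def by blast+
  define E where "E s = (l2_norm \<Omega> (v s))\<^sup>2 + \<alpha>\<^sup>2 * (V_norm \<Omega> (v s))\<^sup>2" for s
  define E' where "E' s = 2 * (l2_inner \<Omega> (v' s) (v s) + \<alpha>\<^sup>2 * grad_inner (v' s) (v s))" for s
  define N where "N = V_dual_norm \<Omega> (l2_functional \<Omega> h)"
  have der: "(E has_real_derivative E' s) (at s within {0..})" if "0 \<le> s" for s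
    unfolding E_def[abs_def] E'_def using V that by (intro energy_has_derivative) auto
  have le: "E' s \<le> N\<^sup>2 / \<alpha>\<^sup>2 + 1 * E s" if s: "0 \<le> s" for s
  proof -
    have "tri (v s) (v s) (v s) = 0" by (rule tri_self[OF V(1)[OF s] V_H10[OF V(1)[OF s]]])
    then have "E' s = 2 * (l2_inner \<Omega> h (v s) - \<nu> * (V_norm \<Omega> (v s))\<^sup>2)"
      unfolding E'_def weak_solution_eq[OF eq s V(1)[OF s]] by (simp add: V_norm_sq)
    also have "\<dots> \<le> 2 * (N * V_norm \<Omega> (v s))"
    proof -
      have "0 \<le> \<nu> * (V_norm \<Omega> (v s))\<^sup>2" using \<nu> by simp
      moreover have "2 * (x - y) \<le> 2 * z" if "0 \<le> y" "\<bar>x\<bar> \<le> z" for x y z :: real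
        using that abs_ge_self[of x] by simp
      ultimately show ?thesis
        using V_dual_norm_bound[OF H_space_L2[OF h] V(1)[OF s]] unfolding N_def by blast
    qed
    \<comment> \<open>The weight \<alpha> is chosen so that the second square is part of the energy
      \<open>E\<close>.\<close>
    also have "\<dots> = 2 * (N / \<alpha>) * (\<alpha> * V_norm \<Omega> (v s))" using \<alpha> by simp
    also have "\<dots> \<le> (N / \<alpha>)\<^sup>2 + (\<alpha> * V_norm \<Omega> (v s))\<^sup>2" by (rule sum_squares_bound)
    also have "\<dots> \<le> N\<^sup>2 / \<alpha>\<^sup>2 + 1 * E s" by (simp add: E_def power_divide power_mult_distrib)
    finally show ?thesis .
  qed
  have "E t \<le> (E 0 + N\<^sup>2 / \<alpha>\<^sup>2 * t) * exp (1 * t)"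
    using der le t by (intro Gronwall[of E E' T]) auto
  also have "\<dots> \<le> (E 0 + N\<^sup>2 / \<alpha>\<^sup>2 * T) * exp T"
  proof (rule mult_mono)
    show "E 0 + N\<^sup>2 / \<alpha>\<^sup>2 * t \<le> E 0 + N\<^sup>2 / \<alpha>\<^sup>2 * T"
      using t by (intro add_left_mono mult_left_mono) auto
    show "0 \<le> E 0 + N\<^sup>2 / \<alpha>\<^sup>2 * T"
      unfolding E_def using t by (intro add_nonneg_nonneg mult_nonneg_nonneg) auto
  qed (use t in auto)
  \<comment> \<open>The initial value is attained almost everywhere only, which both norms
    respect.\<close>
  also have "E 0 = (l2_norm \<Omega> v0)\<^sup>2 + \<alpha>\<^sup>2 * (V_norm \<Omega> v0)\<^sup>2"
    unfolding E_def using V(1)[of 0] v0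
    by (simp add: l2_norm_cong_AE[OF init] V_norm_cong_AE[OF init] V_L2 V_H1)
  finally have "\<alpha>\<^sup>2 * (V_norm \<Omega> (v t))\<^sup>2 \<le> ((l2_norm \<Omega> v0)\<^sup>2 + \<alpha>\<^sup>2 * (V_norm \<Omega> v0)\<^sup>2 + N\<^sup>2 / \<alpha>\<^sup>2 * T) * exp T"
    unfolding E_def using zero_le_power2[of "l2_norm \<Omega> (v t)"] by linarith
  then have "(V_norm \<Omega> (v t))\<^sup>2 \<le> ((l2_norm \<Omega> v0)\<^sup>2 + \<alpha>\<^sup>2 * (V_norm \<Omega> v0)\<^sup>2 + N\<^sup>2 / \<alpha>\<^sup>2 * T) * exp T / \<alpha>\<^sup>2"
    using \<alpha> by (simp add: pos_le_divide_eq mult.commute)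
  also have "\<dots> = D_const \<Omega> \<alpha> h v0 T * exp T"
    unfolding D_const_def N_def by (simp add: mult.commute)
  finally show ?thesis .
qed

text \<open>The viscosity acts on \<open>v\<close>, not on \<open>w\<close>, so it appears as a
  source. Cauchy-Schwarz and Young's inequality turn it into \<nu>^2 times the energy bound plus the
  squared gradient norm of \<open>w\<close>; the latter and the convective term give the two parts
  of the exponent.\<close>

lemma inviscid_limit_estimate:
  assumes \<alpha>: "\<alpha> > 0" and \<nu>: "\<nu> > 0" and h: "h \<in> H_space \<Omega>" and v0: "v0 \<in> V_space \<Omega>"
    and v: "NSV_weak_solution \<Omega> \<nu> \<alpha> h v0 v" and u: "Bardina_weak_solution \<Omega> \<alpha> h v0 u" and t: "0 \<le> t" "t \<le> T"
  shows "(l2_norm \<Omega> (\<lambda>x. v t x - u t x))\<^sup>2 + \<alpha>\<^sup>2 * (V_norm \<Omega> (\<lambda>x. v t x - u t x))\<^sup>2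
    \<le> \<nu>\<^sup>2 * T * D_const \<Omega> \<alpha> h v0 T * exp T *
      exp (T / \<alpha>\<^sup>2 + 2 * sqrt 8 / \<alpha>\<^sup>2 * stokes_lambda1 \<Omega> powr (- 1/4) * T * sqrt (D_const \<Omega> \<alpha> h v0 T) * exp (T / 2))"
proof -
  let ?D = "D_const \<Omega> \<alpha> h v0 T"
  define c where "c = sqrt 8 * stokes_lambda1 \<Omega> powr (- 1/4)"
  have c: "c \<ge> 0" by (simp add: c_def)
  have T: "T \<ge> 0" using t by linarith
  have D: "?D \<ge> 0" by (rule D_const_nonneg[OF T])
  have u0: "NSV_weak_solution \<Omega> 0 \<alpha> h v0 u" using u by (simp add: Bardina_iff_inviscid_NSV)
  obtain v' where C1v: "C1_in_V \<Omega> v v'" and eqv: "weak_equation \<nu> \<alpha> h v v'" and initv: "AE x in lebesgue_on \<Omega>. v 0 x = v0 x"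
    using v unfolding NSV_weak_solution_def by blast
  obtain u' where C1u: "C1_in_V \<Omega> u u'" and equ: "weak_equation 0 \<alpha> h u u'" and initu: "AE x in lebesgue_on \<Omega>. u 0 x = v0 x"
    using u0 unfolding NSV_weak_solution_def by blast
  have Vv: "v s \<in> V_space \<Omega>" "v' s \<in> V_space \<Omega>"
    "((\<lambda>r. V_norm \<Omega> (\<lambda>x. (v r x - v s x) /\<^sub>R (r - s) - v' s x)) \<longlongrightarrow> 0) (at s within {0..})" if "s \<ge> 0" for s
    using C1v that unfolding C1_in_V_def by blast+
  have Vu: "u s \<in> V_space \<Omega>" "u' s \<in> V_space \<Omega>"
    "((\<lambda>r. V_norm \<Omega> (\<lambda>x. (u r x - u s x) /\<^sub>R (r - s) - u' s x)) \<longlongrightarrow> 0) (at s within {0..})" if "s \<ge> 0" for s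
    using C1u that unfolding C1_in_V_def by blast+
  define w where "w s x = v s x - u s x" for s x
  define w' where "w' s x = v' s x - u' s x" for s x
  have Vw: "w s \<in> V_space \<Omega>" "w' s \<in> V_space \<Omega>" if "s \<ge> 0" for s
    unfolding w_def[abs_def] w'_def[abs_def] using that by (intro V_diff Vv Vu; assumption)+
  have dw: "((\<lambda>r. V_norm \<Omega> (\<lambda>x. (w r x - w s x) /\<^sub>R (r - s) - w' s x)) \<longlongrightarrow> 0) (at s within {0..})" if s: "s \<ge> 0" for s
  proof (rule tendsto_sandwich[OF _ _ tendsto_const tendsto_add_zero[OF Vv(3)[OF s] Vu(3)[OF s]]])
    show "eventually (\<lambda>r. 0 \<le> V_norm \<Omega> (\<lambda>x. (w r x - w s x) /\<^sub>R (r - s) - w' s x)) (at s within {0..})"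
      by (simp add: V_norm_nonneg)
    have "eventually (\<lambda>r. r \<in> {0..}) (at s within {0..})" by (auto simp: eventually_at_filter)
    then show "eventually (\<lambda>r. V_norm \<Omega> (\<lambda>x. (w r x - w s x) /\<^sub>R (r - s) - w' s x)
        \<le> V_norm \<Omega> (\<lambda>x. (v r x - v s x) /\<^sub>R (r - s) - v' s x) + V_norm \<Omega> (\<lambda>x. (u r x - u s x) /\<^sub>R (r - s) - u' s x)) (at s within {0..})"
    proof eventually_elim
      case (elim r)
      then have r: "r \<ge> 0" by simp
      let ?a = "\<lambda>x. (v r x - v s x) /\<^sub>R (r - s) - v' s x" and ?b = "\<lambda>x. (u r x - u s x) /\<^sub>R (r - s) - u' s x"
      have "?a \<in> V_space \<Omega>" "?b \<in> V_space \<Omega>"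
        by (intro V_diff V_scaleR Vv Vu r s)+
      then have a: "?a \<in> H1 \<Omega>" and b: "?b \<in> H1 \<Omega>" by (auto simp: V_H1)
      have e: "(\<lambda>x. (w r x - w s x) /\<^sub>R (r - s) - w' s x) = (\<lambda>x. ?a x + (- 1) *\<^sub>R ?b x)"
        by (simp add: fun_eq_iff w_def w'_def algebra_simps)
      show ?case
        unfolding e using V_norm_triangle[OF a H1_scaleR[OF b, of "-1"]] unfolding V_norm_scaleR[OF b] by simp
    qed
  qed
  define E where "E s = (l2_norm \<Omega> (w s))\<^sup>2 + \<alpha>\<^sup>2 * (V_norm \<Omega> (w s))\<^sup>2" for s
  define E' where "E' s = 2 * (l2_inner \<Omega> (w' s) (w s) + \<alpha>\<^sup>2 * grad_inner (w' s) (w s))" for s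
  \<comment> \<open>Both parts carry 1/\<alpha>^2 because \<open>E\<close> controls the squared
    gradient norm only with the weight \<alpha>^2.\<close>
  define K where "K = 1 / \<alpha>\<^sup>2 + 2 * c / \<alpha>\<^sup>2 * sqrt ?D * exp (T / 2)"
  have K: "K \<ge> 0" unfolding K_def using c D by simp
  have der: "(E has_real_derivative E' s) (at s within {0..})" if "0 \<le> s" for s
    unfolding E_def[abs_def] E'_def using Vw dw that by (intro energy_has_derivative) auto
  have le: "E' s \<le> \<nu>\<^sup>2 * ?D * exp T + K * E s" if s: "0 \<le> s" "s \<le> T" for s
  proof -
    note H10 = V_H10[OF Vv(1)[OF s(1)]] V_H10[OF Vu(1)[OF s(1)]] V_H10[OF Vw(1)[OF s(1)]]
    note H1 = H10[THEN H10_H1]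
    let ?w = "w s" and ?v = "v s" and ?u = "u s"
    have w_eq: "?w = (\<lambda>x. ?v x - ?u x)" by (simp add: w_def fun_eq_iff)
    have ev: "l2_inner \<Omega> (v' s) ?w + \<alpha>\<^sup>2 * grad_inner (v' s) ?w = l2_inner \<Omega> h ?w - \<nu> * grad_inner ?v ?w - tri ?v ?v ?w"
      by (rule weak_solution_eq[OF eqv s(1) Vw(1)[OF s(1)]])
    have eu: "l2_inner \<Omega> (u' s) ?w + \<alpha>\<^sup>2 * grad_inner (u' s) ?w = l2_inner \<Omega> h ?w - 0 * grad_inner ?u ?w - tri ?u ?u ?w"
      by (rule weak_solution_eq[OF equ s(1) Vw(1)[OF s(1)]])
    have "l2_inner \<Omega> (w' s) ?w = l2_inner \<Omega> (v' s) ?w - l2_inner \<Omega> (u' s) ?w"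
      unfolding w'_def[abs_def] by (rule l2_inner_diff_left[OF V_L2[OF Vv(2)[OF s(1)]] V_L2[OF Vu(2)[OF s(1)]] V_L2[OF Vw(1)[OF s(1)]]])
    moreover have "\<alpha>\<^sup>2 * grad_inner (w' s) ?w = \<alpha>\<^sup>2 * grad_inner (v' s) ?w - \<alpha>\<^sup>2 * grad_inner (u' s) ?w"
      unfolding w'_def[abs_def] grad_inner_diff_left[OF V_H1[OF Vv(2)[OF s(1)]] V_H1[OF Vu(2)[OF s(1)]] H1(3)]
      by (rule right_diff_distrib)
    \<comment> \<open>The difference (v . nabla) v - (u . nabla) u equals (v . nabla) w + (w .
      nabla) u, and the first summand is orthogonal to w.\<close>
    moreover have "tri ?v ?v ?w - tri ?u ?u ?w = tri ?w ?u ?w"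
    proof -
      have "tri ?w ?u ?w = tri ?v ?u ?w - tri ?u ?u ?w"
        unfolding w_eq[THEN arg_cong, of "\<lambda>z. tri z ?u ?w"] by (rule tri_diff_left[OF H10(1,2) H1(2) H10(3)])
      moreover have "tri ?v ?w ?w = tri ?v ?v ?w - tri ?v ?u ?w"
        unfolding w_eq[THEN arg_cong, of "\<lambda>z. tri ?v z ?w"] by (rule tri_diff_middle[OF H10(1) H1(1,2) H10(3)])
      moreover have "tri ?v ?w ?w = 0" by (rule tri_self[OF Vv(1)[OF s(1)] H10(3)])
      ultimately show ?thesis by linarith
    qed
    \<comment> \<open>The difference of the two tested equations, isolated as arithmetic of real
      numbers; the forcing \<open>p\<close> cancels.\<close>
    moreover have "2 * (a + b) = - 2 * n - 2 * z"
      if "a = a1 - a2" "b = b1 - b2" "z1 - z2 = z" "a1 + b1 = p - n - z1" "a2 + b2 = p - 0 * k - z2"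
      for a b n z a1 a2 b1 b2 z1 z2 p k :: real
      using that by simp
    ultimately have "E' s = - 2 * (\<nu> * grad_inner ?v ?w) - 2 * tri ?w ?u ?w"
      using ev eu unfolding E'_def by blast
    also have "\<dots> \<le> 2 * (\<nu> * V_norm \<Omega> ?v) * V_norm \<Omega> ?w + 2 * (V_norm \<Omega> ?u * (c * (V_norm \<Omega> ?w)\<^sup>2))"
    proof -
      have "- (\<nu> * grad_inner ?v ?w) \<le> \<nu> * (V_norm \<Omega> ?v * V_norm \<Omega> ?w)"
      proof -
        have "- grad_inner ?v ?w \<le> V_norm \<Omega> ?v * V_norm \<Omega> ?w"
          using grad_inner_Cauchy_Schwarz[OF H1(1,3)] by linarith
        from mult_left_mono[OF this, of \<nu>] show ?thesis using \<nu> by simp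
      qed
      moreover have "\<bar>tri ?w ?u ?w\<bar> \<le> V_norm \<Omega> ?u * L4_bound ?w"
        using tri_bound[OF H10(3) H1(2) H10(3)] by (simp add: L4_bound_nonneg)
      moreover have "V_norm \<Omega> ?u * L4_bound ?w \<le> V_norm \<Omega> ?u * (c * (V_norm \<Omega> ?w)\<^sup>2)"
        unfolding c_def by (intro mult_left_mono L4_bound_le Vw s V_norm_nonneg)
      ultimately show ?thesis by linarith
    qed
    also have "2 * (\<nu> * V_norm \<Omega> ?v) * V_norm \<Omega> ?w \<le> (\<nu> * V_norm \<Omega> ?v)\<^sup>2 + (V_norm \<Omega> ?w)\<^sup>2"
      by (rule sum_squares_bound)
    also have "(\<nu> * V_norm \<Omega> ?v)\<^sup>2 \<le> \<nu>\<^sup>2 * (?D * exp T)"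
      unfolding power_mult_distrib using \<nu> by (intro mult_left_mono V_norm_weak_solution_le[OF \<alpha> _ h v0 v s]) auto
    also have "2 * (V_norm \<Omega> ?u * (c * (V_norm \<Omega> ?w)\<^sup>2)) \<le> 2 * (sqrt ?D * exp (T / 2) * (c * (V_norm \<Omega> ?w)\<^sup>2))"
    proof -
      \<comment> \<open>The root of the energy bound for \<nu> = 0 is the origin of the square root
        of \<open>D_const\<close> and of exp (T/2).\<close>
      have "V_norm \<Omega> ?u \<le> sqrt (?D * exp T)"
        by (rule real_le_rsqrt[OF V_norm_weak_solution_le[OF \<alpha> order_refl h v0 u0 s]])
      also have "\<dots> = sqrt ?D * exp (T / 2)"
      proof -
        have "exp T = (exp (T / 2))\<^sup>2" by (simp add: power2_eq_square flip: exp_add)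
        then show ?thesis by (simp add: real_sqrt_mult)
      qed
      finally show ?thesis using c by (intro mult_left_mono mult_right_mono) auto
    qed
    finally have *: "E' s \<le> \<nu>\<^sup>2 * (?D * exp T) + (V_norm \<Omega> ?w)\<^sup>2 + 2 * (sqrt ?D * exp (T / 2) * (c * (V_norm \<Omega> ?w)\<^sup>2))"
      by (simp only: add.assoc)
    have "E' s \<le> \<nu>\<^sup>2 * ?D * exp T + K * (\<alpha>\<^sup>2 * (V_norm \<Omega> ?w)\<^sup>2)"
    proof -
      have "(1 / q + 2 * c / q * a * b) * (q * y) = y + 2 * (a * b * (c * y))" if "q \<noteq> 0" for q a b y
        using that by (simp add: field_simps)
      from this[of "\<alpha>\<^sup>2"] have "K * (\<alpha>\<^sup>2 * (V_norm \<Omega> ?w)\<^sup>2)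
          = (V_norm \<Omega> ?w)\<^sup>2 + 2 * (sqrt ?D * exp (T / 2) * (c * (V_norm \<Omega> ?w)\<^sup>2))"
        unfolding K_def using \<alpha> by simp
      then show ?thesis using * by (simp only: mult.assoc add.assoc)
    qed
    also have "\<dots> \<le> \<nu>\<^sup>2 * ?D * exp T + K * E s"
      unfolding E_def using K by (intro add_left_mono mult_left_mono) auto
    finally show ?thesis .
  qed
  have a0: "0 \<le> \<nu>\<^sup>2 * ?D * exp T" using D by simp
  have "E t \<le> (E 0 + \<nu>\<^sup>2 * ?D * exp T * t) * exp (K * t)"
    by (rule Gronwall[OF der le a0 K t])
  also have "E 0 = 0"
  proof -
    \<comment> \<open>The two initial values coincide almost everywhere only; \<open>w 0\<close> is
      therefore compared with its multiple by 0, whose norms vanish by homogeneity.\<close>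
    have "AE x in lebesgue_on \<Omega>. w 0 x = 0 *\<^sub>R w 0 x"
      using initv initu by eventually_elim (simp add: w_def)
    moreover have "w 0 \<in> L2 \<Omega>" "w 0 \<in> H1 \<Omega>" by (simp_all add: V_L2 V_H1 Vw)
    ultimately have "l2_norm \<Omega> (w 0) = l2_norm \<Omega> (\<lambda>x. 0 *\<^sub>R w 0 x)" "V_norm \<Omega> (w 0) = V_norm \<Omega> (\<lambda>x. 0 *\<^sub>R w 0 x)"
      using l2_norm_cong_AE[OF _ _ L2_scaleR] V_norm_cong_AE[OF _ _ L2_scaleR] by blast+
    then show ?thesis
      unfolding E_def l2_norm_scaleR V_norm_scaleR[OF V_H1[OF Vw(1)[OF order_refl]]] by simp
  qed
  also have "(0 + \<nu>\<^sup>2 * ?D * exp T * t) * exp (K * t) \<le> (\<nu>\<^sup>2 * ?D * exp T * T) * exp (K * T)"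
    using t T K a0 by (intro mult_mono) (auto intro!: mult_left_mono)
  also have "\<dots> = \<nu>\<^sup>2 * T * ?D * exp T * exp (T / \<alpha>\<^sup>2 + 2 * sqrt 8 / \<alpha>\<^sup>2 * stokes_lambda1 \<Omega> powr (- 1/4) * T * sqrt ?D * exp (T / 2))"
  proof -
    have "K * T = T / \<alpha>\<^sup>2 + 2 * sqrt 8 / \<alpha>\<^sup>2 * stokes_lambda1 \<Omega> powr (- 1/4) * T * sqrt ?D * exp (T / 2)"
      unfolding K_def c_def by (simp add: algebra_simps)
    then show ?thesis by (simp add: mult_ac)
  qed
  finally show ?thesis unfolding E_def w_def[abs_def] .
qed

text \<open>The estimate is \<nu>^2 times a number \<open>X\<close> free of \<nu> and t, so the
  gradient norm is at most linear in \<nu> on the whole interval.\<close>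

lemma inviscid_limit_uniform:
  assumes \<alpha>: "\<alpha> > 0" and h: "h \<in> H_space \<Omega>" and v0: "v0 \<in> V_space \<Omega>"
    and v: "\<And>\<nu>. \<nu> > 0 \<Longrightarrow> NSV_weak_solution \<Omega> \<nu> \<alpha> h v0 (v \<nu>)" and u: "Bardina_weak_solution \<Omega> \<alpha> h v0 u"
  shows "uniform_limit {0..T} (\<lambda>\<nu> t. V_norm \<Omega> (\<lambda>x. v \<nu> t x - u t x)) (\<lambda>_. 0) (at_right 0)"
proof (cases "T \<ge> 0")
  case True
  define X where "X = T * D_const \<Omega> \<alpha> h v0 T * exp T * exp (T / \<alpha>\<^sup>2 + 2 * sqrt 8 / \<alpha>\<^sup>2 *
    stokes_lambda1 \<Omega> powr (- 1/4) * T * sqrt (D_const \<Omega> \<alpha> h v0 T) * exp (T / 2))"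
  have X: "X \<ge> 0" unfolding X_def using True D_const_nonneg[OF True] by simp
  have bound: "V_norm \<Omega> (\<lambda>x. v \<nu> t x - u t x) \<le> \<nu> * (sqrt X / \<alpha>)" if \<nu>: "\<nu> > 0" and t: "t \<in> {0..T}" for \<nu> t
  proof (rule power2_le_imp_le)
    have "(l2_norm \<Omega> (\<lambda>x. v \<nu> t x - u t x))\<^sup>2 + \<alpha>\<^sup>2 * (V_norm \<Omega> (\<lambda>x. v \<nu> t x - u t x))\<^sup>2 \<le> \<nu>\<^sup>2 * X"
      using inviscid_limit_estimate[OF \<alpha> \<nu> h v0 v[OF \<nu>] u, of t T] t
      unfolding X_def by (simp add: mult.assoc)
    then have "\<alpha>\<^sup>2 * (V_norm \<Omega> (\<lambda>x. v \<nu> t x - u t x))\<^sup>2 \<le> \<nu>\<^sup>2 * X"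
      using zero_le_power2[of "l2_norm \<Omega> (\<lambda>x. v \<nu> t x - u t x)"] by linarith
    then have "(V_norm \<Omega> (\<lambda>x. v \<nu> t x - u t x))\<^sup>2 \<le> \<nu>\<^sup>2 * X / \<alpha>\<^sup>2"
      using \<alpha> by (simp add: pos_le_divide_eq mult.commute)
    then show "(V_norm \<Omega> (\<lambda>x. v \<nu> t x - u t x))\<^sup>2 \<le> (\<nu> * (sqrt X / \<alpha>))\<^sup>2"
      using X by (simp add: power_mult_distrib power_divide)
    show "0 \<le> \<nu> * (sqrt X / \<alpha>)" using \<nu> \<alpha> X by simp
  qed
  show ?thesis
    unfolding uniform_limit_iff
  proof (intro allI impI)
    fix e :: real assume e: "e > 0"
    \<comment> \<open>The summand 1 keeps the denominator positive when
      \<open>X = 0\<close>.\<close>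
    define b where "b = e / (sqrt X / \<alpha> + 1)"
    have q: "sqrt X / \<alpha> + 1 > 0" using X \<alpha> by (simp add: add_nonneg_pos)
    have b: "b > 0" using e q by (simp add: b_def)
    have "eventually (\<lambda>\<nu>. 0 < \<nu> \<and> \<nu> < b) (at_right 0)"
      using b eventually_at_right_field[of _ "0::real"] by blast
    then show "eventually (\<lambda>\<nu>. \<forall>t\<in>{0..T}. dist (V_norm \<Omega> (\<lambda>x. v \<nu> t x - u t x)) 0 < e) (at_right 0)"
    proof eventually_elim
      case (elim \<nu>)
      have "\<nu> * (sqrt X / \<alpha>) < e"
      proof -
        have "\<nu> * (sqrt X / \<alpha>) < \<nu> * (sqrt X / \<alpha> + 1)"
          using elim by (intro mult_strict_left_mono) auto
        also have "\<dots> < b * (sqrt X / \<alpha> + 1)" using elim q by (intro mult_strict_right_mono) auto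
        also have "\<dots> = e" using q by (simp add: b_def)
        finally show ?thesis .
      qed
      then have "V_norm \<Omega> (\<lambda>x. v \<nu> t x - u t x) < e" if "t \<in> {0..T}" for t
        using bound[OF conjunct1[OF elim] that] by linarith
      then show ?case by (simp add: dist_real_def V_norm_nonneg)
    qed
  qed
qed (simp add: uniform_limit_iff)

end

section \<open>The inviscid limit\<close>

theorem mainTheorem4:
  fixes \<Omega> :: "(real ^ 3) set"
  assumes "bounded_smooth_domain \<Omega>"
  shows
    "(\<forall>\<alpha> h v0 v u.
        \<alpha> > 0 \<longrightarrow> h \<in> H_space \<Omega> \<longrightarrow> v0 \<in> V_space \<Omega> \<longrightarrow>
        (\<forall>\<nu>>0. NSV_weak_solution \<Omega> \<nu> \<alpha> h v0 (v \<nu>)) \<longrightarrow>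
        Bardina_weak_solution \<Omega> \<alpha> h v0 u \<longrightarrow>
        (\<forall>T>0. uniform_limit {0..T} (\<lambda>\<nu> t. V_norm \<Omega> (\<lambda>x. v \<nu> t x - u t x)) (\<lambda>_. 0) (at_right 0)))
     \<and>
     (\<exists>C>0. \<forall>r>0. \<forall>\<Omega>'. \<Omega>' = (\<lambda>x. r *\<^sub>R x) ` \<Omega> \<longrightarrow>
        (\<forall>\<alpha> h v0 \<nu> v u T t.
           \<alpha> > 0 \<longrightarrow> h \<in> H_space \<Omega>' \<longrightarrow> v0 \<in> V_space \<Omega>' \<longrightarrow> \<nu> > 0 \<longrightarrow>
           NSV_weak_solution \<Omega>' \<nu> \<alpha> h v0 v \<longrightarrow>
           Bardina_weak_solution \<Omega>' \<alpha> h v0 u \<longrightarrow>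
           T > 0 \<longrightarrow> t \<in> {0..T} \<longrightarrow>
           (l2_norm \<Omega>' (\<lambda>x. v t x - u t x))\<^sup>2 + \<alpha>\<^sup>2 * (V_norm \<Omega>' (\<lambda>x. v t x - u t x))\<^sup>2
           \<le> \<nu>\<^sup>2 * T * D_const \<Omega>' \<alpha> h v0 T * exp T *
              exp (T / \<alpha>\<^sup>2 +
                   2 * C / \<alpha>\<^sup>2 * stokes_lambda1 \<Omega>' powr (- 1/4) * T *
                   sqrt (D_const \<Omega>' \<alpha> h v0 T) * exp (T / 2))))"
proof -
  have \<Omega>: "open \<Omega>" "bounded \<Omega>" using assms by (auto simp: bounded_smooth_domain_def)
  interpret bounded_open \<Omega> by unfold_locales (rule \<Omega>)+
  \<comment> \<open>A rescaled domain is again open and bounded, so the estimate applies to it with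
    the same constant sqrt 8.\<close>
  have scaled: "bounded_open ((\<lambda>x. r *\<^sub>R x) ` \<Omega>)" if "r > 0" for r :: real
    using \<Omega> that by unfold_locales (auto intro: open_scaling bounded_scaling)
  show ?thesis
  proof (intro conjI exI[of _ "sqrt 8"] allI impI, goal_cases)
    case (1 \<alpha> h v0 v u T)
    then show ?case by (intro inviscid_limit_uniform) blast+
  next
    case (3 r \<Omega>' \<alpha> h v0 \<nu> v u T t)
    then interpret scaled: bounded_open \<Omega>' using scaled by simp
    show ?case using 3 by (intro scaled.inviscid_limit_estimate) auto
  qed simp
qed

end
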